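(* Let $k \ge 2$ be an integer, $\rho \in [0,1]$ and $\varepsilon > 0$. There exists an explicitly computable $n_0 = n_0(\rho,k,\varepsilon)$ with $n_0 \le \exp\left(\mathrm{poly}\left(k, \frac{1}{1-\rho}, \frac{1}{\varepsilon}\right)\right)$ such that the following holds. For any $n \in \mathbb{N}$ and any measurable $f : \mathbb{R}^n \to \Delta_k$, there exists a function $\widetilde{f} : \mathbb{R}^{n_0} \to \Delta_k$ such that (1) $\left\| \mathbb{E}[f] - \mathbb{E}[\widetilde{f}] \right\|_1 \le \varepsilon$ (expectations with respect to $\gamma_n$ and $\gamma_{n_0}$ respectively), and (2) $\mathrm{Stab}_\rho(\widetilde{f}) \ge \mathrm{Stab}_\rho(f) - \varepsilon$. Moreover, there exists an explicitly computable $d_0 = d_0(\rho,k,\varepsilon) \le \mathrm{poly}\left(k, \frac{1}{1-\rho}, \frac{1}{\varepsilon}\right)$ and a polynomial $g : \mathbb{R}^{n_0} \to \mathbb{R}^k$ of degree $d_0$ such that $\widetilde{f}(\mathbf{a}) = \mathcal{R}\left(g\left(\frac{\mathbf{a}}{\|\mathbf{a}\|_2}\right)\right)$.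
   Context: $\gamma_n$ denotes the standard Gaussian measure on $\mathbb{R}^n$. $\Delta_k = \{v \in \mathbb{R}^k : v_i \ge 0, \sum_i v_i = 1\}$ is the probability simplex. The rounding operator $\mathcal{R} : \mathbb{R}^k \to \Delta_k$ maps each $v \in \mathbb{R}^k$ to its (Euclidean) closest point in $\Delta_k$. For $f = (f_1,\dots,f_k) : \mathbb{R}^n \to \mathbb{R}^k$, the Ornstein–Uhlenbeck operator acts coordinatewise by $(U_\rho f_i)(\mathbf{X}) = \int_{\mathbb{R}^n} f_i(\rho \mathbf{X} + \sqrt{1-\rho^2}\mathbf{Z})\, d\gamma_n(\mathbf{Z})$, and the noise stability is $\mathrm{Stab}_\rho(f) = \mathbb{E}_{\mathbf{X} \sim \gamma_n}[\langle f(\mathbf{X}), U_\rho f(\mathbf{X})\rangle]$, where $\langle\cdot,\cdot\rangle$ is the standard inner product on $\mathbb{R}^k$. *)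

theory Defs
  imports "HOL-Probability.Probability" "HOL-Library.Poly_Mapping"
begin

text \<open>
  The dimensions \<open>n\<close>, \<open>k\<close> and \<open>n\<^sub>0\<close> are quantified inside the statement, so \<open>\<real>\<^sup>n\<close> is represented
  by the extensional functions \<open>{..<n} \<rightarrow>\<^sub>E UNIV\<close>, which form the space of the product
  measures \<open>PiM {..<n} _\<close>.
\<close>

definition gauss :: "nat \<Rightarrow> (nat \<Rightarrow> real) measure" where
  "gauss n = PiM {..<n} (\<lambda>_. std_normal_distribution)"

definition prob_simplex :: "nat \<Rightarrow> (nat \<Rightarrow> real) set" where
  "prob_simplex k = {v \<in> {..<k} \<rightarrow>\<^sub>E UNIV. (\<forall>i<k. 0 \<le> v i) \<and> (\<Sum>i<k. v i) = 1}"

definition rounding :: "nat \<Rightarrow> (nat \<Rightarrow> real) \<Rightarrow> (nat \<Rightarrow> real)" where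
  "rounding k v = arg_min_on (\<lambda>w. L2_set (\<lambda>i. v i - w i) {..<k}) (prob_simplex k)"

definition measurable_simplex_fun ::
  "nat \<Rightarrow> nat \<Rightarrow> ((nat \<Rightarrow> real) \<Rightarrow> (nat \<Rightarrow> real)) \<Rightarrow> bool" where
  "measurable_simplex_fun n k f \<longleftrightarrow>
     f \<in> gauss n \<rightarrow>\<^sub>M PiM {..<k} (\<lambda>_. borel) \<and> f \<in> space (gauss n) \<rightarrow> prob_simplex k"

definition ornstein_uhlenbeck ::
  "nat \<Rightarrow> real \<Rightarrow> ((nat \<Rightarrow> real) \<Rightarrow> real) \<Rightarrow> (nat \<Rightarrow> real) \<Rightarrow> real" where
  "ornstein_uhlenbeck n \<rho> h x =
     (\<integral>z. h (\<lambda>i\<in>{..<n}. \<rho> * x i + sqrt (1 - \<rho>\<^sup>2) * z i) \<partial>gauss n)"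

definition noise_stability ::
  "nat \<Rightarrow> nat \<Rightarrow> real \<Rightarrow> ((nat \<Rightarrow> real) \<Rightarrow> (nat \<Rightarrow> real)) \<Rightarrow> real" where
  "noise_stability n k \<rho> f =
     (\<integral>x. (\<Sum>i<k. f x i * ornstein_uhlenbeck n \<rho> (\<lambda>y. f y i) x) \<partial>gauss n)"

definition unit_vector :: "nat \<Rightarrow> (nat \<Rightarrow> real) \<Rightarrow> (nat \<Rightarrow> real)" where
  "unit_vector n a = (\<lambda>i\<in>{..<n}. a i / L2_set a {..<n})"

text \<open>
  A real polynomial is a finitely supported map from monomials to coefficients, a monomial
  being a finitely supported map from variable indices to exponents.
\<close>

type_synonym mpoly = "(nat \<Rightarrow>\<^sub>0 nat) \<Rightarrow>\<^sub>0 real"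

definition mpoly_in :: "nat \<Rightarrow> mpoly \<Rightarrow> bool" where
  "mpoly_in n p \<longleftrightarrow> (\<forall>m \<in> Poly_Mapping.keys p. Poly_Mapping.keys m \<subseteq> {..<n})"

definition mpoly_eval :: "mpoly \<Rightarrow> (nat \<Rightarrow> real) \<Rightarrow> real" where
  "mpoly_eval p x = (\<Sum>m\<in>Poly_Mapping.keys p. Poly_Mapping.lookup p m *
     (\<Prod>i\<in>Poly_Mapping.keys m. x i ^ Poly_Mapping.lookup m i))"

definition mpoly_degree :: "mpoly \<Rightarrow> nat" where
  "mpoly_degree p = Max (insert 0
     ((\<lambda>m. \<Sum>i\<in>Poly_Mapping.keys m. Poly_Mapping.lookup m i) ` Poly_Mapping.keys p))"

text \<open>
  A polynomial \<open>\<real>\<^sup>n \<rightarrow> \<real>\<^sup>k\<close> is a family of component polynomials \<open>g i\<close> for \<open>i < k\<close>; its degree is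
  the largest degree of a component.
\<close>

definition poly_map_of_degree :: "nat \<Rightarrow> nat \<Rightarrow> nat \<Rightarrow> (nat \<Rightarrow> mpoly) \<Rightarrow> bool" where
  "poly_map_of_degree n k d g \<longleftrightarrow>
     (\<forall>i<k. mpoly_in n (g i)) \<and> Max ((\<lambda>i. mpoly_degree (g i)) ` {..<k}) = d"

definition poly_map_eval :: "nat \<Rightarrow> (nat \<Rightarrow> mpoly) \<Rightarrow> (nat \<Rightarrow> real) \<Rightarrow> (nat \<Rightarrow> real)" where
  "poly_map_eval k g x = (\<lambda>i\<in>{..<k}. mpoly_eval (g i) x)"

text \<open>
  Total recursive functions of arity \<open>n\<close>; only the values on lists of length \<open>n\<close> are meaningful.
  Minimisation is restricted to regular functions, which by Kleene's normal form theorem still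
  yields all total computable functions.
\<close>

inductive recursive_fun :: "nat \<Rightarrow> (nat list \<Rightarrow> nat) \<Rightarrow> bool" where
  zero: "recursive_fun n (\<lambda>_. 0)"
| succ: "recursive_fun 1 (\<lambda>xs. Suc (xs ! 0))"
| proj: "i < n \<Longrightarrow> recursive_fun n (\<lambda>xs. xs ! i)"
| comp: "recursive_fun (length fs) g \<Longrightarrow> (\<forall>f\<in>set fs. recursive_fun n f) \<Longrightarrow>
    recursive_fun n (\<lambda>xs. g (map (\<lambda>f. f xs) fs))"
| prec: "recursive_fun n f \<Longrightarrow> recursive_fun (n + 2) g \<Longrightarrow>
    recursive_fun (Suc n)
      (\<lambda>xs. rec_nat (f (tl xs)) (\<lambda>y r. g (r # y # tl xs)) (hd xs))"
| mu: "recursive_fun (Suc n) f \<Longrightarrow> (\<forall>xs. length xs = n \<longrightarrow> (\<exists>y. f (y # xs) = 0)) \<Longrightarrow>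
    recursive_fun n (\<lambda>xs. LEAST y. f (y # xs) = 0)"

text \<open>
  Computability of a function \<open>h \<rho> k \<epsilon>\<close> of real parameters \<open>\<rho> \<in> [0,1]\<close>, \<open>\<epsilon> > 0\<close> and \<open>k \<ge> 2\<close>: on
  rational inputs \<open>\<rho> = p / q\<close>, \<open>\<epsilon> = r / s\<close>, its value is computed from \<open>p, q, k, r, s\<close>. (An
  integer-valued function computable from Cauchy names of real arguments would have to be
  constant in \<open>\<rho>\<close> and \<open>\<epsilon>\<close>.)
\<close>

definition computable_param :: "(real \<Rightarrow> nat \<Rightarrow> real \<Rightarrow> nat) \<Rightarrow> bool" where
  "computable_param h \<longleftrightarrow>
     (\<exists>N. recursive_fun 5 N \<and>
        (\<forall>p q k r s. 0 < q \<and> p \<le> q \<and> 2 \<le> k \<and> 0 < r \<and> 0 < s \<longrightarrow>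
           h (real p / real q) k (real r / real s) = N [p, q, k, r, s]))"

end

theory Submission
  imports Defs
begin

text \<open>
  Let \<open>S\<^sub>t\<close> be the noise stability of \<open>f\<close> at correlation \<open>t\<close> and let \<open>M\<close> be an \<open>n \<times> D\<close> matrix with
  independent standard Gaussian entries. For unit vectors \<open>u, v\<close> the points \<open>M u, M v\<close> are standard
  Gaussians with correlation \<open>\<langle>u, v\<rangle>\<close>, so \<open>E \<langle>f (M u), f (M v)\<rangle> = S\<^sub>t\<close> for \<open>t = \<langle>u, v\<rangle>\<close>. Two things follow.

  First, \<open>(u, v) \<mapsto> S\<^sub>t\<close> is positive definite on every sphere. Suitable finite configurations of
  unit vectors give the properties of \<open>t \<mapsto> S\<^sub>t\<close> that are needed, without Hermite expansions: it is
  nondecreasing on \<open>[0, 1]\<close>, the sequence \<open>j \<mapsto> S\<close> at \<open>\<tau> ^ j\<close> is convex, and \<open>\<bar>S\<^sub>t - S\<^sub>0\<bar> = O(\<bar>t\<bar>)\<close>. Hence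
  \<open>S\<^sub>t\<close> is almost \<open>S\<^sub>\<rho>\<close> as soon as \<open>t\<close> is not much smaller than \<open>\<rho>\<close>, uniformly in \<open>n\<close> and \<open>f\<close>.

  Second, for fixed \<open>M\<close> let \<open>f'\<close> be the average of \<open>f (M y)\<close> over the unit sphere, weighted with the
  density proportional to \<open>(1 + \<langle>a / \<parallel>a\<parallel>, y\<rangle>) ^ d\<close>. This is a polynomial of degree \<open>d\<close> in \<open>a / \<parallel>a\<parallel>\<close> with
  values in the simplex, on which \<open>rounding\<close> is the identity, and the weight is concentrated near
  \<open>a / \<parallel>a\<parallel>\<close> once \<open>d\<close> is large compared to \<open>D\<^sup>2\<close>. The expected stability of \<open>f'\<close> over \<open>M\<close> is an average
  of \<open>S\<^sub>t\<close> over values \<open>t\<close> that concentrate at \<open>\<rho>\<close>, and the mean of \<open>f'\<close> has small variance. Only a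
  lower bound on the stability is required, so averaging a linear combination of the stability and
  the squared error of the mean produces a good \<open>M\<close>, already with \<open>D\<close> polynomial in the parameters.

  For \<open>\<rho> = 1\<close> the function \<open>f\<close> is first replaced by a partition of the real line into intervals with
  the same mean, which is almost perfectly stable also for some \<open>\<rho> < 1\<close>.
\<close>

section \<open>Rotation invariance of Gaussian measures\<close>

text \<open>Nothing is known about \<open>f\<close> beyond measurability, and no bound may depend on
  \<open>n\<close>. Uniformity comes from two facts: \<open>\<phi>\<close>, the function t \<mapsto>
  S_t, takes values in [0, 1], and its positive definiteness holds on spheres of every dimension,
  whatever \<open>n\<close> is. Boundedness then turns a convex sequence or a large orthonormal
  family into a rate such as 1 / m or 1 / sqrt N.

  Both errors of a random \<open>M\<close> become averages of \<open>\<phi>\<close> at random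
  correlations: the stability involves two directions with correlation near \<rho>, the squared
  error of the mean two independent directions, whose correlation is near 0. One \<open>M\<close>
  has to serve both purposes. As stability never exceeds 1, a large multiple of the squared error in
  the linear combination forces that error to be small.

  This cannot reach \<rho> = 1. There the stability is E |f|^2, and for each correlation below 1 a
  sufficiently oscillating \<open>f\<close> loses a fixed amount of it, so no modulus of continuity
  is uniform in \<open>f\<close>. The case is saved by the trivial bound 1 on the stability, which a
  partition into few intervals nearly attains.\<close>

abbreviation std_normal ("\<N>") where
  "\<N> \<equiv> std_normal_distribution"

abbreviation Rn :: "nat \<Rightarrow> (nat \<Rightarrow> real) measure" where
  "Rn n \<equiv> PiM {..<n} (\<lambda>_. borel)"

lemma prob_space_normal [simp]: "prob_space \<N>"
  by (rule prob_space_normal_density) simp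

lemma sigma_finite_normal [simp]: "sigma_finite_measure \<N>"
  by (simp add: prob_space_imp_sigma_finite)

interpretation normal: prob_space \<N>
  by simp

interpretation normal_pair: pair_prob_space \<N> \<N>
  by (simp add: pair_prob_space_def pair_sigma_finite_def)

interpretation normal_prod: product_sigma_finite "\<lambda>_::nat. \<N>"
  by (simp add: product_sigma_finite_def)

lemma sets_gauss [measurable_cong]: "sets (gauss n) = sets (Rn n)"
  unfolding gauss_def by (rule sets_PiM_cong) auto

lemma space_gauss: "space (gauss n) = {..<n} \<rightarrow>\<^sub>E UNIV"
  by (simp add: gauss_def space_PiM)

interpretation gauss: prob_space "gauss n" for n
  unfolding gauss_def by (rule prob_space_PiM) simp

interpretation gauss_prod: product_sigma_finite "\<lambda>_::nat. gauss D" for D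
  by (simp add: product_sigma_finite_def gauss.sigma_finite_measure_axioms)

lemma nn_integral_gauss_Suc:
  assumes [measurable]: "F \<in> borel_measurable (Rn (Suc D))"
  shows "(\<integral>\<^sup>+m. F m \<partial>gauss (Suc D)) =
    (\<integral>\<^sup>+x. \<integral>\<^sup>+m. F (m(D := x)) \<partial>gauss D \<partial>\<N>)"
proof -
  have "F \<in> borel_measurable (Pi\<^sub>M (insert D {..<D}) (\<lambda>_. \<N>))"
    using sets_gauss[of "Suc D"] assms unfolding gauss_def lessThan_Suc[symmetric]
    by (subst measurable_cong_sets) auto
  then show ?thesis
    unfolding gauss_def lessThan_Suc by (subst normal_prod.product_nn_integral_insert_rev) simp_all
qed

lemma nn_integral_normal:
  assumes [measurable]: "F \<in> borel_measurable borel"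
  shows "(\<integral>\<^sup>+x. F x \<partial>\<N>) = (\<integral>\<^sup>+x. ennreal (std_normal_density x) * F x \<partial>lborel)"
  by (subst nn_integral_density) auto

lemma nn_integral_normal_uminus:
  assumes [measurable]: "F \<in> borel_measurable borel"
  shows "(\<integral>\<^sup>+x. F (- x) \<partial>\<N>) = (\<integral>\<^sup>+x. F x \<partial>\<N>)"
  by (simp add: nn_integral_normal, subst (2) nn_integral_real_affine[where c="-1" and t=0])
    (auto simp: std_normal_density_def)

lemma nn_integral_normal_swap:
  fixes F :: "real \<times> real \<Rightarrow> ennreal"
  assumes [measurable]: "F \<in> borel_measurable (borel \<Otimes>\<^sub>M borel)"
  shows "(\<integral>\<^sup>+x. \<integral>\<^sup>+y. F (x, y) \<partial>\<N> \<partial>\<N>) =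
    (\<integral>\<^sup>+y. \<integral>\<^sup>+x. F (x, y) \<partial>\<N> \<partial>\<N>)"
  by (subst normal_pair.Fubini') simp_all

text \<open>Two one-dimensional affine substitutions perform the change of variables: the first
  turns the first argument of \<open>F\<close> into a variable and leaves a factor 1 / |c|, the
  second acts on the other argument and absorbs it. The density depends on
  \<open>x\<^sup>2 + y\<^sup>2\<close> only. Since \<open>c\<close> is divided by, quarter turns are
  treated apart, as a swap followed by a reflection.\<close>

lemma nn_integral_normal_rotate:
  fixes F :: "real \<times> real \<Rightarrow> ennreal"
  assumes [measurable]: "F \<in> borel_measurable (borel \<Otimes>\<^sub>M borel)" and cs: "c\<^sup>2 + s\<^sup>2 = 1"
  shows "(\<integral>\<^sup>+x. \<integral>\<^sup>+y. F (x, y) \<partial>\<N> \<partial>\<N>) =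
    (\<integral>\<^sup>+x. \<integral>\<^sup>+y. F (c * x - s * y, s * x + c * y) \<partial>\<N> \<partial>\<N>)"
    (is "?L = ?R")
proof (cases "c = 0")
  case True
  then have "s = 1 \<or> s = -1" using cs by (simp add: power2_eq_1_iff)
  then show ?thesis
  proof
    assume s: "s = 1"
    have "?R = (\<integral>\<^sup>+x. \<integral>\<^sup>+y. F (- y, x) \<partial>\<N> \<partial>\<N>)"
      using True s by simp
    also have "\<dots> = (\<integral>\<^sup>+x. \<integral>\<^sup>+y. F (y, x) \<partial>\<N> \<partial>\<N>)"
      by (subst nn_integral_normal_uminus) simp_all
    finally show ?thesis using nn_integral_normal_swap[of F] by simp
  next
    assume s: "s = -1"
    have "?R = (\<integral>\<^sup>+x. \<integral>\<^sup>+y. F (y, - x) \<partial>\<N> \<partial>\<N>)"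
      using True s by simp
    also have "\<dots> = (\<integral>\<^sup>+x. \<integral>\<^sup>+y. F (y, x) \<partial>\<N> \<partial>\<N>)"
      by (rule nn_integral_normal_uminus[of "\<lambda>x. \<integral>\<^sup>+y. F (y, x) \<partial>\<N>"]) simp
    finally show ?thesis using nn_integral_normal_swap[of F] by simp
  qed
next
  case False
  define p where "p x y = ennreal (1 / (2 * pi) * exp (- (x\<^sup>2 + y\<^sup>2) / 2))" for x y :: real
  have [measurable]: "case_prod p \<in> borel_measurable (borel \<Otimes>\<^sub>M borel)"
    unfolding p_def by measurable
  have den: "ennreal (std_normal_density x) * (ennreal (std_normal_density y) * a) = p x y * a" for x y a
  proof -
    have "std_normal_density x * std_normal_density y = 1 / (2 * pi) * exp (- (x\<^sup>2 + y\<^sup>2) / 2)"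
      by (simp add: std_normal_density_def field_simps flip: exp_add)
    then show ?thesis
      by (simp add: p_def mult.assoc[symmetric] flip: ennreal_mult)
  qed
  have lb: "(\<integral>\<^sup>+x. \<integral>\<^sup>+y. G x y \<partial>\<N> \<partial>\<N>) =
    (\<integral>\<^sup>+x. \<integral>\<^sup>+y. p x y * G x y \<partial>lborel \<partial>lborel)"
    if [measurable]: "case_prod G \<in> borel_measurable (borel \<Otimes>\<^sub>M borel)" for G
    by (simp add: nn_integral_normal nn_integral_cmult[symmetric] den)
  have inv: "p (c * x - s * y) (s * x + c * y) = p x y" for x y
  proof -
    have "(c * x - s * y)\<^sup>2 + (s * x + c * y)\<^sup>2 = (c\<^sup>2 + s\<^sup>2) * (x\<^sup>2 + y\<^sup>2)"
      by (simp add: power2_eq_square algebra_simps)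
    then show ?thesis using cs by (simp add: p_def)
  qed
  define H where "H x y = p x y * F (x, y)" for x y
  have [measurable]: "case_prod H \<in> borel_measurable (borel \<Otimes>\<^sub>M borel)"
    unfolding H_def by measurable
  have eq1: "c * (s * y / c + 1 / c * x) - s * y = x" for x y
    using False by (simp add: field_simps)
  have eq2: "s * (s * y / c + 1 / c * x) + c * y = s / c * x + 1 / c * y" for x y
  proof -
    have "s * (s * y / c + 1 / c * x) + c * y = s / c * x + ((c\<^sup>2 + s\<^sup>2) / c) * y"
      using False by (simp add: field_simps power2_eq_square)
    then show ?thesis using cs by simp
  qed
  have "?R = (\<integral>\<^sup>+x. \<integral>\<^sup>+y. p x y * F (c * x - s * y, s * x + c * y) \<partial>lborel \<partial>lborel)"
    by (subst lb) simp_all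
  also have "\<dots> = (\<integral>\<^sup>+x. \<integral>\<^sup>+y. H (c * x - s * y) (s * x + c * y) \<partial>lborel \<partial>lborel)"
    by (simp add: H_def inv)
  also have "\<dots> = (\<integral>\<^sup>+y. \<integral>\<^sup>+x. H (c * x - s * y) (s * x + c * y) \<partial>lborel \<partial>lborel)"
    by (subst lborel_pair.Fubini') simp_all
  also have "\<dots> = (\<integral>\<^sup>+y. ennreal \<bar>1/c\<bar> * (\<integral>\<^sup>+x. H x ((s / c) * x + (1 / c) * y) \<partial>lborel) \<partial>lborel)"
  proof (rule nn_integral_cong)
    fix y
    have "(\<integral>\<^sup>+x. H (c * x - s * y) (s * x + c * y) \<partial>lborel) =
      \<bar>1/c\<bar> * (\<integral>\<^sup>+x. H (c * (s * y / c + (1/c) * x) - s * y) (s * (s * y / c + (1/c) * x) + c * y) \<partial>lborel)"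
      using False by (subst nn_integral_real_affine[where c="1/c" and t="s * y / c"]) auto
    also have "\<dots> = \<bar>1/c\<bar> * (\<integral>\<^sup>+x. H x ((s / c) * x + (1 / c) * y) \<partial>lborel)"
      by (simp only: eq1 eq2)
    finally show "(\<integral>\<^sup>+x. H (c * x - s * y) (s * x + c * y) \<partial>lborel) =
      ennreal \<bar>1/c\<bar> * (\<integral>\<^sup>+x. H x ((s / c) * x + (1 / c) * y) \<partial>lborel)" .
  qed
  also have "\<dots> = ennreal \<bar>1/c\<bar> * (\<integral>\<^sup>+y. \<integral>\<^sup>+x. H x ((s / c) * x + (1 / c) * y) \<partial>lborel \<partial>lborel)"
    by (subst nn_integral_cmult) simp_all
  also have "\<dots> = ennreal \<bar>1/c\<bar> * (\<integral>\<^sup>+x. \<integral>\<^sup>+y. H x ((s / c) * x + (1 / c) * y) \<partial>lborel \<partial>lborel)"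
    by (subst lborel_pair.Fubini') simp_all
  also have "\<dots> = (\<integral>\<^sup>+x. ennreal \<bar>1/c\<bar> * (\<integral>\<^sup>+y. H x ((s / c) * x + (1 / c) * y) \<partial>lborel) \<partial>lborel)"
    by (subst nn_integral_cmult) simp_all
  also have "\<dots> = (\<integral>\<^sup>+x. \<integral>\<^sup>+y. H x y \<partial>lborel \<partial>lborel)"
    using False by (intro nn_integral_cong nn_integral_real_affine[symmetric]) auto
  also have "\<dots> = ?L"
    unfolding H_def by (subst lb) simp_all
  finally show ?thesis ..
qed

definition ip :: "nat \<Rightarrow> (nat \<Rightarrow> real) \<Rightarrow> (nat \<Rightarrow> real) \<Rightarrow> real" where
  "ip D u v = (\<Sum>i<D. u i * v i)"

lemma ip_Suc_upd [simp]: "ip (Suc D) (m(D := x)) u = ip D m u + x * u D"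
  by (simp add: ip_def)

lemma ip_upd_right [simp]: "ip D u (m(D := x)) = ip D u m"
  by (simp add: ip_def)

lemma ip_Suc: "ip (Suc D) u v = ip D u v + u D * v D"
  by (simp add: ip_def)

lemma ip_commute: "ip D u v = ip D v u"
  by (simp add: ip_def mult.commute)

lemma ip_self_nonneg [simp]: "0 \<le> ip D u u"
  by (simp add: ip_def sum_nonneg)

lemma measurable_ip [measurable (raw)]:
  assumes "\<And>i. i < D \<Longrightarrow> (\<lambda>w. u w i) \<in> borel_measurable M"
    and "\<And>i. i < D \<Longrightarrow> (\<lambda>w. v w i) \<in> borel_measurable M"
  shows "(\<lambda>w. ip D (u w) (v w)) \<in> borel_measurable M"
  unfolding ip_def using assms by (intro borel_measurable_sum borel_measurable_times) auto

text \<open>Supplies the angles of the plane rotations below; the zero vector gets the angle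
  0.\<close>

lemma polar_coordinates_plane:
  fixes a b :: real
  obtains c s where "c\<^sup>2 + s\<^sup>2 = 1" "a = sqrt (a\<^sup>2 + b\<^sup>2) * c" "b = sqrt (a\<^sup>2 + b\<^sup>2) * s"
proof (cases "a\<^sup>2 + b\<^sup>2 = 0")
  case True
  then have "a = 0" "b = 0" by (simp_all add: add_nonneg_eq_0_iff)
  then show ?thesis using that[of 1 0] by simp
next
  case False
  then have "0 < a\<^sup>2 + b\<^sup>2" by (simp add: order_less_le)
  then show ?thesis
    using that[of "a / sqrt (a\<^sup>2 + b\<^sup>2)" "b / sqrt (a\<^sup>2 + b\<^sup>2)"] False
    by (auto simp: power_divide simp flip: add_divide_distrib)
qed

text \<open>\<alpha>, \<beta>, \<gamma> are the entries of a Cholesky factor of the Gram matrix of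
  \<open>u\<close> and \<open>v\<close>. Each new coordinate is absorbed into the triangular form by
  two plane rotations, as in a Givens elimination. They are existentially quantified because the
  Gram matrix does not determine \<beta> when \<alpha> = 0.\<close>

lemma nn_integral_gauss_two_functionals_ex:
  "\<exists>\<alpha> \<beta> \<gamma>. 0 \<le> \<alpha> \<and> 0 \<le> \<gamma> \<and> \<alpha>\<^sup>2 = ip D u u \<and> \<alpha> * \<beta> = ip D u v \<and> \<beta>\<^sup>2 + \<gamma>\<^sup>2 = ip D v v \<and>
    (\<forall>F :: real \<times> real \<Rightarrow> ennreal. F \<in> borel_measurable (borel \<Otimes>\<^sub>M borel) \<longrightarrow>
      (\<integral>\<^sup>+m. F (ip D m u, ip D m v) \<partial>gauss D) =
      (\<integral>\<^sup>+x. \<integral>\<^sup>+z. F (\<alpha> * x, \<beta> * x + \<gamma> * z) \<partial>\<N> \<partial>\<N>))"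
proof (induction D)
  case 0
  show ?case
    by (rule exI[of _ 0])+ (simp add: ip_def gauss.emeasure_space_1 normal.emeasure_space_1
      del: space_density)
next
  case (Suc D)
  then obtain \<alpha> \<beta> \<gamma> where abc: "0 \<le> \<alpha>" "0 \<le> \<gamma>" "\<alpha>\<^sup>2 = ip D u u" "\<alpha> * \<beta> = ip D u v" "\<beta>\<^sup>2 + \<gamma>\<^sup>2 = ip D v v"
    and IH: "\<And>F :: real \<times> real \<Rightarrow> ennreal. F \<in> borel_measurable (borel \<Otimes>\<^sub>M borel) \<Longrightarrow>
      (\<integral>\<^sup>+m. F (ip D m u, ip D m v) \<partial>gauss D) =
      (\<integral>\<^sup>+x. \<integral>\<^sup>+z. F (\<alpha> * x, \<beta> * x + \<gamma> * z) \<partial>\<N> \<partial>\<N>)"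
    by blast
  define \<alpha>' where "\<alpha>' = sqrt (\<alpha>\<^sup>2 + (u D)\<^sup>2)"
  obtain c s where cs: "c\<^sup>2 + s\<^sup>2 = 1" "\<alpha> = \<alpha>' * c" "u D = \<alpha>' * s"
    using polar_coordinates_plane[of \<alpha> "u D"] unfolding \<alpha>'_def by metis
  define \<beta>' where "\<beta>' = \<beta> * c + v D * s"
  define \<delta> where "\<delta> = v D * c - \<beta> * s"
  define \<gamma>' where "\<gamma>' = sqrt (\<gamma>\<^sup>2 + \<delta>\<^sup>2)"
  obtain c2 s2 where cs2: "c2\<^sup>2 + s2\<^sup>2 = 1" "\<gamma> = \<gamma>' * c2" "\<delta> = \<gamma>' * s2"
    using polar_coordinates_plane[of \<gamma> \<delta>] unfolding \<gamma>'_def by metis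
  have c2: "c\<^sup>2 = 1 - s\<^sup>2" "c2\<^sup>2 = 1 - s2\<^sup>2" using cs cs2 by auto
  have "0 \<le> \<alpha>'" "0 \<le> \<gamma>'" by (simp_all add: \<alpha>'_def \<gamma>'_def)
  moreover have "\<alpha>'\<^sup>2 = ip (Suc D) u u"
    by (simp add: \<alpha>'_def abc(3) ip_Suc power2_eq_square[of "u D"])
  moreover have "\<alpha>' * \<beta>' = ip (Suc D) u v"
  proof -
    have "\<alpha>' * \<beta>' = (\<alpha>' * c) * \<beta> + (\<alpha>' * s) * v D"
      by (simp add: \<beta>'_def algebra_simps)
    then show ?thesis by (simp add: ip_Suc abc flip: cs(2,3))
  qed
  moreover have "\<beta>'\<^sup>2 + \<gamma>'\<^sup>2 = ip (Suc D) v v"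
  proof -
    have "\<beta>'\<^sup>2 + \<delta>\<^sup>2 = (\<beta>\<^sup>2 + (v D)\<^sup>2) * (c\<^sup>2 + s\<^sup>2)"
      by (simp add: \<beta>'_def \<delta>_def power2_eq_square algebra_simps)
    then show ?thesis
      using abc(5) cs(1) by (simp add: \<gamma>'_def ip_Suc power2_eq_square)
  qed
  moreover have "(\<integral>\<^sup>+m. F (ip (Suc D) m u, ip (Suc D) m v) \<partial>gauss (Suc D)) =
      (\<integral>\<^sup>+x. \<integral>\<^sup>+z. F (\<alpha>' * x, \<beta>' * x + \<gamma>' * z) \<partial>\<N> \<partial>\<N>)"
    if [measurable]: "F \<in> borel_measurable (borel \<Otimes>\<^sub>M borel)" for F :: "real \<times> real \<Rightarrow> ennreal"
  proof -
    let ?N = "\<N>"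
    have "(\<integral>\<^sup>+m. F (ip (Suc D) m u, ip (Suc D) m v) \<partial>gauss (Suc D)) =
      (\<integral>\<^sup>+y. \<integral>\<^sup>+m. F (ip D m u + y * u D, ip D m v + y * v D) \<partial>gauss D \<partial>?N)"
      by (subst nn_integral_gauss_Suc) simp_all
    also have "\<dots> = (\<integral>\<^sup>+y. \<integral>\<^sup>+x. \<integral>\<^sup>+z. F (\<alpha> * x + y * u D, \<beta> * x + \<gamma> * z + y * v D) \<partial>?N \<partial>?N \<partial>?N)"
      proof (rule nn_integral_cong)
      fix y
      show "(\<integral>\<^sup>+m. F (ip D m u + y * u D, ip D m v + y * v D) \<partial>gauss D) =
        (\<integral>\<^sup>+x. \<integral>\<^sup>+z. F (\<alpha> * x + y * u D, \<beta> * x + \<gamma> * z + y * v D) \<partial>?N \<partial>?N)"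
        using IH[of "\<lambda>p. F (fst p + y * u D, snd p + y * v D)"] by simp
    qed
    also have "\<dots> = (\<integral>\<^sup>+y. \<integral>\<^sup>+z. \<integral>\<^sup>+x. F (\<alpha> * x + y * u D, \<beta> * x + \<gamma> * z + y * v D) \<partial>?N \<partial>?N \<partial>?N)"
      by (intro nn_integral_cong normal_pair.Fubini') simp_all
    also have "\<dots> = (\<integral>\<^sup>+z. \<integral>\<^sup>+y. \<integral>\<^sup>+x. F (\<alpha> * x + y * u D, \<beta> * x + \<gamma> * z + y * v D) \<partial>?N \<partial>?N \<partial>?N)"
      by (intro normal_pair.Fubini') simp_all
    also have "\<dots> = (\<integral>\<^sup>+z. \<integral>\<^sup>+x. \<integral>\<^sup>+y. F (\<alpha> * x + y * u D, \<beta> * x + \<gamma> * z + y * v D) \<partial>?N \<partial>?N \<partial>?N)"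
      by (intro nn_integral_cong normal_pair.Fubini') simp_all
    \<comment> \<open>Rotating the old variable \<open>x\<close> against the new coordinate
      \<open>y\<close> removes \<open>y\<close> from the first functional; what remains of it in the
      second has coefficient \<delta>.\<close>
    also have "\<dots> = (\<integral>\<^sup>+z. \<integral>\<^sup>+x. \<integral>\<^sup>+y. F (\<alpha>' * x, \<beta>' * x + \<gamma> * z + \<delta> * y) \<partial>?N \<partial>?N \<partial>?N)"
    proof (rule nn_integral_cong)
      fix z
      have 1: "\<alpha> * (c * x - s * y) + (s * x + c * y) * u D = \<alpha>' * x" for x y
      proof -
        have "\<alpha> * (c * x - s * y) + (s * x + c * y) * u D = \<alpha>' * ((c\<^sup>2 + s\<^sup>2) * x)"
          unfolding cs(3) by (subst cs(2)) (simp add: algebra_simps power2_eq_square)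
        then show ?thesis by (simp add: cs)
      qed
      have 2: "\<beta> * (c * x - s * y) + \<gamma> * z + (s * x + c * y) * v D = \<beta>' * x + \<gamma> * z + \<delta> * y" for x y
        by (simp add: \<beta>'_def \<delta>_def algebra_simps)
      show "(\<integral>\<^sup>+x. \<integral>\<^sup>+y. F (\<alpha> * x + y * u D, \<beta> * x + \<gamma> * z + y * v D) \<partial>?N \<partial>?N) =
        (\<integral>\<^sup>+x. \<integral>\<^sup>+y. F (\<alpha>' * x, \<beta>' * x + \<gamma> * z + \<delta> * y) \<partial>?N \<partial>?N)"
        using nn_integral_normal_rotate[of "\<lambda>(x, y). F (\<alpha> * x + y * u D, \<beta> * x + \<gamma> * z + y * v D)" c s]
          cs(1) by (simp add: 1 2)
    qed
    also have "\<dots> = (\<integral>\<^sup>+x. \<integral>\<^sup>+z. \<integral>\<^sup>+y. F (\<alpha>' * x, \<beta>' * x + \<gamma> * z + \<delta> * y) \<partial>?N \<partial>?N \<partial>?N)"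
      by (intro normal_pair.Fubini') simp_all
    \<comment> \<open>A second rotation merges \<gamma> z + \<delta> y into \<gamma>' z. Now
      \<open>y\<close> occurs nowhere and integrates to 1.\<close>
    also have "\<dots> = (\<integral>\<^sup>+x. \<integral>\<^sup>+z. \<integral>\<^sup>+y. F (\<alpha>' * x, \<beta>' * x + \<gamma>' * z) \<partial>?N \<partial>?N \<partial>?N)"
    proof (rule nn_integral_cong)
      fix x
      have 1: "\<beta>' * x + \<gamma> * (c2 * z - s2 * y) + \<delta> * (s2 * z + c2 * y) = \<beta>' * x + \<gamma>' * z" for z y
      proof -
        have "\<gamma> * (c2 * z - s2 * y) + \<delta> * (s2 * z + c2 * y) = \<gamma>' * ((c2\<^sup>2 + s2\<^sup>2) * z)"
          unfolding cs2(3) by (subst cs2(2)) (simp add: algebra_simps power2_eq_square)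
        then show ?thesis by (simp add: cs2)
      qed
      show "(\<integral>\<^sup>+z. \<integral>\<^sup>+y. F (\<alpha>' * x, \<beta>' * x + \<gamma> * z + \<delta> * y) \<partial>?N \<partial>?N) =
        (\<integral>\<^sup>+z. \<integral>\<^sup>+y. F (\<alpha>' * x, \<beta>' * x + \<gamma>' * z) \<partial>?N \<partial>?N)"
        using nn_integral_normal_rotate[of "\<lambda>(z, y). F (\<alpha>' * x, \<beta>' * x + \<gamma> * z + \<delta> * y)" c2 s2]
          cs2(1) by (simp add: 1)
    qed
    also have "\<dots> = (\<integral>\<^sup>+x. \<integral>\<^sup>+z. F (\<alpha>' * x, \<beta>' * x + \<gamma>' * z) \<partial>?N \<partial>?N)"
      by (simp add: normal.emeasure_space_1 del: space_density)
    finally show ?thesis .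
  qed
  ultimately show ?case by blast
qed

lemma nn_integral_gauss_two_functionals:
  fixes F :: "real \<times> real \<Rightarrow> ennreal"
  assumes "F \<in> borel_measurable (borel \<Otimes>\<^sub>M borel)" "ip D u u = 1" "ip D v v = 1"
  shows "(\<integral>\<^sup>+m. F (ip D m u, ip D m v) \<partial>gauss D) =
    (\<integral>\<^sup>+x. \<integral>\<^sup>+z. F (x, ip D u v * x + sqrt (1 - (ip D u v)\<^sup>2) * z)
      \<partial>\<N> \<partial>\<N>)"
proof -
  obtain \<alpha> \<beta> \<gamma> where abc: "0 \<le> \<alpha>" "0 \<le> \<gamma>" "\<alpha>\<^sup>2 = 1" "\<alpha> * \<beta> = ip D u v" "\<beta>\<^sup>2 + \<gamma>\<^sup>2 = 1"
    "(\<integral>\<^sup>+m. F (ip D m u, ip D m v) \<partial>gauss D) =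
      (\<integral>\<^sup>+x. \<integral>\<^sup>+z. F (\<alpha> * x, \<beta> * x + \<gamma> * z) \<partial>\<N> \<partial>\<N>)"
    using nn_integral_gauss_two_functionals_ex[of D u v] assms by auto
  have "\<alpha> = 1" using abc by (simp add: power2_eq_1_iff)
  moreover have "\<beta> = ip D u v" using abc \<open>\<alpha> = 1\<close> by simp
  moreover have "\<gamma> = sqrt (1 - \<beta>\<^sup>2)" using abc by (intro real_sqrt_unique[symmetric]) auto
  ultimately show ?thesis using abc(6) by simp
qed

text \<open>Rotation invariance for the pair of a linear functional and the squared norm: the law
  depends on \<open>x\<close> only through its length. Rotations of the plane preserve the sum of
  two squares, so the elimination above also keeps track of the norm.\<close>

lemma nn_integral_gauss_functional_norm:
  fixes F :: "real \<times> real \<Rightarrow> ennreal"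
  assumes "F \<in> borel_measurable (borel \<Otimes>\<^sub>M borel)"
  shows "(\<integral>\<^sup>+m. F (ip (Suc D) m x, ip (Suc D) m m) \<partial>gauss (Suc D)) =
    (\<integral>\<^sup>+r. \<integral>\<^sup>+m. F (sqrt (ip (Suc D) x x) * r, r * r + ip D m m) \<partial>gauss D \<partial>\<N>)"
  using assms
proof (induction D arbitrary: F)
  case 0
  note [measurable] = 0
  have "(\<integral>\<^sup>+m. F (ip (Suc 0) m x, ip (Suc 0) m m) \<partial>gauss (Suc 0)) =
      (\<integral>\<^sup>+r. F (r * x 0, r * r) \<partial>\<N>)"
    by (subst nn_integral_gauss_Suc)
      (simp_all add: ip_def gauss.emeasure_space_1)
  \<comment> \<open>In dimension 1 the only rotation left is the reflection, which corrects the sign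
    of \<open>x 0\<close>.\<close>
  also have "\<dots> = (\<integral>\<^sup>+r. F (\<bar>x 0\<bar> * r, r * r) \<partial>\<N>)"
    using nn_integral_normal_uminus[of "\<lambda>r. F (r * x 0, r * r)"]
    by (cases "x 0 \<ge> 0") (simp_all add: mult.commute)
  finally show ?case
    by (simp add: ip_def gauss.emeasure_space_1 real_sqrt_mult_self)
next
  case (Suc D)
  note [measurable] = Suc.prems
  let ?N = "\<N>"
  define \<alpha> where "\<alpha> = sqrt (ip (Suc D) x x)"
  define b where "b = x (Suc D)"
  define \<alpha>' where "\<alpha>' = sqrt (\<alpha>\<^sup>2 + b\<^sup>2)"
  obtain c s where cs: "c\<^sup>2 + s\<^sup>2 = 1" "\<alpha> = \<alpha>' * c" "b = \<alpha>' * s"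
    using polar_coordinates_plane[of \<alpha> b] unfolding \<alpha>'_def by metis
  have \<alpha>': "\<alpha>' = sqrt (ip (Suc (Suc D)) x x)"
    by (simp add: \<alpha>'_def \<alpha>_def b_def ip_Suc[of "Suc D"] power2_eq_square)
  have "(\<integral>\<^sup>+m. F (ip (Suc (Suc D)) m x, ip (Suc (Suc D)) m m) \<partial>gauss (Suc (Suc D))) =
    (\<integral>\<^sup>+y. \<integral>\<^sup>+m. F (ip (Suc D) m x + y * b, ip (Suc D) m m + y * y) \<partial>gauss (Suc D) \<partial>?N)"
    by (subst nn_integral_gauss_Suc) (simp_all add: b_def)
  also have "\<dots> = (\<integral>\<^sup>+y. \<integral>\<^sup>+r. \<integral>\<^sup>+m. F (\<alpha> * r + y * b, r * r + ip D m m + y * y) \<partial>gauss D \<partial>?N \<partial>?N)"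
  proof (rule nn_integral_cong)
    fix y
    show "(\<integral>\<^sup>+m. F (ip (Suc D) m x + y * b, ip (Suc D) m m + y * y) \<partial>gauss (Suc D)) =
      (\<integral>\<^sup>+r. \<integral>\<^sup>+m. F (\<alpha> * r + y * b, r * r + ip D m m + y * y) \<partial>gauss D \<partial>?N)"
      using Suc.IH[of "\<lambda>p. F (fst p + y * b, snd p + y * y)"] by (simp add: \<alpha>_def)
  qed
  also have "\<dots> = (\<integral>\<^sup>+r. \<integral>\<^sup>+y. \<integral>\<^sup>+m. F (\<alpha> * r + y * b, r * r + ip D m m + y * y) \<partial>gauss D \<partial>?N \<partial>?N)"
    by (intro normal_pair.Fubini') simp_all
  also have "\<dots> = (\<integral>\<^sup>+r. \<integral>\<^sup>+y. \<integral>\<^sup>+m. F (\<alpha>' * r, r * r + (ip D m m + y * y)) \<partial>gauss D \<partial>?N \<partial>?N)"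
  proof -
    have 1: "\<alpha> * (c * r - s * y) + (s * r + c * y) * b = \<alpha>' * r" for r y
    proof -
      have "\<alpha> * (c * r - s * y) + (s * r + c * y) * b = \<alpha>' * ((c\<^sup>2 + s\<^sup>2) * r)"
        unfolding cs(2,3) by (simp add: algebra_simps power2_eq_square)
      then show ?thesis by (simp add: cs(1))
    qed
    have 2: "(c * r - s * y) * (c * r - s * y) + w + (s * r + c * y) * (s * r + c * y) = r * r + (w + y * y)" for r y w
    proof -
      have "(c * r - s * y) * (c * r - s * y) + (s * r + c * y) * (s * r + c * y) = (c\<^sup>2 + s\<^sup>2) * (r * r + y * y)"
        by (simp add: power2_eq_square algebra_simps)
      then show ?thesis by (simp add: cs(1) algebra_simps)
    qed
    show ?thesis
      using nn_integral_normal_rotate[of "\<lambda>(r, y). \<integral>\<^sup>+m. F (\<alpha> * r + y * b, r * r + ip D m m + y * y) \<partial>gauss D" c s]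
        cs(1) by (simp add: 1 2)
  qed
  also have "\<dots> = (\<integral>\<^sup>+r. \<integral>\<^sup>+m. F (\<alpha>' * r, r * r + ip (Suc D) m m) \<partial>gauss (Suc D) \<partial>?N)"
    by (intro nn_integral_cong, subst nn_integral_gauss_Suc) simp_all
  finally show ?case unfolding \<alpha>' .
qed

section \<open>Gaussian matrices applied to unit vectors\<close>

definition mv :: "nat \<Rightarrow> nat \<Rightarrow> (nat \<Rightarrow> nat \<Rightarrow> real) \<Rightarrow> (nat \<Rightarrow> real) \<Rightarrow> (nat \<Rightarrow> real)" where
  "mv n D M y = (\<lambda>r\<in>{..<n}. ip D (M r) y)"

definition gmat :: "nat \<Rightarrow> nat \<Rightarrow> (nat \<Rightarrow> nat \<Rightarrow> real) measure" where
  "gmat n D = PiM {..<n} (\<lambda>_. gauss D)"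

definition ou_point :: "nat \<Rightarrow> real \<Rightarrow> (nat \<Rightarrow> real) \<Rightarrow> (nat \<Rightarrow> real) \<Rightarrow> (nat \<Rightarrow> real)" where
  "ou_point n t x z = (\<lambda>i\<in>{..<n}. t * x i + sqrt (1 - t\<^sup>2) * z i)"

interpretation gmat: prob_space "gmat n D" for n D
  unfolding gmat_def by (rule prob_space_PiM) unfold_locales

lemma measurable_gmat_component:
  assumes "r < n" "j < D"
  shows "(\<lambda>M. M r j) \<in> borel_measurable (gmat n D)"
proof -
  have "(\<lambda>M. M r) \<in> gmat n D \<rightarrow>\<^sub>M gauss D"
    unfolding gmat_def using assms by (intro measurable_component_singleton) simp
  moreover have "(\<lambda>m. m j) \<in> borel_measurable (gauss D)"
    using assms by (subst measurable_cong_sets[OF sets_gauss refl]) (simp add: measurable_component_singleton)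
  ultimately show ?thesis by (rule measurable_compose)
qed

interpretation gmat_normal: pair_prob_space "gmat n D" \<N> for n D
  by unfold_locales

interpretation gauss_normal: pair_prob_space "gauss n" \<N> for n
  by unfold_locales

lemma measurable_gauss_component [measurable (raw)]:
  assumes "x \<in> W \<rightarrow>\<^sub>M Rn n" "i < n"
  shows "(\<lambda>w. x w i :: real) \<in> borel_measurable W"
  using measurable_compose[OF assms(1) measurable_component_singleton[of i]] assms(2) by simp

lemma measurable_gmat_entry:
  assumes "M \<in> W \<rightarrow>\<^sub>M gmat n D" "r < n" "j < D"
  shows "(\<lambda>w. M w r j) \<in> borel_measurable W"
  by (rule measurable_compose[OF assms(1) measurable_gmat_component[OF assms(2,3)]])

lemma measurable_mv [measurable (raw)]:
  assumes "M \<in> W \<rightarrow>\<^sub>M gmat n D" "y \<in> W \<rightarrow>\<^sub>M Rn D"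
  shows "(\<lambda>w. mv n D (M w) (y w)) \<in> W \<rightarrow>\<^sub>M Rn n"
  unfolding mv_def
  by (intro measurable_restrict measurable_ip measurable_gmat_entry[OF assms(1)]
    measurable_gauss_component[OF assms(2)]) auto

lemma measurable_mv_fixed [measurable (raw)]:
  assumes "M \<in> W \<rightarrow>\<^sub>M gmat n D"
  shows "(\<lambda>w. mv n D (M w) u) \<in> W \<rightarrow>\<^sub>M Rn n"
  unfolding mv_def
  by (intro measurable_restrict measurable_ip measurable_gmat_entry[OF assms]) auto

lemma measurable_ou_point [measurable (raw)]:
  assumes [measurable]: "t \<in> borel_measurable W"
    "x \<in> W \<rightarrow>\<^sub>M Rn n" "z \<in> W \<rightarrow>\<^sub>M Rn n"
  shows "(\<lambda>w. ou_point n (t w) (x w) (z w)) \<in> W \<rightarrow>\<^sub>M Rn n"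
  unfolding ou_point_def by (rule measurable_restrict) measurable

lemma upd_in_mv: "mv (Suc n) D (M(n := m)) y = (mv n D M y)(n := ip D m y)"
  by (auto simp: mv_def fun_eq_iff restrict_def)

lemma ou_point_upd: "ou_point (Suc n) t (x(n := a)) (z(n := b)) = (ou_point n t x z)(n := t * a + sqrt (1 - t\<^sup>2) * b)"
  by (auto simp: ou_point_def fun_eq_iff restrict_def)

lemma measurable_upd_lessThan [measurable (raw)]:
  assumes "f \<in> W \<rightarrow>\<^sub>M Rn n" "g \<in> borel_measurable W"
  shows "(\<lambda>w. (f w)(n := g w :: real)) \<in> W \<rightarrow>\<^sub>M Rn (Suc n)"
proof -
  have "(\<lambda>(x, r). x(n := r)) \<in> Rn n \<Otimes>\<^sub>M borel \<rightarrow>\<^sub>M PiM {..<Suc n} (\<lambda>_. borel :: real measure)"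
    unfolding lessThan_Suc by (rule measurable_add_dim)
  from measurable_compose[OF measurable_Pair[OF assms] this] show ?thesis by simp
qed

text \<open>The rows of \<open>M\<close> are independent, and each row contributes one coordinate of
  both points, with the joint law given by the two-functional identity. The induction splits off the
  last row; all other steps reorder integrals until the split coordinate can be joined to the
  remaining ones.\<close>

lemma nn_integral_gmat_pair:
  fixes F :: "(nat \<Rightarrow> real) \<times> (nat \<Rightarrow> real) \<Rightarrow> ennreal"
  assumes "F \<in> borel_measurable (Rn n \<Otimes>\<^sub>M Rn n)"
    and "ip D u u = 1" "ip D v v = 1"
  shows "(\<integral>\<^sup>+M. F (mv n D M u, mv n D M v) \<partial>gmat n D) =
    (\<integral>\<^sup>+x. \<integral>\<^sup>+z. F (x, ou_point n (ip D u v) x z) \<partial>gauss n \<partial>gauss n)"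
  using assms(1)
proof (induction n arbitrary: F)
  case 0
  have 1: "mv 0 D M y = (\<lambda>_. undefined)" "ou_point 0 t x z = (\<lambda>_. undefined)" for M y t x z
    by (auto simp: mv_def ou_point_def)
  have "(\<integral>\<^sup>+x. F (x, \<lambda>_. undefined) \<partial>gauss 0) = (\<integral>\<^sup>+x. F (\<lambda>_. undefined, \<lambda>_. undefined) \<partial>gauss 0)"
    by (intro nn_integral_cong) (simp add: space_gauss)
  then show ?case
    by (simp add: 1 gmat.emeasure_space_1 gauss.emeasure_space_1)
next
  case (Suc n)
  note [measurable] = Suc.prems
  let ?N = "\<N>" and ?t = "ip D u v"
  have gm: "gmat n D = PiM {..<n} (\<lambda>_. gauss D)" "gmat (Suc n) D = PiM (insert n {..<n}) (\<lambda>_. gauss D)"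
    by (simp_all add: gmat_def lessThan_Suc)
  have gm: "gmat n D = PiM {..<n} (\<lambda>_. gauss D)" "gmat (Suc n) D = PiM (insert n {..<n}) (\<lambda>_. gauss D)"
    by (simp_all add: gmat_def lessThan_Suc)
  let ?G = "\<lambda>p q x0 z0. F (p(n := x0), q(n := ?t * x0 + sqrt (1 - ?t\<^sup>2) * z0))"
  have "(\<integral>\<^sup>+M. F (mv (Suc n) D M u, mv (Suc n) D M v) \<partial>gmat (Suc n) D) =
    (\<integral>\<^sup>+M. \<integral>\<^sup>+m. F ((mv n D M u)(n := ip D m u), (mv n D M v)(n := ip D m v)) \<partial>gauss D \<partial>gmat n D)"
  proof -
    have "(\<lambda>M. F (mv (Suc n) D M u, mv (Suc n) D M v)) \<in> borel_measurable (gmat (Suc n) D)"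
      by measurable
    then show ?thesis unfolding gm
      by (subst gauss_prod.product_nn_integral_insert) (simp_all add: upd_in_mv)
  qed
  also have "\<dots> = (\<integral>\<^sup>+M. \<integral>\<^sup>+x0. \<integral>\<^sup>+z0. ?G (mv n D M u) (mv n D M v) x0 z0 \<partial>?N \<partial>?N \<partial>gmat n D)"
  proof (rule nn_integral_cong)
    fix M
    have [simp]: "mv n D M y \<in> space (Rn n)" for y
      by (simp add: mv_def space_PiM)
    show "(\<integral>\<^sup>+m. F ((mv n D M u)(n := ip D m u), (mv n D M v)(n := ip D m v)) \<partial>gauss D) =
      (\<integral>\<^sup>+x0. \<integral>\<^sup>+z0. ?G (mv n D M u) (mv n D M v) x0 z0 \<partial>?N \<partial>?N)"
      using nn_integral_gauss_two_functionals[of "\<lambda>p. F ((mv n D M u)(n := fst p), (mv n D M v)(n := snd p))" D u v]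
        assms by simp
  qed
  also have "\<dots> = (\<integral>\<^sup>+x0. \<integral>\<^sup>+M. \<integral>\<^sup>+z0. ?G (mv n D M u) (mv n D M v) x0 z0 \<partial>?N \<partial>gmat n D \<partial>?N)"
    by (intro gmat_normal.Fubini'[symmetric]) simp_all
  also have "\<dots> = (\<integral>\<^sup>+x0. \<integral>\<^sup>+z0. \<integral>\<^sup>+M. ?G (mv n D M u) (mv n D M v) x0 z0 \<partial>gmat n D \<partial>?N \<partial>?N)"
    by (intro nn_integral_cong gmat_normal.Fubini'[symmetric]) simp_all
  also have "\<dots> = (\<integral>\<^sup>+x0. \<integral>\<^sup>+z0. \<integral>\<^sup>+x. \<integral>\<^sup>+z. ?G x (ou_point n ?t x z) x0 z0 \<partial>gauss n \<partial>gauss n \<partial>?N \<partial>?N)"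
  proof (intro nn_integral_cong)
    fix x0 z0
    show "(\<integral>\<^sup>+M. ?G (mv n D M u) (mv n D M v) x0 z0 \<partial>gmat n D) =
      (\<integral>\<^sup>+x. \<integral>\<^sup>+z. ?G x (ou_point n ?t x z) x0 z0 \<partial>gauss n \<partial>gauss n)"
      using Suc.IH[of "\<lambda>(p, q). ?G p q x0 z0"] by simp
  qed
  also have "\<dots> = (\<integral>\<^sup>+x0. \<integral>\<^sup>+x. \<integral>\<^sup>+z0. \<integral>\<^sup>+z. ?G x (ou_point n ?t x z) x0 z0 \<partial>gauss n \<partial>?N \<partial>gauss n \<partial>?N)"
    by (intro nn_integral_cong gauss_normal.Fubini') simp_all
  also have "\<dots> = (\<integral>\<^sup>+x0. \<integral>\<^sup>+x. \<integral>\<^sup>+z. F (x(n := x0), ou_point (Suc n) ?t (x(n := x0)) z)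
      \<partial>gauss (Suc n) \<partial>gauss n \<partial>?N)"
  proof (intro nn_integral_cong)
    fix x0 :: real and x assume "x \<in> space (gauss n)"
    then have "x(n := x0) \<in> space (Rn (Suc n))"
      by (auto simp: space_gauss space_PiM PiE_def extensional_def)
    then show "(\<integral>\<^sup>+z0. \<integral>\<^sup>+z. ?G x (ou_point n ?t x z) x0 z0 \<partial>gauss n \<partial>?N) =
      (\<integral>\<^sup>+z. F (x(n := x0), ou_point (Suc n) ?t (x(n := x0)) z) \<partial>gauss (Suc n))"
      by (subst nn_integral_gauss_Suc) (simp_all add: ou_point_upd)
  qed
  also have "\<dots> = (\<integral>\<^sup>+x. \<integral>\<^sup>+z. F (x, ou_point (Suc n) ?t x z) \<partial>gauss (Suc n) \<partial>gauss (Suc n))"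
    by (rule nn_integral_gauss_Suc[symmetric]) simp
  finally show ?case .
qed

section \<open>Noise stability as a positive definite kernel\<close>

lemma (in prob_space) integrable_bounded:
  fixes g :: "'a \<Rightarrow> real"
  assumes "g \<in> borel_measurable M" "\<And>x. x \<in> space M \<Longrightarrow> \<bar>g x\<bar> \<le> B"
  shows "integrable M g"
  using assms by (intro integrable_const_bound[where B = B]) auto

lemma (in prob_space) square_expectation_le:
  fixes g :: "'a \<Rightarrow> real"
  assumes [measurable]: "g \<in> borel_measurable M" and "\<And>x. x \<in> space M \<Longrightarrow> \<bar>g x\<bar> \<le> B"
  shows "(expectation g)\<^sup>2 \<le> expectation (\<lambda>x. (g x)\<^sup>2)"
proof -
  have "\<bar>(g x)\<^sup>2\<bar> \<le> B\<^sup>2" if "x \<in> space M" for x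
    using power_mono[OF assms(2)[OF that], of 2] by simp
  then have "integrable M g" "integrable M (\<lambda>x. (g x)\<^sup>2)"
    using assms by (auto intro!: integrable_bounded)
  then show ?thesis
    using variance_positive[of g] variance_eq[of g] by simp
qed

lemma integral_swap_bounded:
  fixes g :: "'a \<Rightarrow> 'b \<Rightarrow> real"
  assumes "prob_space P" "prob_space Q" "(\<lambda>(x, y). g x y) \<in> borel_measurable (P \<Otimes>\<^sub>M Q)"
    and "\<And>x y. x \<in> space P \<Longrightarrow> y \<in> space Q \<Longrightarrow> \<bar>g x y\<bar> \<le> B"
  shows "(\<integral>x. \<integral>y. g x y \<partial>Q \<partial>P) = (\<integral>y. \<integral>x. g x y \<partial>P \<partial>Q)"
proof -
  interpret P: prob_space P by fact
  interpret Q: prob_space Q by fact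
  interpret PQ: pair_prob_space P Q ..
  have "integrable (P \<Otimes>\<^sub>M Q) (\<lambda>(x, y). g x y)"
    using assms(3,4) by (intro PQ.P.integrable_bounded[of _ B]) (auto simp: space_pair_measure)
  then show ?thesis by (rule PQ.Fubini_integral[symmetric])
qed

lemma restrict_PiE_UNIV: "x \<in> {..<n} \<rightarrow>\<^sub>E UNIV \<Longrightarrow> (\<lambda>i\<in>{..<n}. x i) = x"
  by (auto simp: fun_eq_iff PiE_def extensional_def)

locale simplex_fun =
  fixes n k :: nat and f :: "(nat \<Rightarrow> real) \<Rightarrow> nat \<Rightarrow> real"
  assumes msf: "measurable_simplex_fun n k f"
begin

definition dot :: "(nat \<Rightarrow> real) \<Rightarrow> (nat \<Rightarrow> real) \<Rightarrow> real" where
  "dot x y = (\<Sum>i<k. f x i * f y i)"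

abbreviation \<phi> :: "real \<Rightarrow> real" where
  "\<phi> t \<equiv> noise_stability n k t f"

definition mean :: "nat \<Rightarrow> real" where
  "mean i = (\<integral>x. f x i \<partial>gauss n)"

lemma measurable_f [measurable]: "f \<in> Rn n \<rightarrow>\<^sub>M Rn k"
  using msf by (simp add: measurable_simplex_fun_def measurable_cong_sets[OF sets_gauss refl])

lemma measurable_dot [measurable (raw)]:
  assumes [measurable]: "g \<in> W \<rightarrow>\<^sub>M Rn n" "h \<in> W \<rightarrow>\<^sub>M Rn n"
  shows "(\<lambda>w. dot (g w) (h w)) \<in> borel_measurable W"
  unfolding dot_def by (intro borel_measurable_sum borel_measurable_times) measurable

lemma f_simplex: "x \<in> {..<n} \<rightarrow>\<^sub>E UNIV \<Longrightarrow> f x \<in> prob_simplex k"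
  using msf by (auto simp: measurable_simplex_fun_def space_gauss)

lemma f_bounds:
  assumes "x \<in> {..<n} \<rightarrow>\<^sub>E UNIV" "i < k"
  shows "0 \<le> f x i" "f x i \<le> 1"
proof -
  have *: "(\<Sum>i<k. f x i) = 1" "\<And>i. i < k \<Longrightarrow> 0 \<le> f x i"
    using f_simplex[OF assms(1)] by (auto simp: prob_simplex_def)
  then show "0 \<le> f x i" using assms by blast
  have "f x i \<le> (\<Sum>i<k. f x i)" using * assms by (intro member_le_sum) auto
  then show "f x i \<le> 1" using * by simp
qed

lemma dot_bounds:
  assumes "x \<in> {..<n} \<rightarrow>\<^sub>E UNIV" "y \<in> {..<n} \<rightarrow>\<^sub>E UNIV"
  shows "0 \<le> dot x y" "dot x y \<le> 1"
proof -
  show "0 \<le> dot x y" unfolding dot_def using assms by (intro sum_nonneg mult_nonneg_nonneg) (auto simp: f_bounds)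
  have "dot x y \<le> (\<Sum>i<k. f x i * 1)"
    unfolding dot_def using assms by (intro sum_mono mult_left_mono) (auto simp: f_bounds)
  also have "\<dots> = 1" using f_simplex[OF assms(1)] by (simp add: prob_simplex_def)
  finally show "dot x y \<le> 1" .
qed

lemma ou_point_in [simp]: "ou_point n t x z \<in> {..<n} \<rightarrow>\<^sub>E UNIV"
  by (simp add: ou_point_def)

lemma mv_in [simp]: "mv n D M y \<in> {..<n} \<rightarrow>\<^sub>E UNIV"
  by (simp add: mv_def)

lemma mean_bounds: "i < k \<Longrightarrow> 0 \<le> mean i" "i < k \<Longrightarrow> mean i \<le> 1"
proof -
  assume i: "i < k"
  show "0 \<le> mean i" unfolding mean_def
    using i by (intro integral_nonneg_AE AE_I2) (auto simp: f_bounds space_gauss)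
  have "mean i \<le> (\<integral>x. 1 \<partial>gauss n)" unfolding mean_def
    using i by (intro integral_mono gauss.integrable_bounded[of _ _ 1]) (auto simp: f_bounds space_gauss)
  then show "mean i \<le> 1" by (simp add: gauss.prob_space)
qed

lemma sum_mean: "(\<Sum>i<k. mean i) = 1"
proof -
  have "(\<Sum>i<k. mean i) = (\<integral>x. (\<Sum>i<k. f x i) \<partial>gauss n)"
    unfolding mean_def
    by (rule Bochner_Integration.integral_sum[symmetric])
      (auto intro!: gauss.integrable_bounded[of _ _ 1] simp: f_bounds space_gauss)
  also have "\<dots> = (\<integral>x. 1 \<partial>gauss n)"
    using f_simplex by (intro Bochner_Integration.integral_cong) (auto simp: space_gauss prob_simplex_def)
  finally show ?thesis by (simp add: gauss.prob_space)
qed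

lemma \<phi>_eq: "\<phi> t = (\<integral>x. \<integral>z. dot x (ou_point n t x z) \<partial>gauss n \<partial>gauss n)"
  unfolding noise_stability_def
proof (rule Bochner_Integration.integral_cong[OF refl])
  fix x assume x: "x \<in> space (gauss n)"
  have [measurable]: "x \<in> space (Rn n)" using x by (simp add: space_gauss space_PiM)
  have "(\<integral>z. dot x (ou_point n t x z) \<partial>gauss n) = (\<Sum>i<k. (\<integral>z. f x i * f (ou_point n t x z) i \<partial>gauss n))"
    unfolding dot_def
    by (rule Bochner_Integration.integral_sum)
      (auto intro!: gauss.integrable_bounded[of _ _ 1] integrable_mult_right simp: f_bounds)
  then show "(\<Sum>i<k. f x i * ornstein_uhlenbeck n t (\<lambda>y. f y i) x) = (\<integral>z. dot x (ou_point n t x z) \<partial>gauss n)"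
    by (simp add: ornstein_uhlenbeck_def ou_point_def)
qed

lemma integral_dot_bounds:
  assumes "x \<in> {..<n} \<rightarrow>\<^sub>E UNIV"
  shows "0 \<le> (\<integral>z. dot x (ou_point n t x z) \<partial>gauss n)" "(\<integral>z. dot x (ou_point n t x z) \<partial>gauss n) \<le> 1"
proof -
  show "0 \<le> (\<integral>z. dot x (ou_point n t x z) \<partial>gauss n)"
    using assms by (intro integral_nonneg_AE AE_I2) (auto simp: dot_bounds)
  have [measurable]: "x \<in> space (Rn n)" using assms by (simp add: space_PiM)
  have "integrable (gauss n) (\<lambda>z. dot x (ou_point n t x z))"
    using assms by (intro gauss.integrable_bounded[of _ _ 1]) (simp_all add: dot_bounds)
  then have "(\<integral>z. dot x (ou_point n t x z) \<partial>gauss n) \<le> (\<integral>z. 1 \<partial>gauss n)"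
    using assms by (intro integral_mono) (simp_all add: dot_bounds)
  then show "(\<integral>z. dot x (ou_point n t x z) \<partial>gauss n) \<le> 1" by (simp add: gauss.prob_space)
qed

lemma integrable_integral_dot:
  "integrable (gauss n) (\<lambda>x. \<integral>z. dot x (ou_point n t x z) \<partial>gauss n)"
  by (rule gauss.integrable_bounded[of _ _ 1]) (measurable, simp add: space_gauss integral_dot_bounds)

lemma \<phi>_nonneg: "0 \<le> \<phi> t"
  unfolding \<phi>_eq by (rule integral_nonneg_AE, rule AE_I2, rule integral_dot_bounds) (simp add: space_gauss)

lemma \<phi>_le_1: "\<phi> t \<le> 1"
proof -
  have "\<phi> t \<le> (\<integral>x. 1 \<partial>gauss n)"
    unfolding \<phi>_eq using integrable_integral_dot
    by (intro integral_mono) (simp_all add: space_gauss integral_dot_bounds)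
  then show ?thesis by (simp add: gauss.prob_space)
qed

text \<open>At correlation 0 the two points are independent. This is how the squared length of the
  mean enters estimates that speak of \<open>\<phi>\<close> only.\<close>

lemma \<phi>_zero: "\<phi> 0 = (\<Sum>i<k. (mean i)\<^sup>2)"
proof -
  have "ornstein_uhlenbeck n 0 (\<lambda>y. f y i) x = mean i" for i x
    unfolding ornstein_uhlenbeck_def mean_def
    by (intro Bochner_Integration.integral_cong) (simp_all add: space_gauss restrict_PiE_UNIV)
  then have "\<phi> 0 = (\<integral>x. (\<Sum>i<k. f x i * mean i) \<partial>gauss n)"
    by (simp add: noise_stability_def)
  also have "\<dots> = (\<Sum>i<k. (\<integral>x. f x i * mean i \<partial>gauss n))"
    by (rule Bochner_Integration.integral_sum)
      (auto intro!: gauss.integrable_bounded[of _ _ 1] integrable_mult_left simp: f_bounds space_gauss)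
  finally show ?thesis by (simp add: mean_def power2_eq_square)
qed

lemma integral_gmat_dot:
  assumes "ip D u u = 1" "ip D v v = 1"
  shows "(\<integral>M. dot (mv n D M u) (mv n D M v) \<partial>gmat n D) = \<phi> (ip D u v)"
proof -
  have "ennreal (\<phi> (ip D u v)) = (\<integral>\<^sup>+x. \<integral>\<^sup>+z. dot x (ou_point n (ip D u v) x z) \<partial>gauss n \<partial>gauss n)"
    unfolding \<phi>_eq
  proof (subst nn_integral_eq_integral[symmetric])
    show "integrable (gauss n) (\<lambda>x. \<integral>z. dot x (ou_point n (ip D u v) x z) \<partial>gauss n)"
      by (rule integrable_integral_dot)
    show "AE x in gauss n. 0 \<le> (\<integral>z. dot x (ou_point n (ip D u v) x z) \<partial>gauss n)"
      by (rule AE_I2, rule integral_dot_bounds) (simp add: space_gauss)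
    show "(\<integral>\<^sup>+x. ennreal (\<integral>z. dot x (ou_point n (ip D u v) x z) \<partial>gauss n) \<partial>gauss n) =
      (\<integral>\<^sup>+x. \<integral>\<^sup>+z. dot x (ou_point n (ip D u v) x z) \<partial>gauss n \<partial>gauss n)"
    proof (rule nn_integral_cong, rule nn_integral_eq_integral[symmetric])
      fix x assume x: "x \<in> space (gauss n)"
      then have [measurable]: "x \<in> space (Rn n)" by (simp add: space_gauss space_PiM)
      show "integrable (gauss n) (\<lambda>z. dot x (ou_point n (ip D u v) x z))"
        using x by (intro gauss.integrable_bounded[of _ _ 1]) (simp_all add: dot_bounds space_gauss)
      show "AE z in gauss n. 0 \<le> dot x (ou_point n (ip D u v) x z)"
        using x by (intro AE_I2) (simp_all add: dot_bounds space_gauss)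
    qed
  qed
  also have "\<dots> = (\<integral>\<^sup>+M. dot (mv n D M u) (mv n D M v) \<partial>gmat n D)"
    using nn_integral_gmat_pair[of "\<lambda>(x, y). ennreal (dot x y)" n D u v] assms by simp
  also have "\<dots> = ennreal (\<integral>M. dot (mv n D M u) (mv n D M v) \<partial>gmat n D)"
    by (rule nn_integral_eq_integral)
      (auto intro!: gmat.integrable_bounded[of _ _ _ 1] simp: dot_bounds)
  finally show ?thesis
    by (simp add: \<phi>_nonneg dot_bounds integral_nonneg_AE)
qed

lemma integral_gmat_f:
  assumes "ip D u u = 1" "i < k"
  shows "(\<integral>M. f (mv n D M u) i \<partial>gmat n D) = mean i"
proof -
  have "ennreal (mean i) = (\<integral>\<^sup>+x. \<integral>\<^sup>+z. f x i \<partial>gauss n \<partial>gauss n)"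
  proof -
    have "integrable (gauss n) (\<lambda>x. f x i)"
      using assms by (intro gauss.integrable_bounded[of _ _ 1]) (auto simp: f_bounds space_gauss)
    then have "(\<integral>\<^sup>+x. f x i \<partial>gauss n) = ennreal (mean i)"
      unfolding mean_def using assms
      by (intro nn_integral_eq_integral) (auto simp: f_bounds space_gauss)
    then show ?thesis by (simp add: gauss.emeasure_space_1)
  qed
  also have "\<dots> = (\<integral>\<^sup>+M. f (mv n D M u) i \<partial>gmat n D)"
    using nn_integral_gmat_pair[of "\<lambda>(x, y). ennreal (f x i)" n D u u] assms by simp
  also have "\<dots> = ennreal (\<integral>M. f (mv n D M u) i \<partial>gmat n D)"
    using assms by (intro nn_integral_eq_integral) (auto intro!: gmat.integrable_bounded[of _ _ _ 1] simp: f_bounds)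
  finally show ?thesis
    using assms by (simp add: mean_bounds f_bounds integral_nonneg_AE)
qed

text \<open>The right-hand side is the expected squared length of the sum of w_a f(M y_a), and the
  left-hand side is the squared length of its expectation. Keeping this term, instead of 0, is what
  allows weights with nonzero sum in the estimate near 0.\<close>

lemma \<phi>_pos_def:
  fixes y :: "'b \<Rightarrow> nat \<Rightarrow> real"
  assumes "finite I" and unit: "\<And>a. a \<in> I \<Longrightarrow> ip D (y a) (y a) = 1"
  shows "(\<Sum>a\<in>I. w a)\<^sup>2 * \<phi> 0 \<le> (\<Sum>a\<in>I. \<Sum>b\<in>I. w a * w b * \<phi> (ip D (y a) (y b)))"
proof -
  define S where "S i M = (\<Sum>a\<in>I. w a * f (mv n D M (y a)) i)" for i M
  define W where "W = (\<Sum>a\<in>I. \<bar>w a\<bar>)"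
  have [measurable]: "i < k \<Longrightarrow> S i \<in> borel_measurable (gmat n D)" for i
    unfolding S_def by measurable
  have bound: "\<bar>S i M\<bar> \<le> W" if "i < k" for i M
  proof -
    have "\<bar>S i M\<bar> \<le> (\<Sum>a\<in>I. \<bar>w a * f (mv n D M (y a)) i\<bar>)" unfolding S_def by (rule sum_abs)
    also have "\<dots> \<le> W" unfolding W_def
      using that by (intro sum_mono) (auto simp: abs_mult f_bounds intro!: mult_left_le)
    finally show ?thesis .
  qed
  have intf: "integrable (gmat n D) (\<lambda>M. f (mv n D M (y a)) i)" if "i < k" for i a
    using that by (intro gmat.integrable_bounded[of _ _ _ 1]) (auto simp: f_bounds)
  have intd: "integrable (gmat n D) (\<lambda>M. dot (mv n D M (y a)) (mv n D M (y b)))" for a b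
    by (intro gmat.integrable_bounded[of _ _ _ 1]) (auto simp: dot_bounds)
  have ES: "(\<integral>M. S i M \<partial>gmat n D) = (\<Sum>a\<in>I. w a) * mean i" if "i < k" for i
    unfolding S_def sum_distrib_right
    by (subst Bochner_Integration.integral_sum) (auto simp: that intf integral_gmat_f unit)
  have "(\<Sum>a\<in>I. w a)\<^sup>2 * \<phi> 0 = (\<Sum>i<k. (\<integral>M. S i M \<partial>gmat n D)\<^sup>2)"
    by (simp add: \<phi>_zero ES sum_distrib_left power_mult_distrib)
  also have "\<dots> \<le> (\<Sum>i<k. (\<integral>M. (S i M)\<^sup>2 \<partial>gmat n D))"
    using bound by (intro sum_mono gmat.square_expectation_le[of _ _ _ W]) auto
  also have "\<dots> = (\<integral>M. (\<Sum>i<k. (S i M)\<^sup>2) \<partial>gmat n D)"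
  proof (rule Bochner_Integration.integral_sum[symmetric])
    fix i assume "i \<in> {..<k}"
    then show "integrable (gmat n D) (\<lambda>M. (S i M)\<^sup>2)"
      using power_mono[OF bound[of i], of _ 2] by (intro gmat.integrable_bounded[of _ _ _ "W\<^sup>2"]) auto
  qed
  also have "\<dots> = (\<integral>M. (\<Sum>a\<in>I. \<Sum>b\<in>I. w a * w b * dot (mv n D M (y a)) (mv n D M (y b))) \<partial>gmat n D)"
  proof (rule Bochner_Integration.integral_cong[OF refl])
    fix M
    have "(\<Sum>i<k. (S i M)\<^sup>2) = (\<Sum>i<k. \<Sum>a\<in>I. \<Sum>b\<in>I. w a * w b * (f (mv n D M (y a)) i * f (mv n D M (y b)) i))"
      by (simp add: S_def power2_eq_square sum_product mult_ac)
    also have "\<dots> = (\<Sum>a\<in>I. \<Sum>i<k. \<Sum>b\<in>I. w a * w b * (f (mv n D M (y a)) i * f (mv n D M (y b)) i))"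
      by (rule sum.swap)
    also have "\<dots> = (\<Sum>a\<in>I. \<Sum>b\<in>I. \<Sum>i<k. w a * w b * (f (mv n D M (y a)) i * f (mv n D M (y b)) i))"
      by (intro sum.cong refl sum.swap)
    finally show "(\<Sum>i<k. (S i M)\<^sup>2) = (\<Sum>a\<in>I. \<Sum>b\<in>I. w a * w b * dot (mv n D M (y a)) (mv n D M (y b)))"
      by (simp add: dot_def sum_distrib_left)
  qed
  also have "\<dots> = (\<Sum>a\<in>I. \<Sum>b\<in>I. w a * w b * \<phi> (ip D (y a) (y b)))"
    by (simp add: Bochner_Integration.integral_sum intd integral_gmat_dot unit)
  finally show ?thesis .
qed

end

section \<open>Monotonicity, convexity and continuity of the noise stability\<close>

lemma sum_diagonal_two_values:
  "(\<Sum>i<N. \<Sum>j<N. if i = j then a else b) = real N * a + real N * (real N - 1) * b"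
proof -
  have "(\<Sum>i<N. \<Sum>j<N. if i = j then a else b) = (\<Sum>i<N. \<Sum>j<N. b + (if i = j then a - b else 0))"
    by (intro sum.cong refl) simp
  also have "\<dots> = real N * (real N * b) + real N * (a - b)"
    by (simp add: sum.distrib algebra_simps)
  finally show ?thesis by (simp add: algebra_simps)
qed

text \<open>With \<open>e = sqrt (1 - ip m p p)\<close> this lifts a point \<open>p\<close> of the
  unit ball to the sphere, and two lifts with different \<open>j\<close> still have inner product
  \<open>ip m p p\<close>.\<close>

definition extend_vec :: "nat \<Rightarrow> (nat \<Rightarrow> real) \<Rightarrow> nat \<Rightarrow> real \<Rightarrow> nat \<Rightarrow> real" where
  "extend_vec m p j e i = (if i < m then p i else if i = m + j then e else 0)"

lemma ip_extend_vec:
  assumes "j < L" "l < L"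
  shows "ip (m + L) (extend_vec m p j e) (extend_vec m q l e') = ip m p q + (if j = l then e * e' else 0)"
proof -
  have "{..<m + L} = {..<m} \<union> {m..<m + L}" by auto
  then have "ip (m + L) (extend_vec m p j e) (extend_vec m q l e') =
    ip m p q + (\<Sum>i\<in>{m..<m + L}. extend_vec m p j e i * extend_vec m q l e' i)"
    unfolding ip_def by (simp add: sum.union_disjoint ivl_disj_int extend_vec_def)
  also have "(\<Sum>i\<in>{m..<m + L}. extend_vec m p j e i * extend_vec m q l e' i) =
    (\<Sum>i\<in>{m..<m + L}. if i = m + j then (if j = l then e * e' else 0) else 0)"
    by (intro sum.cong) (auto simp: extend_vec_def)
  also have "\<dots> = (if j = l then e * e' else 0)" using assms by simp
  finally show ?thesis .
qed

lemma nonneg_if_archimedean_bound: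
  fixes a :: real
  assumes "\<And>N::nat. 0 < N \<Longrightarrow> - c / real N \<le> a" "0 \<le> c"
  shows "0 \<le> a"
proof (rule tendsto_upperbound[of "\<lambda>N. - c / real N" 0 sequentially a])
  show "(\<lambda>N. - c / real N) \<longlonglongrightarrow> 0" by real_asymp
  show "\<forall>\<^sub>F N in sequentially. - c / real N \<le> a"
    using assms by (intro eventually_sequentiallyI[of 1]) auto
qed simp

context simplex_fun
begin

text \<open>Extending \<open>p\<close> and \<open>q\<close> to unit vectors by pairwise different new coordinates, \<open>N\<close> times each, and
  letting \<open>N\<close> tend to infinity extends positive definiteness from the sphere to the ball.\<close>

lemma \<phi>_ball:
  assumes "ip m p p \<le> 1" "ip m q q \<le> 1"
  shows "2 * \<phi> (ip m p q) \<le> \<phi> (ip m p p) + \<phi> (ip m q q)"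
proof -
  define a b c where "a = \<phi> (ip m p p)" and "b = \<phi> (ip m q q)" and "c = \<phi> (ip m p q)"
  \<comment> \<open>Copies of \<open>p\<close> use the even new coordinates and copies of
    \<open>q\<close> the odd ones, so no coordinate is shared.\<close>
  define v where "v s l = (if s then extend_vec m p (2 * l) (sqrt (1 - ip m p p))
      else extend_vec m q (Suc (2 * l)) (sqrt (1 - ip m q q)))" for s :: bool and l :: nat
  define w :: "bool \<Rightarrow> real" where "w s = (if s then 1 else -1)" for s
  \<comment> \<open>Equal copies contribute 2 N values of \<open>\<phi>\<close> at 1, negligible
    against the N^2 pairs of different copies that carry \<open>a + b - 2 * c\<close>.\<close>
  have "- 2 / real N \<le> a + b - 2 * c" if N: "0 < N" for N
  proof -
    define D where "D = m + 2 * N"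
    have ipv: "ip D (v s j) (v s' l) = (if s = s' then (if j = l then 1 else if s then ip m p p else ip m q q) else ip m p q)"
      if "j < N" "l < N" for s s' j l
    proof -
      have *: "2 * j < 2 * N" "Suc (2 * j) < 2 * N" "2 * l < 2 * N" "Suc (2 * l) < 2 * N"
        "2 * j \<noteq> Suc (2 * l)" "Suc (2 * j) \<noteq> 2 * l" using that by presburger+
      show ?thesis
        using assms * by (cases s; cases s') (simp_all add: v_def D_def ip_extend_vec ip_commute[of m q p])
    qed
    have "(\<Sum>x\<in>UNIV \<times> {..<N}. w (fst x))\<^sup>2 * \<phi> 0 \<le>
      (\<Sum>x\<in>UNIV \<times> {..<N}. \<Sum>y\<in>UNIV \<times> {..<N}. w (fst x) * w (fst y) * \<phi> (ip D (case_prod v x) (case_prod v y)))"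
      by (rule \<phi>_pos_def) (auto simp: ipv)
    also have "\<dots> = (\<Sum>s\<in>UNIV. \<Sum>s'\<in>UNIV. w s * w s' * (\<Sum>j<N. \<Sum>l<N. \<phi> (ip D (v s j) (v s' l))))"
    proof -
      have "(\<Sum>x\<in>UNIV \<times> {..<N}. \<Sum>y\<in>UNIV \<times> {..<N}. w (fst x) * w (fst y) * \<phi> (ip D (case_prod v x) (case_prod v y))) =
        (\<Sum>s\<in>UNIV. \<Sum>j<N. \<Sum>s'\<in>UNIV. \<Sum>l<N. w s * w s' * \<phi> (ip D (v s j) (v s' l)))"
        by (simp add: sum.cartesian_product')
      also have "\<dots> = (\<Sum>s\<in>UNIV. \<Sum>s'\<in>UNIV. \<Sum>j<N. \<Sum>l<N. w s * w s' * \<phi> (ip D (v s j) (v s' l)))"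
        by (intro sum.cong refl sum.swap)
      finally show ?thesis by (simp add: sum_distrib_left)
    qed
    also have "\<dots> = (\<Sum>s\<in>UNIV. \<Sum>s'\<in>UNIV. w s * w s' * (\<Sum>j<N. \<Sum>l<N. if s = s' then (if j = l then \<phi> 1 else if s then a else b) else c))"
      by (intro sum.cong refl arg_cong2[of _ _ _ _ "(*)"]) (auto simp: ipv a_def b_def c_def)
    also have "\<dots> = real N * \<phi> 1 + real N * (real N - 1) * a + (real N * \<phi> 1 + real N * (real N - 1) * b) - 2 * (real N * (real N * c))"
      by (simp add: UNIV_bool w_def sum_diagonal_two_values)
    also have "(\<Sum>x\<in>UNIV \<times> {..<N}. w (fst x)) = 0"
      by (simp add: sum.cartesian_product' UNIV_bool w_def)
    finally have "0 \<le> real N * (2 * \<phi> 1 - a - b + real N * (a + b - 2 * c))"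
      by (simp add: algebra_simps)
    then have "0 \<le> 2 * \<phi> 1 - a - b + real N * (a + b - 2 * c)"
      using N by (simp add: zero_le_mult_iff)
    moreover have "\<phi> 1 \<le> 1" "0 \<le> a" "0 \<le> b" by (simp_all add: \<phi>_le_1 \<phi>_nonneg a_def b_def)
    ultimately have "- 2 \<le> (a + b - 2 * c) * real N" by (simp add: mult.commute)
    then show ?thesis using N by (subst pos_divide_le_eq) simp_all
  qed
  from nonneg_if_archimedean_bound[OF this] show ?thesis by (simp add: a_def b_def c_def)
qed

text \<open>The ball of dimension 1. In terms of log t this is midpoint convexity of
  \<open>\<phi>\<close>.\<close>

lemma \<phi>_midpoint:
  assumes "0 \<le> x" "x \<le> 1" "0 \<le> y" "y \<le> 1"
  shows "2 * \<phi> (x * y) \<le> \<phi> (x\<^sup>2) + \<phi> (y\<^sup>2)"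
  using \<phi>_ball[of 1 "\<lambda>_. x" "\<lambda>_. y"] assms by (simp add: ip_def power2_eq_square mult_le_one)

text \<open>Two vectors in the plane of squared length \<open>t\<close> and inner product
  \<open>s\<close> are fed into \<open>\<phi>_ball\<close>, whose right-hand side is then twice the
  value at \<open>t\<close>.\<close>

lemma \<phi>_mono:
  assumes "0 \<le> s" "s \<le> t" "t \<le> 1"
  shows "\<phi> s \<le> \<phi> t"
proof (cases "t = 0")
  case False
  define p where "p i = (if i = 0 then sqrt t else 0)" for i :: nat
  define q where "q i = (if i = 0 then s / sqrt t else sqrt (t - s\<^sup>2 / t))" for i :: nat
  have t: "0 < t" using assms False by simp
  have "s * s \<le> t * t" using assms by (intro mult_mono) auto
  then have "s\<^sup>2 / t \<le> t" using t by (simp add: divide_le_eq power2_eq_square)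
  then have "ip 2 p p = t" "ip 2 q q = t" "ip 2 p q = s"
    using t by (simp_all add: ip_def p_def q_def numeral_2_eq_2 power2_eq_square)
  then show ?thesis using \<phi>_ball[of 2 p q] assms by simp
qed (use assms in simp)

text \<open>A unit vector that has inner product \<open>t\<close> with \<open>N\<close> orthonormal ones is tested against their sum.\<close>

lemma \<phi>_near_zero:
  assumes "0 < N" "real N * t\<^sup>2 \<le> 1"
  shows "\<bar>\<phi> t - \<phi> 0\<bar> \<le> 1 / sqrt N"
proof -
  define u where "u i = (if i < N then t else sqrt (1 - real N * t\<^sup>2))" for i
  define e :: "nat \<Rightarrow> nat \<Rightarrow> real" where "e j i = (if i = j then 1 else 0)" for j i
  define y where "y j = (if j < N then e j else u)" for j
  have ipu: "ip (Suc N) u u = 1"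
    using assms by (simp add: ip_def u_def power2_eq_square)
  have ipe: "ip (Suc N) (e j) v = v j" "ip (Suc N) v (e j) = v j" if "j < N" for j v
    using that by (simp_all add: ip_def e_def if_distrib if_distribR sum.delta cong: if_cong)
  have *: "\<sigma> * (\<phi> t - \<phi> 0) \<le> 1 / sqrt N" if \<sigma>: "\<sigma> = 1 \<or> \<sigma> = -1" for \<sigma> :: real
  proof -
    \<comment> \<open>The weight sqrt N on \<open>u\<close> balances its diagonal term against those
      of the \<open>N\<close> orthonormal vectors: both contribute N times the value at 1. The sign
      \<sigma> yields the two halves of the absolute value.\<close>
    define w where "w j = (if j < N then 1 else - \<sigma> * sqrt N)" for j
    have \<sigma>2: "\<sigma> * \<sigma> = 1" using \<sigma> by auto
    have "(\<Sum>j<Suc N. w j)\<^sup>2 * \<phi> 0 \<le> (\<Sum>i<Suc N. \<Sum>j<Suc N. w i * w j * \<phi> (ip (Suc N) (y i) (y j)))"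
      by (rule \<phi>_pos_def) (auto simp: y_def ipu ipe e_def)
    also have "\<dots> = (\<Sum>i<N. \<Sum>j<N. if i = j then \<phi> 1 else \<phi> 0) - 2 * \<sigma> * sqrt N * real N * \<phi> t + real N * \<phi> 1"
    proof -
      have "(\<Sum>i<N. \<Sum>j<N. w i * w j * \<phi> (ip (Suc N) (y i) (y j))) = (\<Sum>i<N. \<Sum>j<N. if i = j then \<phi> 1 else \<phi> 0)"
        by (intro sum.cong refl) (auto simp: w_def y_def ipe e_def)
      moreover have "(\<Sum>i<N. w i * w N * \<phi> (ip (Suc N) (y i) (y N))) = real N * (- \<sigma> * sqrt N * \<phi> t)"
        by (simp add: w_def y_def ipe u_def)
      moreover have "(\<Sum>i<N. w N * w i * \<phi> (ip (Suc N) (y N) (y i))) = real N * (- \<sigma> * sqrt N * \<phi> t)"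
        by (simp add: w_def y_def ipe u_def)
      moreover have "w N * w N * \<phi> (ip (Suc N) (y N) (y N)) = real N * \<phi> 1"
        using \<sigma>2 by (simp add: w_def y_def ipu mult.assoc[symmetric]) (simp add: mult.commute mult.left_commute)
      ultimately show ?thesis by (simp add: sum.distrib)
    qed
    also have "(\<Sum>j<Suc N. w j) = real N - \<sigma> * sqrt N" by (simp add: w_def)
    finally have "(real N - \<sigma> * sqrt N)\<^sup>2 * \<phi> 0 \<le> real N * \<phi> 1 + real N * (real N - 1) * \<phi> 0 - 2 * \<sigma> * sqrt N * real N * \<phi> t + real N * \<phi> 1"
      by (simp add: sum_diagonal_two_values)
    moreover have "(real N - \<sigma> * sqrt N)\<^sup>2 = real N * real N - 2 * \<sigma> * sqrt N * real N + real N"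
      using \<sigma>2 by (simp add: power2_eq_square algebra_simps)
    ultimately have "0 \<le> 2 * real N * (\<phi> 1 - \<phi> 0 - \<sigma> * sqrt N * (\<phi> t - \<phi> 0))"
      by (simp add: algebra_simps)
    then have "\<sigma> * sqrt N * (\<phi> t - \<phi> 0) \<le> \<phi> 1 - \<phi> 0"
      using assms by (simp add: zero_le_mult_iff)
    also have "\<dots> \<le> 1" using \<phi>_le_1[of 1] \<phi>_nonneg[of 0] by simp
    finally show ?thesis using assms by (simp add: field_simps)
  qed
  from *[of 1] *[of "-1"] show ?thesis by (simp add: abs_if)
qed

text \<open>By midpoint convexity the decrements along a geometric progression decrease. The first
  \<open>m\<close> of them telescope to at most 1, so the next one is at most 1 / m.\<close>

lemma \<phi>_power_step:
  assumes "0 \<le> \<tau>" "\<tau> \<le> 1" "0 < m"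
  shows "\<phi> (\<tau> ^ m) - 1 / real m \<le> \<phi> (\<tau> ^ Suc m)"
proof -
  define d where "d j = \<phi> (\<tau> ^ j) - \<phi> (\<tau> ^ Suc j)" for j
  have "d (Suc j) \<le> d j" for j
  proof -
    have "\<tau> ^ j * \<tau> ^ Suc (Suc j) = (\<tau> ^ Suc j)\<^sup>2"
      by (simp add: power2_eq_square mult_ac)
    then have "sqrt (\<tau> ^ j) * sqrt (\<tau> ^ Suc (Suc j)) = \<tau> ^ Suc j"
      using assms by (metis real_sqrt_mult real_sqrt_abs abs_of_nonneg zero_le_power)
    then show ?thesis
      using \<phi>_midpoint[of "sqrt (\<tau> ^ j)" "sqrt (\<tau> ^ Suc (Suc j))"] assms
      by (simp add: d_def power_le_one mult_le_one)
  qed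
  then have dec: "d m \<le> d j" if "j \<le> m" for j
    using lift_Suc_antimono_le[of d j m] that by simp
  have "real m * d m \<le> (\<Sum>j<m. d j)"
    using sum_mono[of "{..<m}" "\<lambda>_. d m" d] dec by simp
  also have "\<dots> = \<phi> 1 - \<phi> (\<tau> ^ m)"
    unfolding d_def by (subst sum_lessThan_telescope') simp
  also have "\<dots> \<le> 1" using \<phi>_le_1[of 1] \<phi>_nonneg[of "\<tau> ^ m"] by simp
  finally have "d m \<le> 1 / real m" using assms by (simp add: field_simps)
  then show ?thesis by (simp add: d_def)
qed

text \<open>With \<tau> the m-th root of \<rho>, one step of the progression leads from \<rho> to
  \<tau> \<rho>. Bernoulli's inequality gives \<tau> \<le> 1 - (1 - \<rho>) / m, hence \<tau> \<rho>
  \<le> t, and monotonicity finishes. The loss is independent of \<rho>; only the admissible drop in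
  correlation depends on it.\<close>

lemma \<phi>_lower_semicontinuous:
  assumes "0 \<le> \<rho>" "\<rho> \<le> 1" "0 < m" "\<rho> - \<rho> * (1 - \<rho>) / real m \<le> t" "t \<le> 1"
  shows "\<phi> \<rho> - 1 / real m \<le> \<phi> t"
proof -
  define \<tau> where "\<tau> = root m \<rho>"
  have \<tau>: "0 \<le> \<tau>" "\<tau> \<le> 1" "\<tau> ^ m = \<rho>" using assms by (auto simp: \<tau>_def)
  have "\<rho> \<le> (1 + - ((1 - \<rho>) / real m)) ^ m"
    using Bernoulli_inequality[of "- ((1 - \<rho>) / real m)" m] assms
    by (simp add: divide_le_eq)
  moreover have "0 \<le> 1 - (1 - \<rho>) / real m" using assms by (simp add: divide_le_eq)
  ultimately have "\<tau> \<le> 1 - (1 - \<rho>) / real m"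
    using assms \<tau> power_mono_iff[of \<tau> "1 - (1 - \<rho>) / real m" m] by simp
  then have "\<tau> * \<rho> \<le> (1 - (1 - \<rho>) / real m) * \<rho>"
    using assms by (intro mult_right_mono) auto
  also have "\<dots> \<le> t" using assms by (simp add: algebra_simps)
  finally have "\<phi> (\<tau> ^ Suc m) \<le> \<phi> t"
    using \<tau> assms by (intro \<phi>_mono) simp_all
  then show ?thesis using \<phi>_power_step[of \<tau> m] \<tau> assms by simp
qed

text \<open>The drop \<rho> (1 - \<rho>) / m allowed above degenerates at both ends. The bound by
  \<open>B\<close> keeps \<rho> away from 1. If \<rho> is below 1 / (8 A), then \<open>t\<close>
  either is at least \<rho> or lies, like \<rho>, so close to 0 that both values are within 1 / (8
  A) of the value at 0.\<close>

lemma \<phi>_modulus: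
  fixes A :: nat
  assumes "0 \<le> \<rho>" "\<rho> \<le> 1 - 1 / B" "1 \<le> B" "0 < A" "\<rho> - 1 / (32 * real A ^ 2 * B) \<le> t" "t \<le> 1"
  shows "\<phi> \<rho> - 1 / (4 * real A) \<le> \<phi> t"
proof (cases "1 / (8 * real A) \<le> \<rho>")
  case True
  \<comment> \<open>The drop 1 / (32 A^2 B) is the product of the lower bounds for \<rho> and 1 -
    \<rho>, divided by m = 4 A.\<close>
  have "1 / (8 * real A) * (1 / B) \<le> \<rho> * (1 - \<rho>)"
    using assms True by (intro mult_mono) auto
  then have "1 / (8 * real A) * (1 / B) / real (4 * A) \<le> \<rho> * (1 - \<rho>) / real (4 * A)"
    by (rule divide_right_mono) simp
  then have "1 / (32 * real A ^ 2 * B) \<le> \<rho> * (1 - \<rho>) / real (4 * A)"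
    by (simp add: power2_eq_square mult_ac)
  then have "\<rho> - \<rho> * (1 - \<rho>) / real (4 * A) \<le> t" using assms by linarith
  moreover have "0 \<le> 1 / B" using assms by simp
  then have "\<rho> \<le> 1" using assms by linarith
  ultimately show ?thesis
    using \<phi>_lower_semicontinuous[of \<rho> "4 * A" t] assms by simp
next
  case False
  \<comment> \<open>Chosen so that 1 / sqrt N = 1 / (8 A), which is both the error and the largest
    admissible correlation.\<close>
  define N where "N = 64 * A\<^sup>2"
  have sq: "sqrt (real N) = 8 * real A"
    using assms by (simp add: N_def real_sqrt_mult)
  have near: "\<bar>\<phi> s - \<phi> 0\<bar> \<le> 1 / (8 * real A)" if "\<bar>s\<bar> \<le> 1 / (8 * real A)" for s
  proof -
    have "s\<^sup>2 \<le> (1 / (8 * real A))\<^sup>2" using power_mono[OF that, of 2] by simp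
    then have "real N * s\<^sup>2 \<le> 1" using assms by (simp add: N_def power_divide field_simps)
    moreover have "0 < N" using assms by (simp add: N_def)
    ultimately show ?thesis using \<phi>_near_zero[of N s] by (simp only: sq)
  qed
  show ?thesis
  proof (cases "\<rho> \<le> t")
    case True
    then have "\<phi> \<rho> \<le> \<phi> t" using assms by (intro \<phi>_mono) auto
    then show ?thesis using assms by (smt (verit) divide_nonneg_nonneg of_nat_0_le_iff)
  next
    case ft: False
    have "8 * 1 * (1 * real A) \<le> (32 * B) * (real A * real A)"
      using assms by (intro mult_mono) auto
    then have "1 / (32 * real A ^ 2 * B) \<le> 1 / (8 * real A)"
      using assms by (intro divide_left_mono) (auto simp: power2_eq_square mult_ac)
    then have "\<bar>t\<bar> \<le> 1 / (8 * real A)" "\<bar>\<rho>\<bar> \<le> 1 / (8 * real A)"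
      using False ft assms by auto
    from near[OF this(1)] near[OF this(2)] show ?thesis by simp
  qed
qed

end

section \<open>Concentration of correlated directions\<close>

lemma L2_set_ip: "L2_set a {..<D} = sqrt (ip D a a)"
  by (simp add: L2_set_def ip_def power2_eq_square)

lemma ip_unit_right: "ip D x (unit_vector D y) = ip D x y / sqrt (ip D y y)"
  by (simp add: ip_def unit_vector_def L2_set_ip sum_divide_distrib)

lemma ip_unit_unit: "ip D (unit_vector D x) (unit_vector D y) = ip D x y / (sqrt (ip D x x) * sqrt (ip D y y))"
proof -
  have "ip D (unit_vector D x) y = ip D x y / sqrt (ip D x x)"
    using ip_unit_right[of D y x] by (simp only: ip_commute[of D y])
  then show ?thesis by (simp add: ip_unit_right)
qed

lemma ip_unit_self: "ip D y y \<noteq> 0 \<Longrightarrow> ip D (unit_vector D y) (unit_vector D y) = 1"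
  by (simp add: ip_unit_unit)

lemma measurable_ip' [measurable (raw)]:
  assumes "u \<in> W \<rightarrow>\<^sub>M Rn D" "v \<in> W \<rightarrow>\<^sub>M Rn D"
  shows "(\<lambda>w. ip D (u w) (v w)) \<in> borel_measurable W"
  by (intro measurable_ip measurable_gauss_component[OF assms(1)] measurable_gauss_component[OF assms(2)])

lemma measurable_unit_vector [measurable (raw)]:
  assumes [measurable]: "y \<in> W \<rightarrow>\<^sub>M Rn D"
  shows "(\<lambda>w. unit_vector D (y w)) \<in> W \<rightarrow>\<^sub>M Rn D"
  unfolding unit_vector_def L2_set_ip by (rule measurable_restrict) simp

lemma normal_prob_UNIV [simp]: "normal.prob UNIV = 1"
  using normal.prob_space by simp

lemma ip_Cauchy_Schwarz: "(ip D u v)\<^sup>2 \<le> ip D u u * ip D v v"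
  using Cauchy_Schwarz_ineq_sum[of u v "{..<D}"] by (simp add: ip_def power2_eq_square)

text \<open>The junk value at \<open>y = 0\<close> makes \<open>nrm D y\<close> a unit vector for every \<open>y\<close>, so that no almost-everywhere
  conditions arise below.\<close>

definition nrm :: "nat \<Rightarrow> (nat \<Rightarrow> real) \<Rightarrow> nat \<Rightarrow> real" where
  "nrm D y = (if ip D y y = 0 then (\<lambda>i\<in>{..<D}. if i = 0 then 1 else 0) else unit_vector D y)"

lemma nrm_eq: "ip D y y \<noteq> 0 \<Longrightarrow> nrm D y = unit_vector D y"
  by (simp add: nrm_def)

lemma ip_nrm_right: "ip D y y \<noteq> 0 \<Longrightarrow> ip D x (nrm D y) = ip D x y / sqrt (ip D y y)"
  by (simp add: nrm_eq ip_unit_right)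

lemma ip_nrm_self: "0 < D \<Longrightarrow> ip D (nrm D y) (nrm D y) = 1"
  by (simp add: nrm_def ip_unit_self) (simp add: ip_def if_distrib if_distribR sum.delta cong: if_cong)

lemma measurable_nrm [measurable (raw)]:
  assumes [measurable]: "y \<in> W \<rightarrow>\<^sub>M Rn D"
  shows "(\<lambda>w. nrm D (y w)) \<in> W \<rightarrow>\<^sub>M Rn D"
  unfolding nrm_def by measurable

lemma abs_ip_le:
  assumes "ip D x x = 1" "ip D y y = 1"
  shows "\<bar>ip D x y\<bar> \<le> 1"
  using ip_Cauchy_Schwarz[of D x y] by (simp add: assms abs_square_le_1)

lemma abs_ip_nrm_le: "0 < D \<Longrightarrow> ip D x x = 1 \<Longrightarrow> \<bar>ip D x (nrm D y)\<bar> \<le> 1"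
  by (rule abs_ip_le) (simp_all add: ip_nrm_self)

text \<open>The last coordinate alone already has no atom at 0.\<close>

lemma AE_gauss_nonzero:
  assumes "0 < D"
  shows "AE a in gauss D. ip D a a \<noteq> 0"
proof -
  obtain D' where D: "D = Suc D'" using assms by (cases D) auto
  have z: "emeasure \<N> {0} = 0"
    by (subst emeasure_density) (auto simp: nn_integral_indicator_singleton intro!: nn_integral_zero' AE_lborel_singleton[THEN AE_mp])
  have "(\<integral>\<^sup>+a. indicator {0} (ip D a a) \<partial>gauss D) =
    (\<integral>\<^sup>+x. \<integral>\<^sup>+m. indicator {0} (ip D' m m + x * x) \<partial>gauss D' \<partial>\<N>)"
    unfolding D by (subst nn_integral_gauss_Suc) simp_all
  also have "\<dots> \<le> (\<integral>\<^sup>+x. \<integral>\<^sup>+m. indicator {0} x \<partial>gauss D' \<partial>\<N>)"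
    by (intro nn_integral_mono) (auto split: split_indicator simp: add_nonneg_eq_0_iff)
  also have "\<dots> = 0"
    using z by (simp add: gauss.emeasure_space_1 nn_integral_indicator del: space_density)
  finally have "(\<integral>\<^sup>+a. indicator {0} (ip D a a) \<partial>gauss D) = 0" by simp
  then have "AE a in gauss D. indicator {0} (ip D a a) = (0::ennreal)"
    by (subst (asm) nn_integral_0_iff_AE) simp_all
  then show ?thesis by eventually_elim (auto split: split_indicator)
qed

text \<open>Independent centred variables are orthogonal, so only the diagonal of the expanded
  square survives.\<close>

lemma gauss_orthogonal_sum:
  fixes q :: "nat \<Rightarrow> real \<Rightarrow> real"
  assumes int: "\<And>i. integrable \<N> (q i)"
    and int2: "\<And>i. integrable \<N> (\<lambda>x. (q i x)\<^sup>2)"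
    and mean0: "\<And>i. (\<integral>x. q i x \<partial>\<N>) = 0"
  shows "integrable (gauss D) (\<lambda>m. (\<Sum>i<D. q i (m i))\<^sup>2)"
    and "(\<integral>m. (\<Sum>i<D. q i (m i))\<^sup>2 \<partial>gauss D) = (\<Sum>i<D. \<integral>x. (q i x)\<^sup>2 \<partial>\<N>)"
proof -
  \<comment> \<open>Writes q_i(m_i) q_j(m_j) as a product over all coordinates, as the product
    formula for integrals demands. For i = j both factors fall on the same coordinate and give the
    square.\<close>
  define h where "h i j l x = (if l = i then q i x else 1) * (if l = j then q j x else 1)" for i j l x
  have inth: "integrable \<N> (h i j l)" for i j l
    using int[of l] int2[of l] by (cases "l = i"; cases "l = j") (simp_all add: h_def[abs_def] power2_eq_square)
  have prod_h: "(\<Prod>l<D. h i j l (m l)) = q i (m i) * q j (m j)" if "i < D" "j < D" for i j m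
    using that by (simp add: h_def prod.distrib prod.delta)
  have inte: "integrable (gauss D) (\<lambda>m. q i (m i) * q j (m j))" if "i < D" "j < D" for i j
    using normal_prod.product_integrable_prod[of "{..<D}" "h i j"] inth
    by (simp add: prod_h that gauss_def)
  have val: "(\<integral>m. q i (m i) * q j (m j) \<partial>gauss D) = (if i = j then \<integral>x. (q i x)\<^sup>2 \<partial>\<N> else 0)"
    if "i < D" "j < D" for i j
  proof -
    have "(\<integral>m. q i (m i) * q j (m j) \<partial>gauss D) = (\<Prod>l<D. \<integral>x. h i j l x \<partial>\<N>)"
      using normal_prod.product_integral_prod[of "{..<D}" "h i j"] inth by (simp add: prod_h that gauss_def)
    also have "\<dots> = (if i = j then \<integral>x. (q i x)\<^sup>2 \<partial>\<N> else 0)"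
    proof (cases "i = j")
      case True
      have "(\<Prod>l<D. \<integral>x. h i j l x \<partial>\<N>) =
        (\<Prod>l<D. if l = i then \<integral>x. (q i x)\<^sup>2 \<partial>\<N> else 1)"
        using True by (intro prod.cong) (auto simp: h_def power2_eq_square normal.prob_space)
      then show ?thesis using that True by (simp add: prod.delta)
    next
      case False
      have "(\<integral>x. h i j i x \<partial>\<N>) = 0" using False mean0 by (simp add: h_def)
      then show ?thesis using that False by (auto intro!: prod_zero)
    qed
    finally show ?thesis .
  qed
  have eq: "(\<Sum>i<D. q i (m i))\<^sup>2 = (\<Sum>i<D. \<Sum>j<D. q i (m i) * q j (m j))" for m
    by (simp add: power2_eq_square sum_product)
  show "integrable (gauss D) (\<lambda>m. (\<Sum>i<D. q i (m i))\<^sup>2)"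
    unfolding eq by (intro Bochner_Integration.integrable_sum inte) auto
  have "(\<integral>m. (\<Sum>i<D. q i (m i))\<^sup>2 \<partial>gauss D) = (\<Sum>i<D. \<Sum>j<D. \<integral>m. q i (m i) * q j (m j) \<partial>gauss D)"
  proof -
    have "(\<integral>m. (\<Sum>i<D. q i (m i))\<^sup>2 \<partial>gauss D) = (\<Sum>i<D. \<integral>m. (\<Sum>j<D. q i (m i) * q j (m j)) \<partial>gauss D)"
      unfolding eq by (intro Bochner_Integration.integral_sum Bochner_Integration.integrable_sum inte) auto
    also have "\<dots> = (\<Sum>i<D. \<Sum>j<D. \<integral>m. q i (m i) * q j (m j) \<partial>gauss D)"
      by (intro sum.cong refl Bochner_Integration.integral_sum inte) auto
    finally show ?thesis .
  qed
  also have "\<dots> = (\<Sum>i<D. \<Sum>j<D. if i = j then \<integral>x. (q i x)\<^sup>2 \<partial>\<N> else 0)"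
    by (intro sum.cong refl val) auto
  finally show "(\<integral>m. (\<Sum>i<D. q i (m i))\<^sup>2 \<partial>gauss D) = (\<Sum>i<D. \<integral>x. (q i x)\<^sup>2 \<partial>\<N>)"
    by simp
qed

lemma normal_moments:
  "integrable \<N> (\<lambda>x. x)" "(\<integral>x. x \<partial>\<N>) = 0"
  "integrable \<N> (\<lambda>x. x\<^sup>2)" "(\<integral>x. x\<^sup>2 \<partial>\<N>) = 1"
  "integrable \<N> (\<lambda>x. x^4)" "(\<integral>x. x^4 \<partial>\<N>) = 3"
  using integrable_std_normal_distribution_moment[of 1] integral_std_normal_distribution_moment_odd[of 1]
    std_normal_distribution_even_moments[of 1] std_normal_distribution_even_moments[of 2]
  by (simp_all add: fact_numeral eval_nat_numeral)

lemma gauss_second_moments: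
  "integrable (gauss D) (\<lambda>a. (ip D a a - real D)\<^sup>2)"
  "(\<integral>a. (ip D a a - real D)\<^sup>2 \<partial>gauss D) = 2 * real D"
  "integrable (gauss D) (\<lambda>z. (ip D a z)\<^sup>2)"
  "(\<integral>z. (ip D a z)\<^sup>2 \<partial>gauss D) = ip D a a"
  "integrable (gauss D) (\<lambda>a. ip D a a)"
  "(\<integral>a. ip D a a \<partial>gauss D) = real D"
proof -
  note normal_moments [simp]
  have sq: "(x\<^sup>2 - 1)\<^sup>2 = x^4 - 2 * x\<^sup>2 + (1::real)" for x
    by (simp add: power2_eq_square eval_nat_numeral algebra_simps)
  have q: "integrable \<N> (\<lambda>x. x\<^sup>2 - 1)" "integrable \<N> (\<lambda>x. (x\<^sup>2 - 1)\<^sup>2)"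
    "(\<integral>x. x\<^sup>2 - 1 \<partial>\<N>) = 0" "(\<integral>x. (x\<^sup>2 - 1)\<^sup>2 \<partial>\<N>) = 2"
    unfolding sq by (simp_all add: normal.prob_space)
  have e1: "ip D a a - real D = (\<Sum>i<D. (a i)\<^sup>2 - 1)" for a
    by (simp add: ip_def sum_subtractf power2_eq_square)
  show "integrable (gauss D) (\<lambda>a. (ip D a a - real D)\<^sup>2)" "(\<integral>a. (ip D a a - real D)\<^sup>2 \<partial>gauss D) = 2 * real D"
    unfolding e1 using gauss_orthogonal_sum[of "\<lambda>_ x. x\<^sup>2 - 1" D] q by simp_all
  have l: "integrable \<N> (\<lambda>x. c * x)" "integrable \<N> (\<lambda>x. (c * x)\<^sup>2)"
    "(\<integral>x. c * x \<partial>\<N>) = 0" "(\<integral>x. (c * x)\<^sup>2 \<partial>\<N>) = c\<^sup>2" for c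
    by (simp_all add: power_mult_distrib)
  show "integrable (gauss D) (\<lambda>z. (ip D a z)\<^sup>2)" "(\<integral>z. (ip D a z)\<^sup>2 \<partial>gauss D) = ip D a a"
    unfolding ip_def using gauss_orthogonal_sum[of "\<lambda>i x. a i * x" D] l by (simp_all add: power2_eq_square)
  have s: "integrable (gauss D) (\<lambda>a. (a i)\<^sup>2)" "(\<integral>a. (a i)\<^sup>2 \<partial>gauss D) = 1" if "i < D" for i
  proof -
    have "(\<Sum>j<D. (if j = i then 1 else 0) * a j) = a i" for a :: "nat \<Rightarrow> real"
      using that by (simp add: if_distrib if_distribR sum.delta cong: if_cong)
    moreover have "(\<Sum>j<D. ((if j = i then 1 else 0) :: real)\<^sup>2) = 1"
      using that by (simp add: if_distrib if_distribR sum.delta cong: if_cong)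
    ultimately show "integrable (gauss D) (\<lambda>a. (a i)\<^sup>2)" "(\<integral>a. (a i)\<^sup>2 \<partial>gauss D) = 1"
      using gauss_orthogonal_sum[of "\<lambda>j x. (if j = i then 1 else 0) * x" D] l by simp_all
  qed
  show "integrable (gauss D) (\<lambda>a. ip D a a)" "(\<integral>a. ip D a a \<partial>gauss D) = real D"
    unfolding ip_def power2_eq_square[symmetric] using s
    by (auto simp: Bochner_Integration.integral_sum intro!: Bochner_Integration.integrable_sum)
qed

lemma ip_ou_point:
  "ip D a (ou_point D \<rho> a z) = \<rho> * ip D a a + sqrt (1 - \<rho>\<^sup>2) * ip D a z"
  "ip D (ou_point D \<rho> a z) (ou_point D \<rho> a z) =
    \<rho>\<^sup>2 * ip D a a + 2 * \<rho> * sqrt (1 - \<rho>\<^sup>2) * ip D a z + (sqrt (1 - \<rho>\<^sup>2))\<^sup>2 * ip D z z"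
  by (simp_all add: ip_def ou_point_def sum_distrib_left sum.distrib[symmetric] algebra_simps power2_eq_square)

text \<open>Deterministic part of the concentration. With b the correlated point, \<langle>a,
  b\<rangle> is within 2 \<kappa> D of \<rho> D, and the product P of the norms of a and b is within
  2 \<kappa> D of D. Hence \<langle>a, b\<rangle> differs from \<rho> P by at most 4 \<kappa> D, and
  P \<ge> D / 2 doubles this to 8 \<kappa>.\<close>

lemma unit_vector_ou_close:
  assumes \<rho>: "0 \<le> \<rho>" "\<rho> \<le> 1" and \<kappa>: "0 < \<kappa>" "\<kappa> \<le> 1 / 4" and D: "0 < D"
    and U: "\<bar>ip D a a - D\<bar> \<le> \<kappa> * D" and V: "\<bar>ip D a z\<bar> \<le> \<kappa> * D" and W: "\<bar>ip D z z - D\<bar> \<le> \<kappa> * D"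
  shows "ip D a a \<noteq> 0" "ip D (ou_point D \<rho> a z) (ou_point D \<rho> a z) \<noteq> 0"
    "\<bar>ip D (unit_vector D a) (unit_vector D (ou_point D \<rho> a z)) - \<rho>\<bar> \<le> 8 * \<kappa>"
proof -
  define s where "s = sqrt (1 - \<rho>\<^sup>2)"
  define b where "b = ou_point D \<rho> a z"
  define P where "P = sqrt (ip D a a) * sqrt (ip D b b)"
  have "\<rho>\<^sup>2 \<le> 1" using \<rho> by (simp add: power_le_one)
  then have s: "0 \<le> s" "s \<le> 1" "\<rho>\<^sup>2 + s\<^sup>2 = 1" using \<rho> by (simp_all add: s_def)
  \<comment> \<open>By the inequality of arithmetic and geometric means the cross term has
    coefficient at most 1, so the three errors of |b|^2 add up to 2 \<kappa> D.\<close>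
  have "2 * (\<rho> * s) \<le> 1" using s sum_squares_bound[of \<rho> s] by simp
  have ab: "\<bar>ip D a b - \<rho> * D\<bar> \<le> 2 * \<kappa> * D"
  proof -
    have "ip D a b - \<rho> * D = \<rho> * (ip D a a - D) + s * ip D a z"
      by (simp add: b_def ip_ou_point s_def algebra_simps)
    also have "\<bar>\<dots>\<bar> \<le> \<rho> * \<bar>ip D a a - D\<bar> + s * \<bar>ip D a z\<bar>"
      using s \<rho> abs_triangle_ineq[of "\<rho> * (ip D a a - D)" "s * ip D a z"] by (simp add: abs_mult)
    also have "\<dots> \<le> 1 * (\<kappa> * D) + 1 * (\<kappa> * D)"
      using s \<rho> U V by (intro add_mono mult_mono) auto
    finally show ?thesis by simp
  qed
  have bb: "\<bar>ip D b b - D\<bar> \<le> 2 * \<kappa> * D"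
  proof -
    have "ip D b b - D = \<rho>\<^sup>2 * (ip D a a - D) + (2 * (\<rho> * s)) * ip D a z + s\<^sup>2 * (ip D z z - D) + (\<rho>\<^sup>2 + s\<^sup>2 - 1) * D"
      unfolding b_def ip_ou_point s_def[symmetric] by (simp add: algebra_simps)
    also have "\<bar>\<dots>\<bar> \<le> \<rho>\<^sup>2 * \<bar>ip D a a - D\<bar> + (2 * (\<rho> * s)) * \<bar>ip D a z\<bar> + s\<^sup>2 * \<bar>ip D z z - D\<bar>"
    proof -
      have "\<bar>x + y + w\<bar> \<le> \<bar>x\<bar> + \<bar>y\<bar> + \<bar>w\<bar>" for x y w :: real by linarith
      from this[of "\<rho>\<^sup>2 * (ip D a a - D)" "(2 * (\<rho> * s)) * ip D a z" "s\<^sup>2 * (ip D z z - D)"]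
      show ?thesis using s \<rho> by (simp add: abs_mult)
    qed
    also have "\<dots> \<le> \<rho>\<^sup>2 * (\<kappa> * D) + 1 * (\<kappa> * D) + s\<^sup>2 * (\<kappa> * D)"
      using s \<rho> U V W \<open>2 * (\<rho> * s) \<le> 1\<close> by (intro add_mono mult_mono) auto
    also have "\<dots> = (\<rho>\<^sup>2 + s\<^sup>2 + 1) * (\<kappa> * D)" by (simp add: algebra_simps)
    finally show ?thesis using s by simp
  qed
  have \<kappa>D: "2 * \<kappa> * D \<le> D / 2" "0 \<le> \<kappa> * D"
    using \<kappa> mult_right_mono[of \<kappa> "1 / 4" "real D"] by simp_all
  have lo: "(1 - 2 * \<kappa>) * D \<le> ip D a a" "(1 - 2 * \<kappa>) * D \<le> ip D b b"
    and hi: "ip D a a \<le> (1 + 2 * \<kappa>) * D" "ip D b b \<le> (1 + 2 * \<kappa>) * D"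
    using U bb \<kappa>D by (simp_all add: algebra_simps abs_le_iff)
  have half: "D / 2 \<le> (1 - 2 * \<kappa>) * D" using \<kappa>D by (simp add: algebra_simps)
  have pos: "0 < (1 - 2 * \<kappa>) * D" using \<kappa> D by simp
  have P: "(1 - 2 * \<kappa>) * D \<le> P" "P \<le> (1 + 2 * \<kappa>) * D"
  proof -
    have "sqrt ((1 - 2 * \<kappa>) * D) * sqrt ((1 - 2 * \<kappa>) * D) \<le> P"
      unfolding P_def using lo pos by (intro mult_mono real_sqrt_le_mono) auto
    then show "(1 - 2 * \<kappa>) * D \<le> P" using pos by simp
    have "P \<le> sqrt ((1 + 2 * \<kappa>) * D) * sqrt ((1 + 2 * \<kappa>) * D)"
      unfolding P_def using hi \<kappa> by (intro mult_mono real_sqrt_le_mono) auto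
    then show "P \<le> (1 + 2 * \<kappa>) * D" using \<kappa> by simp
  qed
  show "ip D a a \<noteq> 0" "ip D (ou_point D \<rho> a z) (ou_point D \<rho> a z) \<noteq> 0"
    using lo pos unfolding b_def by auto
  have "\<bar>P - D\<bar> \<le> 2 * \<kappa> * D" using P by (simp add: algebra_simps abs_le_iff)
  then have "\<rho> * \<bar>P - D\<bar> \<le> 1 * (2 * \<kappa> * D)" using \<rho> by (intro mult_mono) auto
  moreover have "\<rho> * \<bar>P - D\<bar> = \<bar>\<rho> * P - \<rho> * D\<bar>"
    using \<rho> by (simp add: abs_mult flip: right_diff_distrib)
  ultimately have "\<bar>ip D a b - \<rho> * P\<bar> \<le> 4 * \<kappa> * D" using ab by linarith
  also have "\<dots> \<le> 8 * \<kappa> * P"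
    using mult_left_mono[of "D / 2" P "8 * \<kappa>"] half P \<kappa> by simp
  finally have "\<bar>ip D a b - \<rho> * P\<bar> / P \<le> 8 * \<kappa>" using P pos by (simp add: divide_le_eq)
  moreover have "ip D (unit_vector D a) (unit_vector D b) - \<rho> = (ip D a b - \<rho> * P) / P"
    using P pos by (simp add: ip_unit_unit P_def[symmetric] diff_divide_distrib)
  ultimately show "\<bar>ip D (unit_vector D a) (unit_vector D (ou_point D \<rho> a z)) - \<rho>\<bar> \<le> 8 * \<kappa>"
    using P pos by (simp add: b_def[symmetric] abs_divide)
qed

lemma nrm_ou_close:
  assumes "0 \<le> \<rho>" "\<rho> \<le> 1" "0 < \<kappa>" "\<kappa> \<le> 1 / 4" "0 < D"
    and "\<bar>ip D a a - D\<bar> \<le> \<kappa> * D" "\<bar>ip D a z\<bar> \<le> \<kappa> * D" "\<bar>ip D z z - D\<bar> \<le> \<kappa> * D"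
  shows "\<bar>ip D (nrm D a) (nrm D (ou_point D \<rho> a z)) - \<rho>\<bar> \<le> 8 * \<kappa>"
  using unit_vector_ou_close[OF assms] by (simp add: nrm_eq)

text \<open>Chebyshev's inequality for three quantities at once: if the direction is bad, one of
  them exceeds \<kappa> D, so the indicator is at most the sum of their squares over (\<kappa> D)^2.
  The second moments 2 D, D and 2 D add up to 5 D.\<close>

lemma nrm_ou_concentration:
  assumes \<rho>: "0 \<le> \<rho>" "\<rho> \<le> 1" and \<kappa>: "0 < \<kappa>" "\<kappa> \<le> 1 / 4" and D: "0 < D"
  shows "(\<integral>a. \<integral>z. (if \<bar>ip D (nrm D a) (nrm D (ou_point D \<rho> a z)) - \<rho>\<bar> \<le> 8 * \<kappa> then 0 else 1)
    \<partial>gauss D \<partial>gauss D) \<le> 5 / (\<kappa>\<^sup>2 * D)"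
proof -
  let ?bad = "\<lambda>a z. (if \<bar>ip D (nrm D a) (nrm D (ou_point D \<rho> a z)) - \<rho>\<bar> \<le> 8 * \<kappa> then 0 else 1) :: real"
  define E where "E a z = ((ip D a a - D)\<^sup>2 + (ip D a z)\<^sup>2 + (ip D z z - D)\<^sup>2) / (\<kappa> * D)\<^sup>2" for a z
  have sqle: "(\<kappa> * D)\<^sup>2 \<le> u\<^sup>2" if "\<kappa> * D < \<bar>u\<bar>" for u
    using power_mono[of "\<kappa> * D" "\<bar>u\<bar>" 2] that \<kappa> by simp
  have pw: "?bad a z \<le> E a z" for a z
  proof (cases "\<bar>ip D (nrm D a) (nrm D (ou_point D \<rho> a z)) - \<rho>\<bar> \<le> 8 * \<kappa>")
    case False
    then consider "\<kappa> * D < \<bar>ip D a a - D\<bar>" | "\<kappa> * D < \<bar>ip D a z\<bar>" | "\<kappa> * D < \<bar>ip D z z - D\<bar>"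
      using nrm_ou_close[OF \<rho> \<kappa> D] by force
    then have "(\<kappa> * D)\<^sup>2 \<le> (ip D a a - D)\<^sup>2 + (ip D a z)\<^sup>2 + (ip D z z - D)\<^sup>2"
    proof cases
      case 1
      from sqle[OF this] show ?thesis by (intro add_increasing2) simp_all
    next
      case 2
      from sqle[OF this] show ?thesis by (intro add_increasing2[OF _ add_increasing]) simp_all
    next
      case 3
      from sqle[OF this] show ?thesis by (intro add_increasing) simp_all
    qed
    then show ?thesis using False \<kappa> D by (simp add: E_def)
  qed (simp add: E_def)
  have intE: "integrable (gauss D) (E a)" for a
    unfolding E_def by (intro integrable_divide Bochner_Integration.integrable_add gauss_second_moments) simp
  have valE: "(\<integral>z. E a z \<partial>gauss D) = ((ip D a a - D)\<^sup>2 + ip D a a + 2 * D) / (\<kappa> * D)\<^sup>2" for a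
    unfolding E_def by (simp add: gauss_second_moments gauss.prob_space)
  have "(\<integral>a. \<integral>z. ?bad a z \<partial>gauss D \<partial>gauss D) \<le> (\<integral>a. \<integral>z. E a z \<partial>gauss D \<partial>gauss D)"
  proof (rule integral_mono)
    have b1: "integrable (gauss D) (\<lambda>z. ?bad a z)" if "a \<in> space (gauss D)" for a
    proof (rule gauss.integrable_bounded[of _ _ 1])
      have [measurable]: "a \<in> space (Rn D)" using that by (simp add: space_gauss space_PiM)
      show "(\<lambda>z. ?bad a z) \<in> borel_measurable (gauss D)" by measurable
    qed simp
    show "(\<integral>z. ?bad a z \<partial>gauss D) \<le> (\<integral>z. E a z \<partial>gauss D)" if "a \<in> space (gauss D)" for a
      using b1[OF that] intE pw by (intro integral_mono) auto
    show "integrable (gauss D) (\<lambda>a. \<integral>z. ?bad a z \<partial>gauss D)"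
    proof (rule gauss.integrable_bounded[of _ _ 1])
      show "(\<lambda>a. \<integral>z. ?bad a z \<partial>gauss D) \<in> borel_measurable (gauss D)" by measurable
      fix a assume a: "a \<in> space (gauss D)"
      have "0 \<le> (\<integral>z. ?bad a z \<partial>gauss D)" by (intro integral_nonneg_AE AE_I2) simp
      moreover have "(\<integral>z. ?bad a z \<partial>gauss D) \<le> (\<integral>z. 1 \<partial>gauss D)"
        using b1[OF a] by (intro integral_mono) auto
      ultimately show "\<bar>\<integral>z. ?bad a z \<partial>gauss D\<bar> \<le> 1" by (simp add: gauss.prob_space)
    qed
    show "integrable (gauss D) (\<lambda>a. \<integral>z. E a z \<partial>gauss D)"
      unfolding valE by (intro integrable_divide Bochner_Integration.integrable_add gauss_second_moments) simp
  qed
  also have "\<dots> = (2 * real D + real D + 2 * D) / (\<kappa> * D)\<^sup>2"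
    unfolding valE by (simp add: gauss_second_moments gauss.prob_space)
  also have "\<dots> = 5 / (\<kappa>\<^sup>2 * D)"
    using D by (simp add: power2_eq_square field_simps)
  finally show ?thesis .
qed

section \<open>The smoothing kernel on the sphere\<close>

text \<open>Averages over the sphere are written as Gaussian averages of which only the direction
  \<open>nrm D y\<close> is used; this direction is uniform. For unit \<open>x\<close> the kernel is
  nonnegative, and it is a polynomial in \<open>x\<close>.\<close>

definition kern :: "nat \<Rightarrow> nat \<Rightarrow> (nat \<Rightarrow> real) \<Rightarrow> (nat \<Rightarrow> real) \<Rightarrow> real" where
  "kern D d x y = (1 + ip D x (nrm D y)) ^ d"

definition kmass :: "nat \<Rightarrow> nat \<Rightarrow> real" where
  "kmass D d = (\<integral>y. kern D d (\<lambda>i. if i = 0 then 1 else 0) y \<partial>gauss D)"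

lemma measurable_kern [measurable (raw)]:
  assumes [measurable]: "x \<in> W \<rightarrow>\<^sub>M Rn D" "y \<in> W \<rightarrow>\<^sub>M Rn D"
  shows "(\<lambda>w. kern D d (x w) (y w)) \<in> borel_measurable W"
  unfolding kern_def by measurable

lemma measurable_kern_fixed [measurable (raw)]:
  assumes [measurable]: "y \<in> W \<rightarrow>\<^sub>M Rn D"
  shows "(\<lambda>w. kern D d x (y w)) \<in> borel_measurable W"
  unfolding kern_def by measurable

lemma kern_bounds:
  assumes "0 < D" "ip D x x = 1"
  shows "0 \<le> kern D d x y" "kern D d x y \<le> 2 ^ d"
proof -
  have "\<bar>ip D x (nrm D y)\<bar> \<le> 1" by (rule abs_ip_nrm_le[OF assms])
  then have "0 \<le> 1 + ip D x (nrm D y)" "1 + ip D x (nrm D y) \<le> 2" by (auto simp: abs_le_iff)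
  then show "0 \<le> kern D d x y" "kern D d x y \<le> 2 ^ d"
    unfolding kern_def by (auto intro: power_mono)
qed

lemma integrable_kern:
  assumes "0 < D" "ip D x x = 1"
  shows "integrable (gauss D) (kern D d x)"
  using kern_bounds[OF assms] by (intro gauss.integrable_bounded[of _ _ "2 ^ d"]) auto

text \<open>Away from y = 0 the kernel is a function of \<langle>y, x\<rangle> and |y|^2, whose
  joint law is the same for all unit vectors \<open>x\<close>. So one constant normalises the kernel
  at every point of the sphere.\<close>

lemma integral_kern:
  assumes "0 < D" "ip D x x = 1"
  shows "(\<integral>y. kern D d x y \<partial>gauss D) = kmass D d"
proof -
  obtain D' where D: "D = Suc D'" using assms by (cases D) auto
  define F where "F p = ennreal ((1 + fst p / sqrt (snd p)) ^ d)" for p :: "real \<times> real"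
  have [measurable]: "F \<in> borel_measurable (borel \<Otimes>\<^sub>M borel)" unfolding F_def by measurable
  have eq: "ennreal (\<integral>y. kern D d v y \<partial>gauss D) =
    (\<integral>\<^sup>+r. \<integral>\<^sup>+m. F (r, r * r + ip D' m m) \<partial>gauss D' \<partial>\<N>)"
    if v: "ip D v v = 1" for v
  proof -
    have "ennreal (\<integral>y. kern D d v y \<partial>gauss D) = (\<integral>\<^sup>+y. kern D d v y \<partial>gauss D)"
      using kern_bounds[OF assms(1) v] by (intro nn_integral_eq_integral[symmetric] integrable_kern assms v) auto
    also have "\<dots> = (\<integral>\<^sup>+y. F (ip D y v, ip D y y) \<partial>gauss D)"
    proof (rule nn_integral_cong_AE)
      show "AE y in gauss D. ennreal (kern D d v y) = F (ip D y v, ip D y y)"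
        using AE_gauss_nonzero[OF assms(1)]
        by eventually_elim (simp add: F_def kern_def ip_nrm_right, simp only: ip_commute[of D v])
    qed
    also have "\<dots> = (\<integral>\<^sup>+r. \<integral>\<^sup>+m. F (r, r * r + ip D' m m) \<partial>gauss D' \<partial>\<N>)"
      unfolding D by (subst nn_integral_gauss_functional_norm) (use v D in simp_all)
    finally show ?thesis .
  qed
  let ?e = "\<lambda>i. if i = 0 then 1 else 0 :: real"
  have e: "ip D ?e ?e = 1" using D by (simp add: ip_def if_distrib if_distribR sum.delta cong: if_cong)
  have "0 \<le> (\<integral>y. kern D d v y \<partial>gauss D)" if "ip D v v = 1" for v
    using kern_bounds[OF assms(1) that] by (intro integral_nonneg_AE AE_I2) auto
  note nonneg = this
  have "ennreal (\<integral>y. kern D d x y \<partial>gauss D) = ennreal (kmass D d)"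
    unfolding kmass_def by (simp only: eq[OF assms(2)] eq[OF e])
  then show ?thesis
    using nonneg[OF assms(2)] nonneg[OF e] by (subst (asm) ennreal_inj) (simp_all add: kmass_def)
qed

text \<open>The interval lies in [-2, 2], where the density is at least (1 / 3) (1 / 9); its length
  is 2 h, and 2 / 27 \<ge> 1 / 14.\<close>

lemma normal_interval_lower:
  assumes "\<bar>a\<bar> \<le> 1" "0 < h" "h \<le> 1"
  shows "h / 14 \<le> measure \<N> {a - h .. a + h}"
proof -
  have dens: "1 / 27 \<le> std_normal_density x" if "x \<in> {a - h .. a + h}" for x
  proof -
    have "\<bar>x\<bar> \<le> 2" using that assms by (auto simp: abs_le_iff)
    then have "x\<^sup>2 \<le> 2\<^sup>2" using power_mono[of "\<bar>x\<bar>" 2 2] by simp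
    then have e2: "exp (- 2) \<le> exp (- x\<^sup>2 / 2)" by simp
    have "exp (2::real) \<le> 9"
    proof -
      have "exp (2::real) = exp 1 * exp 1" by (simp flip: exp_add)
      also have "\<dots> \<le> 3 * 3" using exp_le by (intro mult_mono) auto
      finally show ?thesis by simp
    qed
    then have "1 / 9 \<le> exp (- 2 :: real)" by (simp add: exp_minus field_simps)
    then have "1 / 9 \<le> exp (- x\<^sup>2 / 2)" using e2 by (rule order.trans)
    moreover have "sqrt (2 * pi) \<le> 3" using pi_less_4 by (intro real_le_lsqrt) auto
    then have "1 / 3 \<le> 1 / sqrt (2 * pi)" by (simp add: field_simps)
    ultimately have "1 / 3 * (1 / 9) \<le> 1 / sqrt (2 * pi) * exp (- x\<^sup>2 / 2)"
      by (intro mult_mono) auto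
    then show ?thesis by (simp add: std_normal_density_def)
  qed
  have "ennreal (h / 14) \<le> ennreal (1 / 27) * emeasure lborel {a - h .. a + h}"
    using assms by (simp add: ennreal_mult[symmetric] del: ennreal_numeral)
  also have "\<dots> = (\<integral>\<^sup>+x. ennreal (1 / 27) * indicator {a - h .. a + h} x \<partial>lborel)"
    by (simp add: nn_integral_cmult)
  also have "\<dots> \<le> (\<integral>\<^sup>+x. ennreal (std_normal_density x) * indicator {a - h .. a + h} x \<partial>lborel)"
    using dens by (intro nn_integral_mono) (auto split: split_indicator intro!: ennreal_leI)
  also have "\<dots> = emeasure \<N> {a - h .. a + h}"
    by (simp add: emeasure_density)
  finally show ?thesis by (simp add: normal.emeasure_eq_measure)
qed

text \<open>A crude bound suffices, because the degree can outweigh any factor of the form c^D. A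
  small cube around \<open>x\<close> consists of points whose directions lie in the cap, and its
  Gaussian measure is a product of \<open>D\<close> interval measures.\<close>

lemma gauss_cap_lower:
  assumes D: "0 < D" and x: "ip D x x = 1" and \<delta>: "0 < \<delta>" "\<delta> \<le> 1"
  shows "(\<delta> / (70 * real D)) ^ D \<le> measure (gauss D) {y \<in> space (gauss D). 1 - \<delta> / 2 \<le> ip D x (nrm D y)}"
proof -
  \<comment> \<open>With h D = \<delta> / 5, both |\<langle>x, y\<rangle> - 1| and |y - x|^2 are at
    most \<delta> / 5 on the cube. Then |y| \<le> 1 + 3 \<delta> / 10, and (1 - \<delta> / 2) (1 + 3
    \<delta> / 10) \<le> 1 - \<delta> / 5 places the direction in the cap.\<close>
  define h where "h = \<delta> / (5 * real D)"
  have h: "0 < h" "h \<le> 1" "h * D = \<delta> / 5" using D \<delta> by (simp_all add: h_def field_simps)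
  have xi: "\<bar>x i\<bar> \<le> 1" if "i < D" for i
  proof -
    have "x i * x i \<le> ip D x x" unfolding ip_def using that by (intro member_le_sum) auto
    then show ?thesis using x by (simp add: abs_square_le_1 power2_eq_square[symmetric])
  qed
  define B where "B = PiE {..<D} (\<lambda>i. {x i - h .. x i + h})"
  have "(h / 14) ^ D = (\<Prod>i<D. h / 14)" by simp
  also have "\<dots> \<le> (\<Prod>i<D. measure \<N> {x i - h .. x i + h})"
    using h xi by (intro prod_mono conjI normal_interval_lower) auto
  also have "\<dots> = measure (gauss D) B"
    unfolding gauss_def B_def by (rule finite_product_prob_space.finite_measure_PiM_emb[symmetric])
      (auto simp: finite_product_prob_space_def finite_product_sigma_finite_def product_prob_space_def
        finite_product_sigma_finite_axioms_def product_prob_space_axioms_def product_sigma_finite_def)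
  also have "\<dots> \<le> measure (gauss D) {y \<in> space (gauss D). 1 - \<delta> / 2 \<le> ip D x (nrm D y)}"
  proof (rule gauss.finite_measure_mono)
    show "{y \<in> space (gauss D). 1 - \<delta> / 2 \<le> ip D x (nrm D y)} \<in> sets (gauss D)" by measurable
    show "B \<subseteq> {y \<in> space (gauss D). 1 - \<delta> / 2 \<le> ip D x (nrm D y)}"
    proof
      fix y assume y: "y \<in> B"
      have yi: "\<bar>y i - x i\<bar> \<le> h" if "i < D" for i
        using y that by (auto simp: B_def PiE_iff abs_le_iff algebra_simps)
      have "ip D x y - 1 = (\<Sum>i<D. x i * (y i - x i))"
        unfolding x[symmetric] by (simp add: ip_def sum_subtractf right_diff_distrib)
      also have "\<bar>\<dots>\<bar> \<le> (\<Sum>i<D. 1 * h)"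
      proof (rule order.trans[OF sum_abs], rule sum_mono)
        fix i assume "i \<in> {..<D}"
        then have "\<bar>x i\<bar> * \<bar>y i - x i\<bar> \<le> 1 * h" using xi yi by (intro mult_mono) auto
        then show "\<bar>x i * (y i - x i)\<bar> \<le> 1 * h" by (simp add: abs_mult)
      qed
      finally have xy: "\<bar>ip D x y - 1\<bar> \<le> \<delta> / 5" using h by (simp add: mult.commute)
      have "ip D y y = (\<Sum>i<D. x i * x i + 2 * (x i * (y i - x i)) + (y i - x i) * (y i - x i))"
        by (simp add: ip_def algebra_simps)
      also have "\<dots> = 1 + 2 * (ip D x y - 1) + (\<Sum>i<D. (y i - x i) * (y i - x i))"
        using \<open>ip D x y - 1 = _\<close> x by (simp add: sum.distrib ip_def sum_distrib_left)
      also have "(\<Sum>i<D. (y i - x i) * (y i - x i)) \<le> (\<Sum>i<D. h * 1)"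
      proof (rule sum_mono)
        fix i assume "i \<in> {..<D}"
        then have "\<bar>y i - x i\<bar> * \<bar>y i - x i\<bar> \<le> h * 1" using yi[of i] h by (intro mult_mono) auto
        then show "(y i - x i) * (y i - x i) \<le> h * 1" by (simp add: abs_mult[symmetric])
      qed
      also have "(\<Sum>i<D. h * 1) = \<delta> / 5" using h by (simp add: mult.commute)
      finally have "ip D y y \<le> 1 + 2 * (ip D x y - 1) + \<delta> / 5" by simp
      then have yy: "ip D y y \<le> 1 + 3 * (\<delta> / 5)" using abs_le_D1[OF xy] by argo
      have "0 < ip D y y"
      proof (rule ccontr)
        assume "\<not> 0 < ip D y y"
        then have "ip D y y = 0" using ip_self_nonneg[of D y] by linarith
        then have "(ip D x y)\<^sup>2 \<le> 0" using ip_Cauchy_Schwarz[of D x y] by simp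
        then show False using xy \<delta> by (simp add: abs_le_iff)
      qed
      have "sqrt (ip D y y) \<le> 1 + 3 / 2 * (\<delta> / 5)"
      proof (rule real_le_lsqrt)
        have "1 + 3 * (\<delta> / 5) \<le> (1 + 3 / 2 * (\<delta> / 5))\<^sup>2" by (simp add: power2_eq_square algebra_simps)
        then show "ip D y y \<le> (1 + 3 / 2 * (\<delta> / 5))\<^sup>2" using yy by simp
      qed (use \<delta> in simp_all)
      then have "(1 - \<delta> / 2) * sqrt (ip D y y) \<le> (1 - \<delta> / 2) * (1 + 3 / 2 * (\<delta> / 5))"
        using \<delta> by (intro mult_left_mono) auto
      also have "\<dots> \<le> 1 - \<delta> / 5" using \<delta> by (simp add: algebra_simps)
      also have "\<dots> \<le> ip D x y" using abs_le_D2[OF xy] by argo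
      finally have "1 - \<delta> / 2 \<le> ip D x (nrm D y)"
        using \<open>0 < ip D y y\<close> by (simp add: ip_nrm_right pos_le_divide_eq)
      moreover have "y \<in> space (gauss D)" using y by (auto simp: B_def space_gauss)
      ultimately show "y \<in> {y \<in> space (gauss D). 1 - \<delta> / 2 \<le> ip D x (nrm D y)}" by simp
    qed
  qed
  also have "h / 14 = \<delta> / (70 * real D)" by (simp add: h_def)
  finally show ?thesis .
qed

text \<open>Only the cap is kept, on which the kernel is at least (2 - \<delta> / 2)^d. The cap has
  half the height \<delta> of the one in the tail estimate, which leaves a ratio strictly below 1
  between the two bases.\<close>

lemma kmass_lower:
  assumes D: "0 < D" and x: "ip D x x = 1" and \<delta>: "0 < \<delta>" "\<delta> \<le> 1"
  shows "(2 - \<delta> / 2) ^ d * (\<delta> / (70 * real D)) ^ D \<le> kmass D d"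
proof -
  let ?C = "{y \<in> space (gauss D). 1 - \<delta> / 2 \<le> ip D x (nrm D y)}"
  have [measurable]: "?C \<in> sets (gauss D)" by measurable
  have "(2 - \<delta> / 2) ^ d * (\<delta> / (70 * real D)) ^ D \<le> (2 - \<delta> / 2) ^ d * measure (gauss D) ?C"
    using gauss_cap_lower[OF assms] \<delta> by (intro mult_left_mono) auto
  also have "\<dots> = (\<integral>y. (2 - \<delta> / 2) ^ d * indicator ?C y \<partial>gauss D)" by simp
  also have "\<dots> \<le> (\<integral>y. kern D d x y \<partial>gauss D)"
  proof (rule integral_mono)
    show "integrable (gauss D) (\<lambda>y. (2 - \<delta> / 2) ^ d * indicator ?C y)"
      by (intro integrable_mult_right gauss.integrable_bounded[of _ _ 1]) (auto split: split_indicator)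
    show "(2 - \<delta> / 2) ^ d * indicator ?C y \<le> kern D d x y" for y
      using kern_bounds[OF D x] \<delta> by (auto split: split_indicator simp: kern_def intro!: power_mono)
  qed (rule integrable_kern[OF D x])
  finally show ?thesis using integral_kern[OF D x] by simp
qed

lemma kmass_pos: "0 < D \<Longrightarrow> 0 < kmass D d"
proof -
  assume D: "0 < D"
  let ?e = "\<lambda>i. if i = 0 then 1 else 0 :: real"
  have e: "ip D ?e ?e = 1" using D by (simp add: ip_def if_distrib if_distribR sum.delta cong: if_cong)
  have "0 < (2 - 1 / 2) ^ d * (1 / (70 * real D)) ^ D" using D by simp
  then show ?thesis using kmass_lower[OF D e, of 1 d] by simp
qed

text \<open>Outside the larger cap the kernel is at most (2 - \<delta>)^d, so relative to the mass
  the tail gains (1 - \<delta> / 4)^d and pays for the measure of the smaller cap. The value of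
  \<open>d\<close> makes \<delta> d / 4 equal to D (70 D \<Delta>) + L; as e^x \<ge> x, the first
  summand compensates the cap and the second yields 1 / L.\<close>

lemma kern_tail:
  assumes D: "0 < D" and x: "ip D x x = 1" and \<Delta>: "0 < \<Delta>" and L: "0 < L" and d: "d = 4 * \<Delta> * (70 * D\<^sup>2 * \<Delta> + L)"
  shows "(\<integral>y. (if ip D x (nrm D y) < 1 - 1 / real \<Delta> then kern D d x y else 0) \<partial>gauss D) \<le> kmass D d / real L"
proof -
  define \<delta> where "\<delta> = 1 / real \<Delta>"
  have \<delta>: "0 < \<delta>" "\<delta> \<le> 1" using \<Delta> by (simp_all add: \<delta>_def)
  have "(\<integral>y. (if ip D x (nrm D y) < 1 - \<delta> then kern D d x y else 0) \<partial>gauss D) \<le> (\<integral>y. (2 - \<delta>) ^ d \<partial>gauss D)"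
  proof (rule integral_mono)
    show "integrable (gauss D) (\<lambda>y. if ip D x (nrm D y) < 1 - \<delta> then kern D d x y else 0)"
      using kern_bounds[OF D x] by (intro gauss.integrable_bounded[of _ _ "2 ^ d"]) auto
    show "(if ip D x (nrm D y) < 1 - \<delta> then kern D d x y else 0) \<le> (2 - \<delta>) ^ d" for y
      using abs_ip_nrm_le[OF D x, of y] \<delta> by (auto simp: kern_def abs_le_iff intro!: power_mono)
  qed simp
  also have "\<dots> = (2 - \<delta>) ^ d" by (simp add: gauss.prob_space)
  also have "\<dots> \<le> ((2 - \<delta> / 2) * (1 - \<delta> / 4)) ^ d"
    using \<delta> by (intro power_mono) (auto simp: algebra_simps)
  also have "\<dots> = (2 - \<delta> / 2) ^ d * (1 - \<delta> / 4) ^ d" by (rule power_mult_distrib)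
  also have "\<dots> \<le> (2 - \<delta> / 2) ^ d * ((\<delta> / (70 * real D)) ^ D / L)"
  proof (rule mult_left_mono)
    have "(1 - \<delta> / 4) ^ d \<le> exp (- \<delta> / 4) ^ d"
      using exp_ge_add_one_self[of "- \<delta> / 4"] \<delta> by (intro power_mono) auto
    also have "\<dots> = exp (- (\<delta> / 4 * d))" by (simp add: exp_of_nat_mult[symmetric] mult.commute)
    also have "\<delta> / 4 * d = real D * (70 * D * \<Delta>) + L"
      using \<Delta> by (simp add: d \<delta>_def power2_eq_square)
    also have "exp (- (real D * (70 * D * \<Delta>) + L)) = exp (- (70 * real D * \<Delta>)) ^ D * exp (- real L)"
      by (simp add: exp_of_nat_mult[symmetric] mult_exp_exp)
    also have "\<dots> \<le> (\<delta> / (70 * real D)) ^ D * (1 / L)"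
    proof (intro mult_mono power_mono)
      have "70 * real D * \<Delta> \<le> exp (70 * real D * \<Delta>)" "real L \<le> exp (real L)"
        using exp_ge_add_one_self[of "70 * real D * \<Delta>"] exp_ge_add_one_self[of "real L"] by linarith+
      then show "exp (- (70 * real D * \<Delta>)) \<le> \<delta> / (70 * real D)" "exp (- real L) \<le> 1 / L"
        using D \<Delta> L by (simp_all add: exp_minus \<delta>_def divide_simps mult_ac)
    qed (use \<delta> in auto)
    finally show "(1 - \<delta> / 4) ^ d \<le> (\<delta> / (70 * real D)) ^ D / L" by simp
  qed (use \<delta> in auto)
  also have "\<dots> \<le> kmass D d / L"
    using kmass_lower[OF D x \<delta>, of d] L by (simp add: divide_right_mono)
  finally show ?thesis by (simp add: \<delta>_def)
qed

section \<open>Random projection and smoothing\<close>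

text \<open>For unit vectors |a - b|^2 = 2 - 2 \<langle>a, b\<rangle> \<le> 2 \<delta>.
  Cauchy-Schwarz replaces one argument at a time, which gives the factor 2.\<close>

lemma ip_perturb:
  assumes unit: "ip D x x = 1" "ip D u u = 1" "ip D x' x' = 1" "ip D u' u' = 1"
    and "1 - \<delta> \<le> ip D x u" "1 - \<delta> \<le> ip D x' u'"
  shows "ip D x x' - 2 * sqrt (2 * \<delta>) \<le> ip D u u'"
proof -
  have diff: "ip D (\<lambda>i. a i - b i) c = ip D a c - ip D b c" "ip D c (\<lambda>i. a i - b i) = ip D c a - ip D c b" for a b c
    by (simp_all add: ip_def left_diff_distrib right_diff_distrib sum_subtractf)
  have close: "\<bar>ip D c a - ip D c b\<bar> \<le> sqrt (2 * \<delta>)"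
    if "ip D a a = 1" "ip D b b = 1" "ip D c c = 1" "1 - \<delta> \<le> ip D a b" for a b c
  proof -
    have "(ip D c a - ip D c b)\<^sup>2 \<le> 2 - 2 * ip D a b"
      using ip_Cauchy_Schwarz[of D c "\<lambda>i. a i - b i"] that by (simp add: diff ip_commute[of D b a])
    also have "\<dots> \<le> 2 * \<delta>" using that by simp
    finally show ?thesis by (rule real_le_rsqrt[of "\<bar>_\<bar>", simplified])
  qed
  have "\<bar>ip D x x' - ip D x u'\<bar> \<le> sqrt (2 * \<delta>)" "\<bar>ip D u' x - ip D u' u\<bar> \<le> sqrt (2 * \<delta>)"
    using assms by (auto intro: close)
  then show ?thesis by (simp add: ip_commute[of D u'] abs_le_iff)
qed

locale projected = simplex_fun +
  fixes D d :: nat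
  assumes D_pos: "0 < D"
begin

definition dens :: "(nat \<Rightarrow> real) \<Rightarrow> (nat \<Rightarrow> real) \<Rightarrow> real" where
  "dens x y = kern D d x y / kmass D d"

definition samp :: "(nat \<Rightarrow> nat \<Rightarrow> real) \<Rightarrow> (nat \<Rightarrow> real) \<Rightarrow> nat \<Rightarrow> real" where
  "samp M y = f (mv n D M (nrm D y))"

definition smooth :: "(nat \<Rightarrow> nat \<Rightarrow> real) \<Rightarrow> nat \<Rightarrow> (nat \<Rightarrow> real) \<Rightarrow> real" where
  "smooth M i x = (\<integral>y. samp M y i * dens x y \<partial>gauss D)"

definition proj :: "(nat \<Rightarrow> nat \<Rightarrow> real) \<Rightarrow> (nat \<Rightarrow> real) \<Rightarrow> nat \<Rightarrow> real" where
  "proj M a = (\<lambda>i\<in>{..<k}. smooth M i (nrm D a))"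

definition overlap :: "(nat \<Rightarrow> nat \<Rightarrow> real) \<Rightarrow> (nat \<Rightarrow> real) \<Rightarrow> (nat \<Rightarrow> real) \<Rightarrow> real" where
  "overlap M x x' = (\<Sum>i<k. smooth M i x * smooth M i x')"

definition emp_mean :: "nat \<Rightarrow> (nat \<Rightarrow> nat \<Rightarrow> real) \<Rightarrow> real" where
  "emp_mean i M = (\<integral>y. samp M y i \<partial>gauss D)"

lemma measurable_dens [measurable (raw)]:
  assumes [measurable]: "x \<in> W \<rightarrow>\<^sub>M Rn D" "y \<in> W \<rightarrow>\<^sub>M Rn D"
  shows "(\<lambda>w. dens (x w) (y w)) \<in> borel_measurable W"
  unfolding dens_def by measurable

lemma measurable_dens_fixed [measurable (raw)]:
  assumes [measurable]: "y \<in> W \<rightarrow>\<^sub>M Rn D"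
  shows "(\<lambda>w. dens x (y w)) \<in> borel_measurable W"
  unfolding dens_def by measurable

lemma measurable_samp [measurable (raw)]:
  assumes [measurable]: "M \<in> W \<rightarrow>\<^sub>M gmat n D" "y \<in> W \<rightarrow>\<^sub>M Rn D" "i < k"
  shows "(\<lambda>w. samp (M w) (y w) i) \<in> borel_measurable W"
  unfolding samp_def by measurable

lemma dens_nonneg: "ip D x x = 1 \<Longrightarrow> 0 \<le> dens x y"
  using kern_bounds[OF D_pos] kmass_pos[OF D_pos] by (simp add: dens_def order_less_imp_le)

lemma dens_le: "ip D x x = 1 \<Longrightarrow> dens x y \<le> 2 ^ d / kmass D d"
  using kern_bounds[OF D_pos] kmass_pos[OF D_pos, of d] by (simp add: dens_def divide_right_mono)

lemma integrable_dens: "ip D x x = 1 \<Longrightarrow> integrable (gauss D) (dens x)"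
  unfolding dens_def[abs_def] using integrable_kern[OF D_pos] by (intro integrable_divide) auto

lemma integral_dens: "ip D x x = 1 \<Longrightarrow> (\<integral>y. dens x y \<partial>gauss D) = 1"
  using integral_kern[OF D_pos] kmass_pos[OF D_pos, of d] by (simp add: dens_def)

text \<open>By this symmetry the kernel also has integral 1 in its first direction, so smoothing
  does not change the mean.\<close>

lemma dens_swap: "dens (nrm D a) y = dens (nrm D y) a"
  by (simp add: dens_def kern_def ip_commute)

lemma samp_bounds: "i < k \<Longrightarrow> 0 \<le> samp M y i" "i < k \<Longrightarrow> samp M y i \<le> 1"
  by (simp_all add: samp_def f_bounds)

lemma sum_samp: "(\<Sum>i<k. samp M y i) = 1"
  using f_simplex[OF mv_in] by (simp add: samp_def prob_simplex_def)

lemma abs_samp_dens: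
  assumes "ip D x x = 1" "i < k"
  shows "\<bar>samp M y i * dens x y\<bar> \<le> 2 ^ d / kmass D d"
proof -
  have "samp M y i * dens x y \<le> 1 * (2 ^ d / kmass D d)"
    using assms by (intro mult_mono) (simp_all add: samp_bounds dens_le dens_nonneg)
  then show ?thesis using assms by (simp add: samp_bounds dens_nonneg)
qed

lemma integrable_samp_dens:
  assumes [measurable]: "M \<in> space (gmat n D)" and x: "ip D x x = 1" and i: "i < k"
  shows "integrable (gauss D) (\<lambda>y. samp M y i * dens x y)"
proof (rule gauss.integrable_bounded)
  show "(\<lambda>y. samp M y i * dens x y) \<in> borel_measurable (gauss D)" using i by measurable
qed (rule abs_samp_dens[OF x i])

lemma smooth_nonneg: "ip D x x = 1 \<Longrightarrow> i < k \<Longrightarrow> 0 \<le> smooth M i x"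
  unfolding smooth_def by (intro integral_nonneg_AE AE_I2) (simp add: samp_bounds dens_nonneg)

lemma sum_smooth:
  assumes "M \<in> space (gmat n D)" "ip D x x = 1"
  shows "(\<Sum>i<k. smooth M i x) = 1"
proof -
  have "(\<Sum>i<k. smooth M i x) = (\<integral>y. (\<Sum>i<k. samp M y i * dens x y) \<partial>gauss D)"
    unfolding smooth_def
    by (rule Bochner_Integration.integral_sum[symmetric]) (auto intro: integrable_samp_dens assms)
  also have "\<dots> = 1" by (simp add: sum_distrib_right[symmetric] sum_samp integral_dens assms)
  finally show ?thesis .
qed

lemma smooth_le_1:
  assumes "M \<in> space (gmat n D)" "ip D x x = 1" "i < k"
  shows "smooth M i x \<le> 1"
  using member_le_sum[of i "{..<k}" "\<lambda>i. smooth M i x"] sum_smooth[OF assms(1,2)] assms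
  by (simp add: smooth_nonneg)

lemma measurable_smooth [measurable (raw)]:
  assumes [measurable]: "M \<in> W \<rightarrow>\<^sub>M gmat n D" "x \<in> W \<rightarrow>\<^sub>M Rn D" and i[measurable]: "i < k"
  shows "(\<lambda>w. smooth (M w) i (x w)) \<in> borel_measurable W"
  unfolding smooth_def using i by measurable

lemma proj_simplex_fun:
  assumes M: "M \<in> space (gmat n D)"
  shows "measurable_simplex_fun D k (proj M)"
  unfolding measurable_simplex_fun_def
proof
  have [measurable]: "(\<lambda>a. M) \<in> gauss D \<rightarrow>\<^sub>M gmat n D" using M by simp
  show "proj M \<in> gauss D \<rightarrow>\<^sub>M Rn k"
    unfolding proj_def[abs_def] by (rule measurable_restrict) measurable
  show "proj M \<in> space (gauss D) \<rightarrow> prob_simplex k"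
    using sum_smooth[OF M ip_nrm_self[OF D_pos]] smooth_nonneg[OF ip_nrm_self[OF D_pos]]
    by (auto simp: proj_def prob_simplex_def)
qed

text \<open>Hence the mean of the smoothed function deviates from that of \<open>f\<close> only
  through the choice of \<open>M\<close>, and this deviation is independent of the degree.\<close>

lemma integral_proj:
  assumes M: "M \<in> space (gmat n D)" and i: "i < k"
  shows "(\<integral>a. proj M a i \<partial>gauss D) = emp_mean i M"
proof -
  have [measurable]: "(\<lambda>a. M) \<in> W \<rightarrow>\<^sub>M gmat n D" for W :: "'w measure" using M by simp
  have "(\<integral>a. proj M a i \<partial>gauss D) = (\<integral>a. \<integral>y. samp M y i * dens (nrm D a) y \<partial>gauss D \<partial>gauss D)"
    using i by (simp add: proj_def smooth_def)
  also have "\<dots> = (\<integral>y. \<integral>a. samp M y i * dens (nrm D a) y \<partial>gauss D \<partial>gauss D)"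
    using abs_samp_dens[OF ip_nrm_self[OF D_pos] i] i
    by (intro integral_swap_bounded gauss.prob_space_axioms) (measurable, blast)
  also have "\<dots> = emp_mean i M"
    by (simp add: dens_swap[of _ "_ :: nat \<Rightarrow> real"] integral_dens ip_nrm_self D_pos emp_mean_def)
  finally show ?thesis .
qed

end

section \<open>Averages over the random matrix\<close>

lemma (in prob_space) abs_expectation_le:
  fixes g :: "'a \<Rightarrow> real"
  assumes "0 \<le> B" "\<And>x. x \<in> space M \<Longrightarrow> \<bar>g x\<bar> \<le> B"
  shows "\<bar>expectation g\<bar> \<le> B"
proof (cases "integrable M g")
  case True
  have "\<bar>expectation g\<bar> \<le> expectation (\<lambda>x. \<bar>g x\<bar>)" by (rule integral_abs_bound)
  also have "\<dots> \<le> expectation (\<lambda>_. B)" using True assms by (intro integral_mono) auto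
  finally show ?thesis by (simp add: prob_space)
qed (simp add: not_integrable_integral_eq assms)

context projected
begin

text \<open>The product of two averages is a double integral of inner products of \<open>f\<close>
  at two sampled points; taking the expectation over \<open>M\<close> inside turns each into a value
  of \<open>\<phi>\<close>. Weights 1 give the second moment of the mean, kernel weights the
  expected overlap.\<close>

lemma expectation_samp_quadratic:
  assumes w[measurable]: "w \<in> borel_measurable (gauss D)" "w' \<in> borel_measurable (gauss D)"
    and B: "\<And>y. \<bar>w y\<bar> \<le> B" "\<And>y. \<bar>w' y\<bar> \<le> B"
  shows "(\<integral>M. (\<Sum>i<k. (\<integral>y. samp M y i * w y \<partial>gauss D) * (\<integral>y. samp M y i * w' y \<partial>gauss D)) \<partial>gmat n D) =
    (\<integral>y. \<integral>y'. w y * w' y' * \<phi> (ip D (nrm D y) (nrm D y')) \<partial>gauss D \<partial>gauss D)"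
proof -
  let ?d = "\<lambda>M y y'. dot (mv n D M (nrm D y)) (mv n D M (nrm D y'))"
  have B0: "0 \<le> B" using B(1)[of undefined] by simp
  have bd: "\<bar>w y * w' y' * ?d M y y'\<bar> \<le> B * B" for M y y'
  proof -
    have "\<bar>w y\<bar> * \<bar>w' y'\<bar> * \<bar>?d M y y'\<bar> \<le> B * B * 1"
      using B B0 by (intro mult_mono) (auto simp: dot_bounds)
    then show ?thesis by (simp add: abs_mult)
  qed
  have int: "integrable (gauss D) (\<lambda>y. samp M y i * v y)"
    if [measurable]: "M \<in> space (gmat n D)" "i < k" "v \<in> borel_measurable (gauss D)" and v: "\<And>y. \<bar>v y\<bar> \<le> B" for M i v
  proof (rule gauss.integrable_bounded[of _ _ B])
    show "\<bar>samp M y i * v y\<bar> \<le> B" for y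
      using mult_mono[OF samp_bounds(2)[of i M y] v[of y]] that samp_bounds(1)[of i M y] by (simp add: abs_mult)
  qed measurable
  have eq: "(\<Sum>i<k. (\<integral>y. samp M y i * w y \<partial>gauss D) * (\<integral>y. samp M y i * w' y \<partial>gauss D)) =
    (\<integral>y. \<integral>y'. w y * w' y' * ?d M y y' \<partial>gauss D \<partial>gauss D)" if M: "M \<in> space (gmat n D)" for M
  proof -
    have "(\<Sum>i<k. (\<integral>y. samp M y i * w y \<partial>gauss D) * (\<integral>y. samp M y i * w' y \<partial>gauss D)) =
      (\<Sum>i<k. \<integral>y. samp M y i * w y * (\<integral>y'. samp M y' i * w' y' \<partial>gauss D) \<partial>gauss D)"
      by simp
    also have "\<dots> = (\<integral>y. (\<Sum>i<k. samp M y i * w y * (\<integral>y'. samp M y' i * w' y' \<partial>gauss D)) \<partial>gauss D)"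
      using int[OF M _ w(1) B(1)] by (intro Bochner_Integration.integral_sum[symmetric] integrable_mult_left) auto
    also have "\<dots> = (\<integral>y. \<integral>y'. w y * w' y' * ?d M y y' \<partial>gauss D \<partial>gauss D)"
    proof (rule Bochner_Integration.integral_cong[OF refl])
      fix y
      have "(\<Sum>i<k. samp M y i * w y * (\<integral>y'. samp M y' i * w' y' \<partial>gauss D)) =
        (\<Sum>i<k. \<integral>y'. samp M y i * w y * (samp M y' i * w' y') \<partial>gauss D)"
        by simp
      also have "\<dots> = (\<integral>y'. (\<Sum>i<k. samp M y i * w y * (samp M y' i * w' y')) \<partial>gauss D)"
        using int[OF M _ w(2) B(2)] by (intro Bochner_Integration.integral_sum[symmetric] integrable_mult_right) auto
      also have "\<dots> = (\<integral>y'. w y * w' y' * ?d M y y' \<partial>gauss D)"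
        by (intro Bochner_Integration.integral_cong refl) (simp add: dot_def samp_def sum_distrib_left mult_ac)
      finally show "(\<Sum>i<k. samp M y i * w y * (\<integral>y'. samp M y' i * w' y' \<partial>gauss D)) =
        (\<integral>y'. w y * w' y' * ?d M y y' \<partial>gauss D)" .
    qed
    finally show ?thesis .
  qed
  have "(\<integral>M. (\<Sum>i<k. (\<integral>y. samp M y i * w y \<partial>gauss D) * (\<integral>y. samp M y i * w' y \<partial>gauss D)) \<partial>gmat n D) =
    (\<integral>M. \<integral>y. \<integral>y'. w y * w' y' * ?d M y y' \<partial>gauss D \<partial>gauss D \<partial>gmat n D)"
    by (rule Bochner_Integration.integral_cong) (simp_all add: eq)
  also have "\<dots> = (\<integral>y. \<integral>M. \<integral>y'. w y * w' y' * ?d M y y' \<partial>gauss D \<partial>gmat n D \<partial>gauss D)"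
  proof (rule integral_swap_bounded[OF gmat.prob_space_axioms gauss.prob_space_axioms])
    show "(\<lambda>(M, y). \<integral>y'. w y * w' y' * ?d M y y' \<partial>gauss D) \<in> borel_measurable (gmat n D \<Otimes>\<^sub>M gauss D)"
      by measurable
    show "\<bar>\<integral>y'. w y * w' y' * ?d M y y' \<partial>gauss D\<bar> \<le> B * B" for M y
      using B0 by (intro gauss.abs_expectation_le bd) simp
  qed
  also have "\<dots> = (\<integral>y. \<integral>y'. \<integral>M. w y * w' y' * ?d M y y' \<partial>gmat n D \<partial>gauss D \<partial>gauss D)"
  proof (rule Bochner_Integration.integral_cong[OF refl])
    fix y assume "y \<in> space (gauss D)"
    then have [measurable]: "y \<in> space (Rn D)" by (simp add: space_gauss space_PiM)
    show "(\<integral>M. \<integral>y'. w y * w' y' * ?d M y y' \<partial>gauss D \<partial>gmat n D) = (\<integral>y'. \<integral>M. w y * w' y' * ?d M y y' \<partial>gmat n D \<partial>gauss D)"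
      by (rule integral_swap_bounded[OF gmat.prob_space_axioms gauss.prob_space_axioms _ bd]) measurable
  qed
  also have "\<dots> = (\<integral>y. \<integral>y'. w y * w' y' * \<phi> (ip D (nrm D y) (nrm D y')) \<partial>gauss D \<partial>gauss D)"
    by (simp only: integral_mult_right_zero integral_gmat_dot ip_nrm_self D_pos)
  finally show ?thesis .
qed

lemma emp_mean_bounds:
  assumes "M \<in> space (gmat n D)" "i < k"
  shows "0 \<le> emp_mean i M" "emp_mean i M \<le> 1"
proof -
  have 1: "\<bar>emp_mean i M\<bar> \<le> 1"
    unfolding emp_mean_def using assms by (intro gauss.abs_expectation_le) (auto simp: samp_bounds)
  show "0 \<le> emp_mean i M"
    unfolding emp_mean_def using assms by (intro integral_nonneg_AE AE_I2) (auto simp: samp_bounds)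
  with 1 show "emp_mean i M \<le> 1" by simp
qed

lemma measurable_emp_mean [measurable (raw)]:
  assumes [measurable]: "M \<in> W \<rightarrow>\<^sub>M gmat n D" and i[measurable]: "i < k"
  shows "(\<lambda>w. emp_mean i (M w)) \<in> borel_measurable W"
  unfolding emp_mean_def using i by measurable

lemma expectation_emp_mean:
  assumes i[measurable]: "i < k"
  shows "(\<integral>M. emp_mean i M \<partial>gmat n D) = mean i"
proof -
  have "(\<integral>M. emp_mean i M \<partial>gmat n D) = (\<integral>y. \<integral>M. samp M y i \<partial>gmat n D \<partial>gauss D)"
    unfolding emp_mean_def using i
    by (intro integral_swap_bounded[of _ _ _ 1] gmat.prob_space_axioms gauss.prob_space_axioms)
      (measurable, simp_all add: samp_bounds)
  then show ?thesis
    by (simp add: samp_def integral_gmat_f i ip_nrm_self D_pos gauss.prob_space)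
qed


lemma measurable_\<phi> [measurable]: "\<phi> \<in> borel_measurable borel"
  unfolding \<phi>_eq by measurable

lemma expectation_emp_mean_deviation:
  "(\<integral>M. (\<Sum>i<k. (emp_mean i M - mean i)\<^sup>2) \<partial>gmat n D) =
    (\<integral>y. \<integral>y'. \<phi> (ip D (nrm D y) (nrm D y')) \<partial>gauss D \<partial>gauss D) - \<phi> 0"
proof -
  have int1: "integrable (gmat n D) (emp_mean i)" if "i < k" for i
    using that emp_mean_bounds by (intro gmat.integrable_bounded[of _ _ _ 1]) auto
  have int2: "integrable (gmat n D) (\<lambda>M. (emp_mean i M)\<^sup>2)" if "i < k" for i
    using that emp_mean_bounds by (intro gmat.integrable_bounded[of _ _ _ 1]) (auto simp: power_le_one)
  have "(\<integral>M. (\<Sum>i<k. (emp_mean i M - mean i)\<^sup>2) \<partial>gmat n D) =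
    (\<integral>M. (\<Sum>i<k. (emp_mean i M)\<^sup>2) - (\<Sum>i<k. 2 * mean i * emp_mean i M) + \<phi> 0 \<partial>gmat n D)"
    by (rule Bochner_Integration.integral_cong)
      (simp_all add: \<phi>_zero power2_diff sum.distrib sum_subtractf mult_ac)
  also have "\<dots> = (\<integral>M. (\<Sum>i<k. (emp_mean i M)\<^sup>2) \<partial>gmat n D) - (\<integral>M. (\<Sum>i<k. 2 * mean i * emp_mean i M) \<partial>gmat n D) + \<phi> 0"
    using int1 int2
    by (subst Bochner_Integration.integral_add, (auto intro!: Bochner_Integration.integrable_diff Bochner_Integration.integrable_sum)[2],
      subst Bochner_Integration.integral_diff) (auto intro!: Bochner_Integration.integrable_sum simp: gmat.prob_space)
  also have "(\<integral>M. (\<Sum>i<k. 2 * mean i * emp_mean i M) \<partial>gmat n D) = (\<Sum>i<k. 2 * mean i * mean i)"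
    using int1 by (subst Bochner_Integration.integral_sum) (auto simp: expectation_emp_mean)
  also have "\<dots> = 2 * \<phi> 0" by (simp add: \<phi>_zero power2_eq_square sum_distrib_left mult_ac)
  also have "(\<integral>M. (\<Sum>i<k. (emp_mean i M)\<^sup>2) \<partial>gmat n D) = (\<integral>y. \<integral>y'. \<phi> (ip D (nrm D y) (nrm D y')) \<partial>gauss D \<partial>gauss D)"
    using expectation_samp_quadratic[of "\<lambda>_. 1" "\<lambda>_. 1" 1] by (simp add: emp_mean_def power2_eq_square)
  finally show ?thesis by simp
qed

end

lemma (in prob_space) exists_ge_expectation:
  fixes g :: "'a \<Rightarrow> real"
  assumes "integrable M g"
  shows "\<exists>x\<in>space M. expectation g \<le> g x"
proof (rule ccontr)
  assume "\<not> ?thesis"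
  then have "AE x in M. g x < expectation g" by (intro AE_I2) auto
  then show False using expectation_less[OF assms] by blast
qed

context projected
begin

text \<open>Two independent directions are almost orthogonal. When their correlation is at most 8
  \<kappa>, \<open>\<phi>\<close> is within 1 / sqrt N of its value at 0; otherwise it is at most 1,
  on an event of small probability.\<close>

lemma expectation_emp_mean_deviation_le:
  assumes \<kappa>: "0 < \<kappa>" "\<kappa> \<le> 1 / 4" and N: "0 < N" "real N * (8 * \<kappa>)\<^sup>2 \<le> 1"
  shows "(\<integral>M. (\<Sum>i<k. (emp_mean i M - mean i)\<^sup>2) \<partial>gmat n D) \<le> 1 / sqrt N + 5 / (\<kappa>\<^sup>2 * D)"
proof -
  let ?bad = "\<lambda>y y'. (if \<bar>ip D (nrm D y) (nrm D y')\<bar> \<le> 8 * \<kappa> then 0 else 1) :: real"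
  let ?\<phi> = "\<lambda>y y'. \<phi> (ip D (nrm D y) (nrm D y'))"
  define c where "c = \<phi> 0 + 1 / sqrt N"
  have pw: "?\<phi> y y' \<le> c + ?bad y y'" for y y'
  proof (cases "\<bar>ip D (nrm D y) (nrm D y')\<bar> \<le> 8 * \<kappa>")
    case True
    then have "(ip D (nrm D y) (nrm D y'))\<^sup>2 \<le> (8 * \<kappa>)\<^sup>2" using \<kappa> by (intro power2_le_iff_abs_le[THEN iffD2]) auto
    then have "real N * (ip D (nrm D y) (nrm D y'))\<^sup>2 \<le> real N * (8 * \<kappa>)\<^sup>2" by (intro mult_left_mono) auto
    then have "real N * (ip D (nrm D y) (nrm D y'))\<^sup>2 \<le> 1" using N(2) by (rule order.trans)
    then have "\<bar>?\<phi> y y' - \<phi> 0\<bar> \<le> 1 / sqrt N" by (rule \<phi>_near_zero[OF N(1)])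
    then show ?thesis using True by (simp add: c_def abs_le_iff)
  next
    case False
    have "0 \<le> c" by (simp add: c_def \<phi>_nonneg)
    then show ?thesis using False \<phi>_le_1[of "ip D (nrm D y) (nrm D y')"] by simp
  qed
  have bm: "integrable (gauss D) (\<lambda>y'. ?bad y y')" for y
    by (intro gauss.integrable_bounded[of _ _ 1]) auto
  have bm2: "integrable (gauss D) (\<lambda>y. \<integral>y'. ?bad y y' \<partial>gauss D)"
    by (intro gauss.integrable_bounded[of _ _ 1] gauss.abs_expectation_le) auto
  have fm: "integrable (gauss D) (\<lambda>y'. ?\<phi> y y')" for y
    using \<phi>_le_1 \<phi>_nonneg by (intro gauss.integrable_bounded[of _ _ 1]) auto
  have fm2: "integrable (gauss D) (\<lambda>y. \<integral>y'. ?\<phi> y y' \<partial>gauss D)"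
    using \<phi>_le_1 \<phi>_nonneg by (intro gauss.integrable_bounded[of _ _ 1] gauss.abs_expectation_le) auto
  have "(\<integral>y. \<integral>y'. ?\<phi> y y' \<partial>gauss D \<partial>gauss D) \<le> (\<integral>y. c + (\<integral>y'. ?bad y y' \<partial>gauss D) \<partial>gauss D)"
  proof (rule integral_mono[OF fm2])
    show "integrable (gauss D) (\<lambda>y. c + (\<integral>y'. ?bad y y' \<partial>gauss D))"
      by (intro Bochner_Integration.integrable_add bm2) simp
    fix y
    have "(\<integral>y'. ?\<phi> y y' \<partial>gauss D) \<le> (\<integral>y'. c + ?bad y y' \<partial>gauss D)"
      by (intro integral_mono[OF fm] pw Bochner_Integration.integrable_add bm) simp
    then show "(\<integral>y'. ?\<phi> y y' \<partial>gauss D) \<le> c + (\<integral>y'. ?bad y y' \<partial>gauss D)"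
      using bm by (simp add: gauss.prob_space)
  qed
  also have "\<dots> = c + (\<integral>y. \<integral>y'. ?bad y y' \<partial>gauss D \<partial>gauss D)"
    using bm2 by (simp add: gauss.prob_space)
  \<comment> \<open>An independent pair is the case \<rho> = 0 of a correlated one, since the
    correlated point is then y' itself.\<close>
  also have "(\<integral>y. \<integral>y'. ?bad y y' \<partial>gauss D \<partial>gauss D) =
      (\<integral>y. \<integral>y'. (if \<bar>ip D (nrm D y) (nrm D (ou_point D 0 y y')) - 0\<bar> \<le> 8 * \<kappa> then 0 else 1) \<partial>gauss D \<partial>gauss D)"
    by (intro Bochner_Integration.integral_cong refl) (simp add: ou_point_def restrict_PiE_UNIV space_gauss)
  also have "\<dots> \<le> 5 / (\<kappa>\<^sup>2 * D)"
    using nrm_ou_concentration[OF _ _ \<kappa> D_pos, of 0] by simp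
  finally show ?thesis
    unfolding expectation_emp_mean_deviation by (simp add: c_def)
qed

text \<open>If \<open>y\<close> and \<open>y'\<close> are close to \<open>x\<close> and
  \<open>x'\<close>, their correlation is at least \<tau> and \<open>\<phi>\<close> is at least
  \<open>c\<close>. The other pairs are charged to the kernel mass outside one of the two caps, at
  most 1 / L each.\<close>

lemma expectation_overlap_ge:
  assumes unit: "ip D x x = 1" "ip D x' x' = 1"
    and \<Delta>: "0 < \<Delta>" and L: "0 < L" and d: "d = 4 * \<Delta> * (70 * D\<^sup>2 * \<Delta> + L)"
    and c: "c \<le> 1" "\<And>t. \<tau> \<le> t \<Longrightarrow> t \<le> 1 \<Longrightarrow> c \<le> \<phi> t"
    and \<tau>: "\<tau> \<le> ip D x x' - 2 * sqrt (2 * (1 / real \<Delta>))"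
  shows "c - 2 / real L \<le> (\<integral>M. overlap M x x' \<partial>gmat n D)"
proof -
  define b where "b v y = (if ip D v (nrm D y) < 1 - 1 / real \<Delta> then dens v y else 0)" for v y
  have bdens: "0 \<le> b v y" "b v y \<le> dens v y" if "ip D v v = 1" for v y
    using dens_nonneg[OF that] by (auto simp: b_def)
  have intb: "integrable (gauss D) (b v)" if v: "ip D v v = 1" for v
  proof (rule gauss.integrable_bounded)
    show "b v \<in> borel_measurable (gauss D)" unfolding b_def[abs_def] by measurable
    show "\<bar>b v y\<bar> \<le> 2 ^ d / kmass D d" for y
      using bdens[OF v, of y] dens_le[OF v, of y] by simp
  qed
  have bL: "(\<integral>y. b v y \<partial>gauss D) \<le> 1 / L" if v: "ip D v v = 1" for v
  proof -
    have "(\<integral>y. b v y \<partial>gauss D) = (\<integral>y. (if ip D v (nrm D y) < 1 - 1 / real \<Delta> then kern D d v y else 0) \<partial>gauss D) / kmass D d"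
      unfolding b_def dens_def by (subst integral_divide_zero[symmetric]) (intro Bochner_Integration.integral_cong refl, simp)
    also have "\<dots> \<le> (kmass D d / L) / kmass D d"
      using kern_tail[OF D_pos v \<Delta> L d] kmass_pos[OF D_pos, of d] by (intro divide_right_mono) auto
    also have "\<dots> = 1 / L" using kmass_pos[OF D_pos, of d] by simp
    finally show ?thesis .
  qed
  let ?\<phi> = "\<lambda>y y'. \<phi> (ip D (nrm D y) (nrm D y'))"
  \<comment> \<open>When a point is outside its cap, the left-hand side is at most 0, because c
    \<le> 1, while \<open>\<phi>\<close> is nonnegative.\<close>
  have pw: "c * (dens x y * dens x' y') - b x y * dens x' y' - dens x y * b x' y' \<le> dens x y * dens x' y' * ?\<phi> y y'" for y y'
  proof -
    have nn: "0 \<le> dens x y" "0 \<le> dens x' y'" using dens_nonneg unit by auto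
    define q q' where "q = (if ip D x (nrm D y) < 1 - 1 / real \<Delta> then 1 else 0 :: real)"
      and "q' = (if ip D x' (nrm D y') < 1 - 1 / real \<Delta> then 1 else 0 :: real)"
    have "c - q - q' \<le> ?\<phi> y y'"
    proof (cases "ip D x (nrm D y) < 1 - 1 / real \<Delta> \<or> ip D x' (nrm D y') < 1 - 1 / real \<Delta>")
      case True
      then show ?thesis using c(1) \<phi>_nonneg[of "ip D (nrm D y) (nrm D y')"] by (auto simp: q_def q'_def)
    next
      case False
      then have "ip D x x' - 2 * sqrt (2 * (1 / real \<Delta>)) \<le> ip D (nrm D y) (nrm D y')"
        using unit by (intro ip_perturb) (auto simp: ip_nrm_self D_pos)
      moreover have "ip D (nrm D y) (nrm D y') \<le> 1"
        using abs_ip_le[OF ip_nrm_self ip_nrm_self, OF D_pos D_pos, of y y'] by simp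
      ultimately show ?thesis using c(2)[of "ip D (nrm D y) (nrm D y')"] \<tau> False by (simp add: q_def q'_def)
    qed
    then have "(dens x y * dens x' y') * (c - q - q') \<le> (dens x y * dens x' y') * ?\<phi> y y'"
      using nn by (intro mult_left_mono) auto
    moreover have "b x y = dens x y * q" "b x' y' = dens x' y' * q'" by (auto simp: b_def q_def q'_def)
    ultimately show ?thesis by (simp add: algebra_simps)
  qed
  define \<beta> \<beta>' where "\<beta> = (\<integral>y. b x y \<partial>gauss D)" and "\<beta>' = (\<integral>y. b x' y \<partial>gauss D)"
  define C where "C = 2 ^ d / kmass D d"
  have C: "0 \<le> C" "\<bar>dens x y\<bar> \<le> C" "\<bar>dens x' y\<bar> \<le> C" for y
    using dens_le dens_nonneg unit kmass_pos[OF D_pos, of d] by (auto simp: C_def)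
  have bdd: "\<bar>dens x y * dens x' y' * ?\<phi> y y'\<bar> \<le> C * C * 1" for y y'
    unfolding abs_mult using C \<phi>_le_1 \<phi>_nonneg by (intro mult_mono mult_nonneg_nonneg) auto
  note [simp] = integrable_dens[OF unit(1)] integrable_dens[OF unit(2)] integral_dens[OF unit(1)] integral_dens[OF unit(2)]
    intb[OF unit(1)] intb[OF unit(2)]
  have inner: "c * dens x y - b x y - dens x y * \<beta>' \<le> (\<integral>y'. dens x y * dens x' y' * ?\<phi> y y' \<partial>gauss D)" for y
  proof -
    have "(\<integral>y'. c * (dens x y * dens x' y') - b x y * dens x' y' - dens x y * b x' y' \<partial>gauss D) \<le>
      (\<integral>y'. dens x y * dens x' y' * ?\<phi> y y' \<partial>gauss D)"
    proof (rule integral_mono[OF _ _ pw])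
      show "integrable (gauss D) (\<lambda>y'. dens x y * dens x' y' * ?\<phi> y y')"
        by (rule gauss.integrable_bounded[OF _ bdd]) measurable
    qed simp
    then show ?thesis by (simp add: \<beta>'_def)
  qed
  have "(\<integral>y. c * dens x y - b x y - dens x y * \<beta>' \<partial>gauss D) \<le>
    (\<integral>y. \<integral>y'. dens x y * dens x' y' * ?\<phi> y y' \<partial>gauss D \<partial>gauss D)"
  proof (rule integral_mono[OF _ _ inner])
    show "integrable (gauss D) (\<lambda>y. \<integral>y'. dens x y * dens x' y' * ?\<phi> y y' \<partial>gauss D)"
    proof (rule gauss.integrable_bounded)
      show "(\<lambda>y. \<integral>y'. dens x y * dens x' y' * ?\<phi> y y' \<partial>gauss D) \<in> borel_measurable (gauss D)"
        by measurable
      show "\<bar>\<integral>y'. dens x y * dens x' y' * ?\<phi> y y' \<partial>gauss D\<bar> \<le> C * C * 1" for y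
        by (rule gauss.abs_expectation_le[OF _ bdd]) (use C in simp)
    qed
  qed simp
  also have "\<dots> = (\<integral>M. overlap M x x' \<partial>gmat n D)"
    unfolding overlap_def smooth_def
    by (rule expectation_samp_quadratic[symmetric, OF _ _ C(2,3)]) measurable
  finally have "c - \<beta> - \<beta>' \<le> (\<integral>M. overlap M x x' \<partial>gmat n D)" by (simp add: \<beta>_def)
  then show ?thesis using bL[OF unit(1)] bL[OF unit(2)] by (simp add: \<beta>_def \<beta>'_def)
qed

lemma overlap_bounds:
  assumes "M \<in> space (gmat n D)" "ip D x x = 1" "ip D x' x' = 1"
  shows "0 \<le> overlap M x x'" "overlap M x x' \<le> 1"
proof -
  show "0 \<le> overlap M x x'" unfolding overlap_def
    using assms by (intro sum_nonneg mult_nonneg_nonneg smooth_nonneg) auto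
  have "overlap M x x' \<le> (\<Sum>i<k. smooth M i x * 1)" unfolding overlap_def
    using assms by (intro sum_mono mult_left_mono) (auto simp: smooth_nonneg smooth_le_1)
  then show "overlap M x x' \<le> 1" using sum_smooth[OF assms(1,2)] by simp
qed

lemma abs_overlap_le:
  "M \<in> space (gmat n D) \<Longrightarrow> \<bar>overlap M (nrm D a) (nrm D b)\<bar> \<le> 1"
  using overlap_bounds by (simp add: ip_nrm_self D_pos)

lemma measurable_overlap [measurable (raw)]:
  assumes [measurable]: "M \<in> W \<rightarrow>\<^sub>M gmat n D" "x \<in> W \<rightarrow>\<^sub>M Rn D" "x' \<in> W \<rightarrow>\<^sub>M Rn D"
  shows "(\<lambda>w. overlap (M w) (x w) (x' w)) \<in> borel_measurable W"
  unfolding overlap_def by (intro borel_measurable_sum) measurable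

lemma noise_stability_proj:
  assumes M: "M \<in> space (gmat n D)"
  shows "noise_stability D k \<rho> (proj M) =
    (\<integral>a. \<integral>z. overlap M (nrm D a) (nrm D (ou_point D \<rho> a z)) \<partial>gauss D \<partial>gauss D)"
proof -
  interpret P: simplex_fun D k "proj M" by unfold_locales (rule proj_simplex_fun[OF M])
  show ?thesis unfolding P.\<phi>_eq by (simp add: P.dot_def overlap_def proj_def)
qed

lemma integrable_noise_stability_proj:
  "integrable (gmat n D) (\<lambda>M. noise_stability D k \<rho> (proj M))"
proof -
  have "integrable (gmat n D) (\<lambda>M. \<integral>a. \<integral>z. overlap M (nrm D a) (nrm D (ou_point D \<rho> a z)) \<partial>gauss D \<partial>gauss D)"
  proof (rule gmat.integrable_bounded[of _ _ _ 1])
    show "(\<lambda>M. \<integral>a. \<integral>z. overlap M (nrm D a) (nrm D (ou_point D \<rho> a z)) \<partial>gauss D \<partial>gauss D) \<in> borel_measurable (gmat n D)"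
      by measurable
    show "\<bar>\<integral>a. \<integral>z. overlap M (nrm D a) (nrm D (ou_point D \<rho> a z)) \<partial>gauss D \<partial>gauss D\<bar> \<le> 1"
      if "M \<in> space (gmat n D)" for M
      by (intro gauss.abs_expectation_le abs_overlap_le that) simp_all
  qed
  then show ?thesis
    by (rule Bochner_Integration.integrable_cong[THEN iffD2, rotated -1]) (simp_all add: noise_stability_proj)
qed

text \<open>The correlation suffers twice: by 8 \<kappa> when the correlated points are projected to
  the sphere, and by the width of the kernel when each is replaced by a nearby sample. Exceptional
  pairs of points cost at most 1 because c \<le> 1 and the overlap is nonnegative.\<close>

lemma expectation_noise_stability_proj_ge:
  assumes \<Delta>: "0 < \<Delta>" and L: "0 < L" and d: "d = 4 * \<Delta> * (70 * D\<^sup>2 * \<Delta> + L)"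
    and c: "c \<le> 1" "\<And>t. \<tau> \<le> t \<Longrightarrow> t \<le> 1 \<Longrightarrow> c \<le> \<phi> t"
    and \<rho>: "0 \<le> \<rho>" "\<rho> \<le> 1" and \<kappa>: "0 < \<kappa>" "\<kappa> \<le> 1 / 4"
    and \<tau>: "\<tau> \<le> \<rho> - 8 * \<kappa> - 2 * sqrt (2 * (1 / real \<Delta>))"
  shows "c - 2 / real L - 5 / (\<kappa>\<^sup>2 * D) \<le> (\<integral>M. noise_stability D k \<rho> (proj M) \<partial>gmat n D)"
proof -
  let ?b = "\<lambda>a z. nrm D (ou_point D \<rho> a z)"
  let ?bad = "\<lambda>a z. (if \<bar>ip D (nrm D a) (?b a z) - \<rho>\<bar> \<le> 8 * \<kappa> then 0 else 1) :: real"
  let ?ov = "\<lambda>a z. \<integral>M. overlap M (nrm D a) (?b a z) \<partial>gmat n D"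
  note ob = abs_overlap_le
  have pw: "c - 2 / real L - ?bad a z \<le> ?ov a z" for a z
  proof (cases "\<bar>ip D (nrm D a) (?b a z) - \<rho>\<bar> \<le> 8 * \<kappa>")
    case True
    then have "\<tau> \<le> ip D (nrm D a) (?b a z) - 2 * sqrt (2 * (1 / real \<Delta>))"
      using \<tau> by (simp add: abs_le_iff)
    from expectation_overlap_ge[OF ip_nrm_self ip_nrm_self \<Delta> L d c this] D_pos
    show ?thesis using True by simp
  next
    case False
    have "0 \<le> ?ov a z"
      using overlap_bounds by (intro integral_nonneg_AE AE_I2) (simp add: ip_nrm_self D_pos)
    moreover have "0 \<le> 2 / real L" by simp
    ultimately have "c - 2 / real L - 1 \<le> ?ov a z" using c(1) by linarith
    then show ?thesis using False by simp
  qed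
  have m: "a \<in> space (Rn D)" if "a \<in> space (gauss D)" for a
    using that by (simp add: space_gauss space_PiM)
  have bm: "integrable (gauss D) (\<lambda>z. ?bad a z)" if "a \<in> space (gauss D)" for a
  proof (rule gauss.integrable_bounded[of _ _ 1])
    note m[OF that, measurable]
    show "(\<lambda>z. ?bad a z) \<in> borel_measurable (gauss D)" by measurable
  qed simp
  have bm2: "integrable (gauss D) (\<lambda>a. \<integral>z. ?bad a z \<partial>gauss D)"
  proof (rule gauss.integrable_bounded[of _ _ 1])
    show "(\<lambda>a. \<integral>z. ?bad a z \<partial>gauss D) \<in> borel_measurable (gauss D)" by measurable
    show "\<bar>\<integral>z. ?bad a z \<partial>gauss D\<bar> \<le> 1" for a by (intro gauss.abs_expectation_le) simp_all
  qed
  have om: "integrable (gauss D) (\<lambda>z. ?ov a z)" if "a \<in> space (gauss D)" for a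
  proof (rule gauss.integrable_bounded[of _ _ 1])
    note m[OF that, measurable]
    show "(\<lambda>z. ?ov a z) \<in> borel_measurable (gauss D)" by measurable
    show "\<bar>?ov a z\<bar> \<le> 1" for z by (intro gmat.abs_expectation_le ob) simp_all
  qed
  have om2: "integrable (gauss D) (\<lambda>a. \<integral>z. ?ov a z \<partial>gauss D)"
  proof (rule gauss.integrable_bounded[of _ _ 1])
    show "(\<lambda>a. \<integral>z. ?ov a z \<partial>gauss D) \<in> borel_measurable (gauss D)" by measurable
    show "\<bar>\<integral>z. ?ov a z \<partial>gauss D\<bar> \<le> 1" for a
      by (intro gauss.abs_expectation_le gmat.abs_expectation_le ob) simp_all
  qed
  have "(\<integral>a. c - 2 / real L - (\<integral>z. ?bad a z \<partial>gauss D) \<partial>gauss D) \<le> (\<integral>a. \<integral>z. ?ov a z \<partial>gauss D \<partial>gauss D)"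
  proof (rule integral_mono[OF _ om2])
    show "integrable (gauss D) (\<lambda>a. c - 2 / real L - (\<integral>z. ?bad a z \<partial>gauss D))"
      by (intro Bochner_Integration.integrable_diff bm2) simp_all
    fix a assume a: "a \<in> space (gauss D)"
    have "(\<integral>z. c - 2 / real L - ?bad a z \<partial>gauss D) \<le> (\<integral>z. ?ov a z \<partial>gauss D)"
      by (rule integral_mono[OF _ om[OF a] pw]) (use bm[OF a] in simp)
    then show "c - 2 / real L - (\<integral>z. ?bad a z \<partial>gauss D) \<le> (\<integral>z. ?ov a z \<partial>gauss D)"
      using bm[OF a] by (simp add: gauss.prob_space)
  qed
  moreover have "(\<integral>a. c - 2 / real L - (\<integral>z. ?bad a z \<partial>gauss D) \<partial>gauss D) = c - 2 / real L - (\<integral>a. \<integral>z. ?bad a z \<partial>gauss D \<partial>gauss D)"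
    using bm2 by (simp add: gauss.prob_space)
  moreover have "(\<integral>a. \<integral>z. ?bad a z \<partial>gauss D \<partial>gauss D) \<le> 5 / (\<kappa>\<^sup>2 * D)"
    by (rule nrm_ou_concentration[OF \<rho> \<kappa> D_pos])
  moreover have "(\<integral>a. \<integral>z. ?ov a z \<partial>gauss D \<partial>gauss D) = (\<integral>M. noise_stability D k \<rho> (proj M) \<partial>gmat n D)"
  proof -
    have "(\<integral>M. noise_stability D k \<rho> (proj M) \<partial>gmat n D) =
      (\<integral>M. \<integral>a. \<integral>z. overlap M (nrm D a) (?b a z) \<partial>gauss D \<partial>gauss D \<partial>gmat n D)"
      by (rule Bochner_Integration.integral_cong) (simp_all add: noise_stability_proj)
    also have "\<dots> = (\<integral>a. \<integral>M. \<integral>z. overlap M (nrm D a) (?b a z) \<partial>gauss D \<partial>gmat n D \<partial>gauss D)"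
    proof (rule integral_swap_bounded[OF gmat.prob_space_axioms gauss.prob_space_axioms])
      show "(\<lambda>(M, a). \<integral>z. overlap M (nrm D a) (?b a z) \<partial>gauss D) \<in> borel_measurable (gmat n D \<Otimes>\<^sub>M gauss D)"
        by measurable
      show "\<bar>\<integral>z. overlap M (nrm D a) (?b a z) \<partial>gauss D\<bar> \<le> 1" if "M \<in> space (gmat n D)" for M a
        by (intro gauss.abs_expectation_le ob that) simp
    qed
    also have "\<dots> = (\<integral>a. \<integral>z. ?ov a z \<partial>gauss D \<partial>gauss D)"
    proof (rule Bochner_Integration.integral_cong[OF refl])
      fix a assume a: "a \<in> space (gauss D)"
      note m[OF a, measurable]
      show "(\<integral>M. \<integral>z. overlap M (nrm D a) (?b a z) \<partial>gauss D \<partial>gmat n D) = (\<integral>z. ?ov a z \<partial>gauss D)"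
      proof (rule integral_swap_bounded[OF gmat.prob_space_axioms gauss.prob_space_axioms])
        show "(\<lambda>(M, z). overlap M (nrm D a) (?b a z)) \<in> borel_measurable (gmat n D \<Otimes>\<^sub>M gauss D)"
          by measurable
      qed (rule ob)
    qed
    finally show ?thesis ..
  qed
  ultimately show ?thesis by linarith
qed

lemma exists_good_proj:
  assumes \<Delta>: "0 < \<Delta>" and L: "0 < L" and d: "d = 4 * \<Delta> * (70 * D\<^sup>2 * \<Delta> + L)"
    and c: "c \<le> 1" "\<And>t. \<tau> \<le> t \<Longrightarrow> t \<le> 1 \<Longrightarrow> c \<le> \<phi> t"
    and \<rho>: "0 \<le> \<rho>" "\<rho> \<le> 1" and \<kappa>: "0 < \<kappa>" "\<kappa> \<le> 1 / 4"
    and \<tau>: "\<tau> \<le> \<rho> - 8 * \<kappa> - 2 * sqrt (2 * (1 / real \<Delta>))"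
    and \<kappa>': "0 < \<kappa>'" "\<kappa>' \<le> 1 / 4" and N: "0 < N" "real N * (8 * \<kappa>')\<^sup>2 \<le> 1"
    and \<Lambda>: "0 \<le> \<Lambda>"
  shows "\<exists>M\<in>space (gmat n D). c - 2 / real L - 5 / (\<kappa>\<^sup>2 * D) - \<Lambda> * (1 / sqrt N + 5 / (\<kappa>'\<^sup>2 * D))
    \<le> noise_stability D k \<rho> (proj M) - \<Lambda> * (\<Sum>i<k. (emp_mean i M - mean i)\<^sup>2)"
proof -
  have "\<bar>emp_mean i M - mean i\<bar> \<le> 1" if "M \<in> space (gmat n D)" "i < k" for M i
    using emp_mean_bounds[OF that] mean_bounds[OF that(2)] by (simp add: abs_le_iff)
  then have int: "integrable (gmat n D) (\<lambda>M. \<Sum>i<k. (emp_mean i M - mean i)\<^sup>2)"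
    by (intro Bochner_Integration.integrable_sum gmat.integrable_bounded[of _ _ _ 1]) (auto simp: abs_square_le_1)
  have "c - 2 / real L - 5 / (\<kappa>\<^sup>2 * D) - \<Lambda> * (1 / sqrt N + 5 / (\<kappa>'\<^sup>2 * D)) \<le>
    (\<integral>M. noise_stability D k \<rho> (proj M) \<partial>gmat n D) - \<Lambda> * (\<integral>M. (\<Sum>i<k. (emp_mean i M - mean i)\<^sup>2) \<partial>gmat n D)"
    using expectation_noise_stability_proj_ge[OF \<Delta> L d c \<rho> \<kappa> \<tau>] expectation_emp_mean_deviation_le[OF \<kappa>' N]
    by (intro diff_mono mult_left_mono \<Lambda>) auto
  also have "\<dots> = (\<integral>M. noise_stability D k \<rho> (proj M) - \<Lambda> * (\<Sum>i<k. (emp_mean i M - mean i)\<^sup>2) \<partial>gmat n D)"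
    using int integrable_noise_stability_proj by simp
  moreover have "integrable (gmat n D) (\<lambda>M. noise_stability D k \<rho> (proj M) - \<Lambda> * (\<Sum>i<k. (emp_mean i M - mean i)\<^sup>2))"
    using int integrable_noise_stability_proj by simp
  from gmat.exists_ge_expectation[OF this] obtain M where "M \<in> space (gmat n D)"
    "(\<integral>M. noise_stability D k \<rho> (proj M) - \<Lambda> * (\<Sum>i<k. (emp_mean i M - mean i)\<^sup>2) \<partial>gmat n D) \<le>
      noise_stability D k \<rho> (proj M) - \<Lambda> * (\<Sum>i<k. (emp_mean i M - mean i)\<^sup>2)" ..
  ultimately show ?thesis by (intro bexI[of _ M]) auto
qed

end

section \<open>Polynomials on the sphere\<close>

definition mon :: "(nat \<Rightarrow>\<^sub>0 nat) \<Rightarrow> (nat \<Rightarrow> real) \<Rightarrow> real" where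
  "mon m x = (\<Prod>i\<in>Poly_Mapping.keys m. x i ^ Poly_Mapping.lookup m i)"

definition mdeg :: "(nat \<Rightarrow>\<^sub>0 nat) \<Rightarrow> nat" where
  "mdeg m = (\<Sum>i\<in>Poly_Mapping.keys m. Poly_Mapping.lookup m i)"

lemma mon_superset:
  "finite S \<Longrightarrow> Poly_Mapping.keys m \<subseteq> S \<Longrightarrow> mon m x = (\<Prod>i\<in>S. x i ^ Poly_Mapping.lookup m i)"
  unfolding mon_def by (rule prod.mono_neutral_left) (auto simp: in_keys_iff)

lemma mdeg_superset:
  "finite S \<Longrightarrow> Poly_Mapping.keys m \<subseteq> S \<Longrightarrow> mdeg m = (\<Sum>i\<in>S. Poly_Mapping.lookup m i)"
  unfolding mdeg_def by (rule sum.mono_neutral_left) (auto simp: in_keys_iff)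

lemma mon_add: "mon (m + m') x = mon m x * mon m' x"
  by (simp add: mon_superset[of "Poly_Mapping.keys m \<union> Poly_Mapping.keys m'"] Poly_Mapping.keys_add
    lookup_add power_add prod.distrib)

lemma mdeg_add: "mdeg (m + m') = mdeg m + mdeg m'"
  by (simp add: mdeg_superset[of "Poly_Mapping.keys m \<union> Poly_Mapping.keys m'"] Poly_Mapping.keys_add
    lookup_add sum.distrib)

lemma mon_0 [simp]: "mon 0 x = 1" and mdeg_0 [simp]: "mdeg 0 = 0"
  by (simp_all add: mon_def mdeg_def)

lemma mon_single [simp]: "mon (Poly_Mapping.single i e) x = x i ^ e"
  and mdeg_single [simp]: "mdeg (Poly_Mapping.single i e) = e"
  by (simp_all add: mon_def mdeg_def)

lemma mpoly_eval_superset: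
  "finite S \<Longrightarrow> Poly_Mapping.keys p \<subseteq> S \<Longrightarrow> mpoly_eval p x = (\<Sum>m\<in>S. Poly_Mapping.lookup p m * mon m x)"
  unfolding mpoly_eval_def mon_def by (rule sum.mono_neutral_left) (auto simp: in_keys_iff)

lemma mpoly_eval_add: "mpoly_eval (p + q) x = mpoly_eval p x + mpoly_eval q x"
  by (simp add: mpoly_eval_superset[of "Poly_Mapping.keys p \<union> Poly_Mapping.keys q"] Poly_Mapping.keys_add
    lookup_add sum.distrib distrib_right)

lemma mpoly_eval_0 [simp]: "mpoly_eval 0 x = 0"
  by (simp add: mpoly_eval_def)

lemma mpoly_eval_single [simp]: "mpoly_eval (Poly_Mapping.single m c) x = c * mon m x"
  by (simp add: mpoly_eval_def mon_def)

lemma mpoly_eval_sum: "mpoly_eval (\<Sum>a\<in>I. p a) x = (\<Sum>a\<in>I. mpoly_eval (p a) x)"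
  by (induction I rule: infinite_finite_induct) (simp_all add: mpoly_eval_add)

text \<open>A word of length \<open>d\<close> selects one summand from each factor of (1 + x_0 u_0 +
  ... )^d; the letter \<open>D\<close> stands for the summand 1. Summing over words avoids
  multinomial coefficients.\<close>

definition word_mon :: "nat \<Rightarrow> nat \<Rightarrow> (nat \<Rightarrow> nat) \<Rightarrow> (nat \<Rightarrow>\<^sub>0 nat)" where
  "word_mon D d w = (\<Sum>l<d. if w l < D then Poly_Mapping.single (w l) 1 else 0)"

lemma mon_word_mon: "mon (word_mon D d w) x = (\<Prod>l<d. if w l < D then x (w l) else 1)"
  unfolding word_mon_def by (induction d) (simp_all add: mon_add)

lemma mdeg_word_mon: "mdeg (word_mon D d w) \<le> d"
  unfolding word_mon_def by (induction d) (simp_all add: mdeg_add)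

lemma keys_word_mon: "Poly_Mapping.keys (word_mon D d w) \<subseteq> {..<D}"
  unfolding word_mon_def
proof (induction d)
  case (Suc d)
  then show ?case
    using Poly_Mapping.keys_add[of "\<Sum>l<d. if w l < D then Poly_Mapping.single (w l) 1 else 0"
      "if w d < D then Poly_Mapping.single (w d) (1::nat) else 0"]
    by (force split: if_splits)
qed simp

text \<open>Separates the variables: after integration over \<open>u\<close> only monomials in
  \<open>x\<close> with constant coefficients remain.\<close>

lemma one_plus_ip_power:
  "(1 + ip D x u) ^ d = (\<Sum>w\<in>{..<d} \<rightarrow>\<^sub>E {..D}. mon (word_mon D d w) x * mon (word_mon D d w) u)"
proof -
  have "1 + ip D x u = (\<Sum>j\<le>D. if j < D then x j * u j else 1)"
    by (simp add: lessThan_Suc_atMost[symmetric] ip_def)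
  then have "(1 + ip D x u) ^ d = (\<Prod>l<d. \<Sum>j\<le>D. if j < D then x j * u j else 1)" by simp
  also have "\<dots> = (\<Sum>w\<in>{..<d} \<rightarrow>\<^sub>E {..D}. \<Prod>l<d. if w l < D then x (w l) * u (w l) else 1)"
    by (rule prod_sum_PiE) auto
  also have "\<dots> = (\<Sum>w\<in>{..<d} \<rightarrow>\<^sub>E {..D}. mon (word_mon D d w) x * mon (word_mon D d w) u)"
    unfolding mon_word_mon prod.distrib[symmetric] by (intro sum.cong prod.cong refl) auto
  finally show ?thesis .
qed

text \<open>Vanishes on the unit sphere; adding it fixes the degree without changing the values there.\<close>

definition sphere_poly :: "nat \<Rightarrow> nat \<Rightarrow> mpoly" where
  "sphere_poly D d = (\<Sum>j<D. Poly_Mapping.single (Poly_Mapping.single 0 d + Poly_Mapping.single j 2) 1) +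
    Poly_Mapping.single (Poly_Mapping.single 0 d) (- 1)"

lemma mpoly_eval_sphere_poly: "ip D x x = 1 \<Longrightarrow> mpoly_eval (sphere_poly D d) x = 0"
  by (simp add: sphere_poly_def mpoly_eval_add mpoly_eval_sum mon_add ip_def power2_eq_square
    flip: sum_distrib_left)

lemma keys_sphere_poly:
  "Poly_Mapping.keys (sphere_poly D d) \<subseteq>
    insert (Poly_Mapping.single 0 d) ((\<lambda>j. Poly_Mapping.single 0 d + Poly_Mapping.single j 2) ` {..<D})"
proof -
  have "Poly_Mapping.keys (\<Sum>j<D. Poly_Mapping.single (Poly_Mapping.single 0 d + Poly_Mapping.single j 2) (1::real)) \<subseteq>
    (\<lambda>j. Poly_Mapping.single 0 d + Poly_Mapping.single j 2) ` {..<D}"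
    by (rule order.trans[OF Poly_Mapping.keys_sum]) auto
  then show ?thesis
    unfolding sphere_poly_def by (intro order.trans[OF Poly_Mapping.keys_add]) auto
qed

text \<open>The power x_0^(d+2) arises from j = 0 only, so it cannot cancel and certifies the
  degree.\<close>

lemma lookup_sphere_poly:
  assumes "0 < D"
  shows "Poly_Mapping.lookup (sphere_poly D d) (Poly_Mapping.single 0 (d + 2)) = 1"
proof -
  have eq: "(Poly_Mapping.single 0 d + Poly_Mapping.single j 2 = Poly_Mapping.single 0 (d + 2)) \<longleftrightarrow> j = 0"
    (is "?l \<longleftrightarrow> _") for j :: nat
  proof
    assume ?l
    then have "Poly_Mapping.lookup (Poly_Mapping.single 0 d + Poly_Mapping.single j 2) 0 =
      Poly_Mapping.lookup (Poly_Mapping.single (0::nat) (d + 2)) 0" by simp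
    then show "j = 0" by (simp add: lookup_add lookup_single when_def split: if_splits)
  qed (simp only: Poly_Mapping.single_add)
  have neq: "Poly_Mapping.single (0::nat) d \<noteq> Poly_Mapping.single 0 (d + 2)"
    by (metis mdeg_single add_eq_self_zero zero_neq_numeral)
  have "Poly_Mapping.lookup (sphere_poly D d) (Poly_Mapping.single 0 (d + 2)) =
    (\<Sum>j<D. if j = 0 then 1 else 0)"
    using neq by (simp add: sphere_poly_def lookup_add lookup_sum lookup_single when_def eq del: add_2_eq_Suc')
  then show ?thesis using assms by simp
qed

context projected
begin

lemma smooth_polynomial:
  assumes M: "M \<in> space (gmat n D)" and i: "i < k"
  shows "\<exists>p. mpoly_in D p \<and> mpoly_degree p = d + 2 \<and>
    (\<forall>x. ip D x x = 1 \<longrightarrow> mpoly_eval p x = smooth M i x)"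
proof -
  let ?W = "{..<d} \<rightarrow>\<^sub>E {..D}"
  have finW: "finite ?W" by (intro finite_PiE) auto
  define cf where "cf w = (\<integral>y. samp M y i * mon (word_mon D d w) (nrm D y) \<partial>gauss D) / kmass D d" for w
  define p where "p = (\<Sum>w\<in>?W. Poly_Mapping.single (word_mon D d w) (cf w))"
  have abs_nrm: "\<bar>nrm D y j\<bar> \<le> 1" if "j < D" for y j
  proof -
    have "nrm D y j * nrm D y j \<le> ip D (nrm D y) (nrm D y)"
      unfolding ip_def using that by (intro member_le_sum) auto
    then show ?thesis by (simp add: ip_nrm_self D_pos abs_square_le_1 flip: power2_eq_square)
  qed
  have int: "integrable (gauss D) (\<lambda>y. samp M y i * mon (word_mon D d w) (nrm D y))" for w
  proof (rule gauss.integrable_bounded)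
    have [measurable]: "(\<lambda>y. if w l < D then nrm D y (w l) else 1) \<in> borel_measurable (gauss D)" for l
      by (cases "w l < D") simp_all
    show "(\<lambda>y. samp M y i * mon (word_mon D d w) (nrm D y)) \<in> borel_measurable (gauss D)"
      unfolding mon_word_mon using M i by measurable
    fix y
    have "\<bar>mon (word_mon D d w) (nrm D y)\<bar> \<le> (\<Prod>l<d. 1)"
      unfolding mon_word_mon abs_prod using abs_nrm by (intro prod_mono) auto
    then have "\<bar>samp M y i\<bar> * \<bar>mon (word_mon D d w) (nrm D y)\<bar> \<le> 1 * 1"
      using samp_bounds[OF i] by (intro mult_mono) auto
    then show "\<bar>samp M y i * mon (word_mon D d w) (nrm D y)\<bar> \<le> 1" by (simp add: abs_mult)
  qed
  have eval: "mpoly_eval p x = smooth M i x" for x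
  proof -
    have "smooth M i x = (\<integral>y. (\<Sum>w\<in>?W. mon (word_mon D d w) x * (samp M y i * mon (word_mon D d w) (nrm D y))) / kmass D d \<partial>gauss D)"
      unfolding smooth_def dens_def kern_def one_plus_ip_power
      by (intro Bochner_Integration.integral_cong refl) (simp add: sum_distrib_left mult_ac)
    also have "\<dots> = (\<Sum>w\<in>?W. mon (word_mon D d w) x * (\<integral>y. samp M y i * mon (word_mon D d w) (nrm D y) \<partial>gauss D)) / kmass D d"
      using int by (simp add: Bochner_Integration.integral_sum)
    also have "\<dots> = mpoly_eval p x"
      by (simp add: p_def mpoly_eval_sum cf_def sum_divide_distrib mult_ac)
    finally show ?thesis ..
  qed
  have keysp: "Poly_Mapping.keys p \<subseteq> word_mon D d ` ?W"
    unfolding p_def by (rule order.trans[OF Poly_Mapping.keys_sum]) auto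
  \<comment> \<open>The statement prescribes the degree exactly, whereas \<open>p\<close> may have
    any degree up to \<open>d\<close>, for instance when \<open>f\<close> is constant. The new
    leading monomial exceeds every degree in \<open>p\<close>.\<close>
  let ?q = "p + sphere_poly D d"
  have keysq: "Poly_Mapping.keys ?q \<subseteq> word_mon D d ` ?W \<union>
    insert (Poly_Mapping.single 0 d) ((\<lambda>j. Poly_Mapping.single 0 d + Poly_Mapping.single j 2) ` {..<D})"
    using Poly_Mapping.keys_add[of p "sphere_poly D d"] keysp keys_sphere_poly[of D d] by blast
  have keys_D: "Poly_Mapping.keys m \<subseteq> {..<D}" and deg_d: "mdeg m \<le> d + 2" if m: "m \<in> Poly_Mapping.keys ?q" for m
  proof -
    consider w where "m = word_mon D d w" | "m = Poly_Mapping.single 0 d"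
      | j where "j < D" "m = Poly_Mapping.single 0 d + Poly_Mapping.single j 2"
      using m keysq by blast
    then show "Poly_Mapping.keys m \<subseteq> {..<D}"
    proof cases
      case 1
      then show ?thesis by (simp add: keys_word_mon)
    next
      case 2
      then show ?thesis using D_pos by simp
    next
      case 3
      have "Poly_Mapping.keys m \<subseteq> {0, j}"
        unfolding 3 by (rule order.trans[OF Poly_Mapping.keys_add]) simp
      then show ?thesis using 3 D_pos by auto
    qed
    have "m \<in> word_mon D d ` ?W \<or> m = Poly_Mapping.single 0 d \<or>
      (\<exists>j<D. m = Poly_Mapping.single 0 d + Poly_Mapping.single j 2)"
      using m keysq by blast
    then show "mdeg m \<le> d + 2"
      by (auto simp: mdeg_add intro: le_SucI mdeg_word_mon)
  qed
  have top: "Poly_Mapping.single 0 (d + 2) \<in> Poly_Mapping.keys ?q"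
  proof -
    have "Poly_Mapping.single 0 (d + 2) \<notin> Poly_Mapping.keys p"
    proof
      assume "Poly_Mapping.single 0 (d + 2) \<in> Poly_Mapping.keys p"
      then obtain w where "Poly_Mapping.single 0 (d + 2) = word_mon D d w" using keysp by auto
      then have "d + 2 \<le> d" using mdeg_word_mon[of D d w] by (metis mdeg_single)
      then show False by simp
    qed
    then have "Poly_Mapping.lookup ?q (Poly_Mapping.single 0 (d + 2)) = 1"
      by (simp add: lookup_add lookup_sphere_poly[OF D_pos, unfolded add_2_eq_Suc'] in_keys_iff)
    then show ?thesis by (simp add: in_keys_iff)
  qed
  have "mpoly_degree ?q = Max (insert 0 (mdeg ` Poly_Mapping.keys ?q))"
    by (simp add: mpoly_degree_def mdeg_def[abs_def])
  also have "\<dots> = d + 2"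
  proof (rule Max_eqI)
    have "mdeg (Poly_Mapping.single 0 (d + 2)) \<in> mdeg ` Poly_Mapping.keys ?q"
      using top by (rule imageI)
    then show "d + 2 \<in> insert 0 (mdeg ` Poly_Mapping.keys ?q)" by simp
  qed (use deg_d in auto)
  finally have "mpoly_degree ?q = d + 2" .
  moreover have "mpoly_in D ?q" using keys_D by (auto simp: mpoly_in_def)
  ultimately show ?thesis
    by (intro exI[of _ ?q]) (simp add: mpoly_eval_add eval mpoly_eval_sphere_poly)
qed

lemma proj_polynomial:
  assumes M: "M \<in> space (gmat n D)" and k: "0 < k"
  shows "\<exists>g. poly_map_of_degree D k (d + 2) g \<and>
    (\<forall>a. ip D a a \<noteq> 0 \<longrightarrow> poly_map_eval k g (unit_vector D a) = proj M a)"
proof -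
  obtain g where g: "\<And>i. i < k \<Longrightarrow> mpoly_in D (g i) \<and> mpoly_degree (g i) = d + 2 \<and>
    (\<forall>x. ip D x x = 1 \<longrightarrow> mpoly_eval (g i) x = smooth M i x)"
    using smooth_polynomial[OF M] by metis
  have "(\<lambda>i. mpoly_degree (g i)) ` {..<k} = {d + 2}" using g k by force
  then have "poly_map_of_degree D k (d + 2) g" using g by (simp add: poly_map_of_degree_def)
  moreover have "poly_map_eval k g (unit_vector D a) = proj M a" if "ip D a a \<noteq> 0" for a
    using g ip_unit_self[OF that] by (auto simp: poly_map_eval_def proj_def nrm_eq[OF that] fun_eq_iff)
  ultimately show ?thesis by blast
qed

end

text \<open>\<open>arg_min_on\<close> chooses some minimiser. Here the minimum is 0, attained at
  \<open>v\<close>, so any minimiser agrees with \<open>v\<close> on the first \<open>k\<close>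
  coordinates, and extensionality gives the rest.\<close>

lemma rounding_simplex:
  assumes v: "v \<in> prob_simplex k"
  shows "rounding k v = v"
proof -
  let ?h = "\<lambda>w. L2_set (\<lambda>i. v i - w i) {..<k}"
  have [simp]: "L2_set (\<lambda>i. 0) {..<k} = 0" by (simp add: L2_set_def)
  have "is_arg_min ?h (\<lambda>w. w \<in> prob_simplex k) v"
    using v by (auto simp: is_arg_min_def not_less L2_set_nonneg)
  then have am: "is_arg_min ?h (\<lambda>w. w \<in> prob_simplex k) (rounding k v)"
    unfolding rounding_def arg_min_on_def arg_min_def
    by (rule someI[of "is_arg_min ?h (\<lambda>w. w \<in> prob_simplex k)"])
  then have "?h (rounding k v) \<le> 0" and mem: "rounding k v \<in> prob_simplex k"
    using v by (force simp: is_arg_min_def not_less)+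
  then have "?h (rounding k v) = 0" using L2_set_nonneg order_antisym by blast
  then have "\<forall>i<k. v i = rounding k v i" by (simp add: L2_set_eq_0_iff)
  then show ?thesis
    using v mem by (intro ext) (auto simp: prob_simplex_def PiE_def extensional_def; metis)
qed

section \<open>Stable partitions of the line\<close>

interpretation normal_dist: real_distribution \<N>
  by (rule real_dist_normal_dist)

abbreviation \<Phi> :: "real \<Rightarrow> real" where
  "\<Phi> \<equiv> cdf \<N>"

lemma emeasure_normal_le:
  assumes [measurable]: "A \<in> sets borel"
  shows "emeasure \<N> A \<le> emeasure lborel A"
proof -
  have "std_normal_density x \<le> 1" for x
  proof -
    have "sqrt 1 \<le> sqrt (2 * pi)" using pi_ge_two by (intro real_sqrt_le_mono) simp
    then have "1 / sqrt (2 * pi) \<le> 1" by simp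
    then have "1 / sqrt (2 * pi) * exp (- x\<^sup>2 / 2) \<le> 1 * 1" by (intro mult_mono) auto
    then show ?thesis by (simp add: std_normal_density_def)
  qed
  note dens = this
  have "emeasure \<N> A = (\<integral>\<^sup>+x. ennreal (std_normal_density x) * indicator A x \<partial>lborel)"
    by (rule emeasure_density) simp_all
  also have "\<dots> \<le> (\<integral>\<^sup>+x. indicator A x \<partial>lborel)"
    by (intro nn_integral_mono) (use dens in \<open>auto split: split_indicator\<close>)
  finally show ?thesis by simp
qed

lemma \<Phi>_diff_le: "x \<le> y \<Longrightarrow> \<Phi> y - \<Phi> x \<le> y - x"
proof (cases "x = y")
  case False
  assume "x \<le> y"
  then have "x < y" using False by simp
  then have "\<Phi> y - \<Phi> x = normal.prob {x<..y}" by (rule normal_dist.cdf_diff_eq)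
  also have "ennreal \<dots> \<le> ennreal (y - x)"
    using emeasure_normal_le[of "{x<..y}"] \<open>x < y\<close> by (simp add: normal.emeasure_eq_measure)
  then have "normal.prob {x<..y} \<le> y - x" using \<open>x < y\<close> by (subst (asm) ennreal_le_iff) auto
  finally show ?thesis .
qed simp

lemma abs_\<Phi>_diff_le: "\<bar>\<Phi> x - \<Phi> y\<bar> \<le> \<bar>x - y\<bar>"
  using \<Phi>_diff_le[of x y] \<Phi>_diff_le[of y x] normal_dist.cdf_nondecreasing[of x y] normal_dist.cdf_nondecreasing[of y x]
  by (cases "x \<le> y") auto

lemma isCont_\<Phi>: "isCont \<Phi> x"
  using emeasure_normal_le[of "{x}"] by (simp add: normal_dist.isCont_cdf measure_def)

lemma measurable_\<Phi> [measurable]: "\<Phi> \<in> borel_measurable borel"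
  by (intro borel_measurable_continuous_onI continuous_at_imp_continuous_on ballI isCont_\<Phi>)

lemma \<Phi>_surj:
  assumes "0 < c" "c < 1"
  shows "\<exists>b. \<Phi> b = c"
proof -
  have "eventually (\<lambda>x. \<Phi> x < c) at_bot"
    by (rule order_tendstoD(2)[OF normal_dist.cdf_lim_at_bot assms(1)])
  then obtain a where a: "\<Phi> a < c" using eventually_happens'[OF trivial_limit_at_bot_linorder] by blast
  have "eventually (\<lambda>x. c < \<Phi> x) at_top"
    by (rule order_tendstoD(1)[OF normal_dist.cdf_lim_at_top_prob assms(2)])
  then obtain b where b: "c < \<Phi> b" using eventually_happens'[OF trivial_limit_at_top_linorder] by blast
  have "a \<le> b" using a b normal_dist.cdf_nondecreasing[of b a] by (meson linear not_le order.strict_trans order.strict_trans2)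
  then show ?thesis
    using IVT[of \<Phi> a c b] a b isCont_\<Phi> by auto
qed

text \<open>The probability integral transform: \<Phi> of a standard Gaussian is uniform on [0, 1].
  The extreme values of \<open>c\<close> need not have preimages under \<Phi>, hence the
  approximation from below by smaller \<open>c'\<close>.\<close>

lemma prob_\<Phi>_less:
  assumes "0 \<le> c" "c \<le> 1"
  shows "normal.prob {x. \<Phi> x < c} = c"
proof (rule antisym)
  have meas: "{x. \<Phi> x < c} \<in> sets borel" by measurable
  show "normal.prob {x. \<Phi> x < c} \<le> c"
  proof (cases "c = 0 \<or> c = 1")
    case True
    then show ?thesis
      using normal.prob_le_1 normal_dist.cdf_nonneg by (auto simp: not_less[symmetric])
  next
    case False
    then obtain b where b: "\<Phi> b = c" using \<Phi>_surj[of c] assms by auto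
    have "{x. \<Phi> x < c} \<subseteq> {..b}"
    proof
      fix x assume "x \<in> {x. \<Phi> x < c}"
      then have "\<not> \<Phi> b \<le> \<Phi> x" using b by simp
      then show "x \<in> {..b}" using normal_dist.cdf_nondecreasing[of b x] by force
    qed
    then have "normal.prob {x. \<Phi> x < c} \<le> normal.prob {..b}" by (intro normal.finite_measure_mono) auto
    then show ?thesis using b by (simp add: cdf_def)
  qed
  show "c \<le> normal.prob {x. \<Phi> x < c}"
  proof (rule dense_le)
    fix c' assume "c' < c"
    show "c' \<le> normal.prob {x. \<Phi> x < c}"
    proof (cases "0 < c'")
      case True
      then obtain b where b: "\<Phi> b = c'" using \<Phi>_surj[of c'] \<open>c' < c\<close> assms by auto
      have "{..b} \<subseteq> {x. \<Phi> x < c}"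
        using normal_dist.cdf_nondecreasing[of _ b] b \<open>c' < c\<close> by force
      then have "normal.prob {..b} \<le> normal.prob {x. \<Phi> x < c}" using meas by (intro normal.finite_measure_mono) auto
      then show ?thesis using b by (simp add: cdf_def)
    next
      case False
      then show ?thesis using measure_nonneg[of \<N> "{x. \<Phi> x < c}"] by linarith
    qed
  qed
qed

lemma prob_\<Phi>_ge:
  assumes "0 \<le> c" "c \<le> 1"
  shows "normal.prob {x. c \<le> \<Phi> x} = 1 - c"
proof -
  have meas: "{x. \<Phi> x < c} \<in> sets borel" by measurable
  have "{x. c \<le> \<Phi> x} = space \<N> - {x. \<Phi> x < c}" by auto
  then show ?thesis using normal.prob_compl[of "{x. \<Phi> x < c}"] meas prob_\<Phi>_less[OF assms] by simp
qed

lemma prob_\<Phi>_near: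
  assumes "0 \<le> c" "c \<le> 1" "0 < h"
  shows "normal.prob {x. \<bar>\<Phi> x - c\<bar> \<le> h} \<le> 3 * h"
proof -
  \<comment> \<open>Reaching up to c + 2 h instead of c + h puts the levels from \<open>u\<close> on
    strictly outside the closed interval around \<open>c\<close>, except where \<open>u\<close> is
    cut off at 1; there the null set \<Phi> = 1 is removed.\<close>
  define l u where "l = max 0 (c - h)" and "u = min 1 (c + 2 * h)"
  have lu: "0 \<le> l" "l \<le> 1" "0 \<le> u" "u \<le> 1" "l \<le> u" "u - l \<le> 3 * h" using assms by (auto simp: l_def u_def)
  have ge: "{x. l \<le> \<Phi> x} = {x. \<bar>\<Phi> x - c\<bar> \<le> h} \<union> ({x. l \<le> \<Phi> x} - {x. \<bar>\<Phi> x - c\<bar> \<le> h})"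
    using normal_dist.cdf_nonneg by (auto simp: l_def abs_le_iff)
  have "{x. u \<le> \<Phi> x} - {x. \<Phi> x = 1} \<subseteq> {x. l \<le> \<Phi> x} - {x. \<bar>\<Phi> x - c\<bar> \<le> h}"
  proof
    fix x assume x: "x \<in> {x. u \<le> \<Phi> x} - {x. \<Phi> x = 1}"
    have "u \<noteq> 1" using x normal_dist.cdf_bounded_prob[of x] by auto
    then have "u = c + 2 * h" by (simp add: u_def min_def split: if_splits)
    then have "\<not> \<bar>\<Phi> x - c\<bar> \<le> h" using x assms by simp
    then show "x \<in> {x. l \<le> \<Phi> x} - {x. \<bar>\<Phi> x - c\<bar> \<le> h}" using x lu by simp
  qed
  moreover have "normal.prob {x. \<Phi> x = 1} = 0"
  proof -
    have "{x. \<Phi> x = 1} = {x. 1 \<le> \<Phi> x}" using normal_dist.cdf_bounded_prob by (auto intro: antisym)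
    then show ?thesis using prob_\<Phi>_ge[of 1] by simp
  qed
  then have "normal.prob ({x. u \<le> \<Phi> x} - {x. \<Phi> x = 1}) = normal.prob {x. u \<le> \<Phi> x}"
    by (intro measure_Diff_null_set) (auto simp: null_sets_def normal.emeasure_eq_measure)
  ultimately have "1 - u \<le> normal.prob ({x. l \<le> \<Phi> x} - {x. \<bar>\<Phi> x - c\<bar> \<le> h})"
    using normal.finite_measure_mono[of "{x. u \<le> \<Phi> x} - {x. \<Phi> x = 1}" "{x. l \<le> \<Phi> x} - {x. \<bar>\<Phi> x - c\<bar> \<le> h}"]
      prob_\<Phi>_ge[OF lu(3,4)] by simp
  moreover have "normal.prob {x. l \<le> \<Phi> x} = normal.prob {x. \<bar>\<Phi> x - c\<bar> \<le> h} + normal.prob ({x. l \<le> \<Phi> x} - {x. \<bar>\<Phi> x - c\<bar> \<le> h})"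
    by (subst ge, rule normal.finite_measure_Union) auto
  ultimately show ?thesis using prob_\<Phi>_ge[OF lu(1,2)] lu(6) by linarith
qed

lemma distr_gauss_1: "distr (gauss 1) borel (\<lambda>x. x 0) = \<N>"
proof (rule measure_eqI)
  fix A assume A: "A \<in> sets (distr (gauss 1) borel (\<lambda>x. x 0))"
  then have [measurable]: "A \<in> sets borel" by simp
  have "emeasure (distr (gauss 1) borel (\<lambda>x. x 0)) A = (\<integral>\<^sup>+x. indicator A (x 0) \<partial>gauss (Suc 0))"
    by (subst nn_integral_indicator[symmetric], simp, subst nn_integral_distr) simp_all
  also have "\<dots> = (\<integral>\<^sup>+r. indicator A r \<partial>\<N>)"
    by (subst nn_integral_gauss_Suc) (simp_all add: gauss.emeasure_space_1)
  finally show "emeasure (distr (gauss 1) borel (\<lambda>x. x 0)) A = emeasure \<N> A"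
    by simp
qed simp

lemma integral_gauss_1:
  fixes g :: "real \<Rightarrow> real"
  assumes [measurable]: "g \<in> borel_measurable borel"
  shows "(\<integral>x. g (x 0) \<partial>gauss 1) = (\<integral>r. g r \<partial>\<N>)"
  by (subst distr_gauss_1[symmetric], subst integral_distr) simp_all

text \<open>The line is cut at the quantiles of the partial sums of \<mu>. Two correlated points lie
  in different pieces only if they are more than \<open>h\<close> apart or the first has a \<Phi>
  value within \<open>h\<close> of a cut, \<Phi> being 1-Lipschitz. The former is bounded by E (r -
  r')^2 / h^2 with E (r - r')^2 = 2 (1 - \<rho>), the latter by 3 h per cut.\<close>

lemma exists_stable_partition:
  assumes \<mu>: "\<mu> \<in> prob_simplex k" and \<rho>: "0 \<le> \<rho>" "\<rho> \<le> 1" and h: "0 < h"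
  shows "\<exists>F. measurable_simplex_fun 1 k F \<and> (\<forall>i<k. (\<integral>x. F x i \<partial>gauss 1) = \<mu> i) \<and>
    1 - 2 * (1 - \<rho>) / h\<^sup>2 - 3 * real k * h \<le> noise_stability 1 k \<rho> F"
proof -
  have \<mu>_nn: "\<And>i. i < k \<Longrightarrow> 0 \<le> \<mu> i" and \<mu>_sum: "(\<Sum>i<k. \<mu> i) = 1"
    using \<mu> by (auto simp: prob_simplex_def)
  have k: "0 < k" using \<mu>_sum by (cases k) auto
  define c where "c j = (\<Sum>i<j. \<mu> i)" for j
  have c_mono: "c i \<le> c j" if "i \<le> j" "j \<le> k" for i j
    unfolding c_def using that \<mu>_nn by (intro sum_mono2) auto
  have c_bounds: "0 \<le> c j" "c j \<le> 1" if "j \<le> k" for j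
    using c_mono[of 0 j] c_mono[of j k] that \<mu>_sum by (auto simp: c_def)
  \<comment> \<open>Comparing \<Phi> with the levels needs no infinite cut points, and the maximum
    skips pieces of mass 0. Level 0 is always reached, so the set is nonempty.\<close>
  define idx where "idx r = Max {j \<in> {..<k}. c j \<le> \<Phi> r}" for r
  have fin: "finite {j \<in> {..<k}. c j \<le> \<Phi> r}" "0 \<in> {j \<in> {..<k}. c j \<le> \<Phi> r}" for r
    using k normal_dist.cdf_nonneg by (auto simp: c_def)
  have "idx r \<in> {j \<in> {..<k}. c j \<le> \<Phi> r}" for r
    unfolding idx_def using fin(2)[of r] by (intro Max_in[OF fin(1)]) blast
  then have idx_mem: "idx r < k" "c (idx r) \<le> \<Phi> r" for r by auto
  have idx_ge: "i \<le> idx r \<longleftrightarrow> c i \<le> \<Phi> r" if "i < k" for i r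
    using c_mono[of i "idx r"] idx_mem[of r] that Max_ge[OF fin(1)[of r], of i] unfolding idx_def[symmetric]
    by (auto intro: order.trans)
  have idx_eq: "idx r = i \<longleftrightarrow> c i \<le> \<Phi> r \<and> (Suc i < k \<longrightarrow> \<not> c (Suc i) \<le> \<Phi> r)" if "i < k" for i r
  proof (cases "Suc i < k")
    case True
    then show ?thesis using idx_ge[of i r] idx_ge[of "Suc i" r] that by auto
  next
    case False
    then show ?thesis using idx_ge[of i r] idx_mem(1)[of r] that by auto
  qed
  define F where "F x = (\<lambda>i\<in>{..<k}. if idx (x 0) = i then 1 else 0 :: real)" for x :: "nat \<Rightarrow> real"
  have [measurable]: "(\<lambda>r. if idx r = i then 1 else 0 :: real) \<in> borel_measurable borel" if "i < k" for i
    unfolding idx_eq[OF that] by measurable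
  have mF: "measurable_simplex_fun 1 k F"
    unfolding measurable_simplex_fun_def
  proof
    show "F \<in> gauss 1 \<rightarrow>\<^sub>M Rn k"
      unfolding F_def[abs_def]
      by (rule measurable_restrict, rule measurable_compose[of "\<lambda>x. x 0" _ borel]) simp_all
    show "F \<in> space (gauss 1) \<rightarrow> prob_simplex k"
      using idx_mem by (auto simp: F_def prob_simplex_def)
  qed
  then interpret F: simplex_fun 1 k F by unfold_locales
  have mean: "(\<integral>x. F x i \<partial>gauss 1) = \<mu> i" if i: "i < k" for i
  proof -
    have "(\<integral>x. F x i \<partial>gauss 1) = (\<integral>r. (if idx r = i then 1 else 0) \<partial>\<N>)"
      using i by (subst integral_gauss_1[symmetric]) (simp_all add: F_def)
    also have "\<dots> = (\<integral>r. indicator {r. idx r = i} r \<partial>\<N>)"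
      by (intro Bochner_Integration.integral_cong) auto
    also have "\<dots> = normal.prob {r. idx r = i}" by simp
    also have "\<dots> = \<mu> i"
    proof (cases "Suc i < k")
      case True
      have "{r. idx r = i} = {r. c i \<le> \<Phi> r} - {r. c (Suc i) \<le> \<Phi> r}"
        using True idx_eq[OF i] by auto
      moreover have "{r. c (Suc i) \<le> \<Phi> r} \<subseteq> {r. c i \<le> \<Phi> r}"
        using c_mono[of i "Suc i"] True by auto
      ultimately have "normal.prob {r. idx r = i} = normal.prob {r. c i \<le> \<Phi> r} - normal.prob {r. c (Suc i) \<le> \<Phi> r}"
        by (simp add: normal.finite_measure_Diff)
      moreover have "c (Suc i) - c i = \<mu> i" by (simp add: c_def)
      ultimately show ?thesis
        using prob_\<Phi>_ge[of "c i"] prob_\<Phi>_ge[of "c (Suc i)"] c_bounds[of i] c_bounds[of "Suc i"] i True by simp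
    next
      case False
      then have "{r. idx r = i} = {r. c i \<le> \<Phi> r}" "Suc i = k" using idx_eq[OF i] i by auto
      then show ?thesis using prob_\<Phi>_ge[of "c i"] c_bounds[of i] i \<mu>_sum by (simp add: c_def flip: \<open>Suc i = k\<close>)
    qed
    finally show ?thesis .
  qed
  have dot: "F.dot x y = (if idx (x 0) = idx (y 0) then 1 else 0)" for x y
  proof -
    have "F.dot x y = (\<Sum>i<k. if idx (x 0) = i then (if idx (x 0) = idx (y 0) then 1 else 0) else 0)"
      unfolding F.dot_def by (intro sum.cong) (auto simp: F_def)
    then show ?thesis using idx_mem(1)[of "x 0"] by (simp add: sum.delta')
  qed
  define near where "near r = (\<Sum>j<k. indicator {r. \<bar>\<Phi> r - c j\<bar> \<le> h} r :: real)" for r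
  have near_nn: "0 \<le> near r" for r by (simp add: near_def sum_nonneg)
  \<comment> \<open>The quadratic term replaces the indicator of a distance above \<open>h\<close>,
    so that only Gaussian second moments have to be computed.\<close>
  have pw: "1 - (r - r')\<^sup>2 / h\<^sup>2 - near r \<le> (if idx r = idx r' then 1 else 0)" for r r'
  proof (cases "idx r = idx r' \<or> h < \<bar>r - r'\<bar>")
    case True
    then show ?thesis
    proof
      assume eq: "idx r = idx r'"
      have "0 \<le> (r - r')\<^sup>2 / h\<^sup>2" by simp
      then have "1 - (r - r')\<^sup>2 / h\<^sup>2 - near r \<le> 1" using near_nn[of r] by linarith
      then show ?thesis using eq by simp
    next
      assume "h < \<bar>r - r'\<bar>"
      then have "h\<^sup>2 \<le> (r - r')\<^sup>2" using h power_mono[of h "\<bar>r - r'\<bar>" 2] by simp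
      then have "1 \<le> (r - r')\<^sup>2 / h\<^sup>2" using h by simp
      then show ?thesis using near_nn[of r] by simp
    qed
  next
    case False
    then obtain j where j: "j < k" "(c j \<le> \<Phi> r) \<noteq> (c j \<le> \<Phi> r')"
      using idx_mem(1)[of r] idx_mem(1)[of r'] idx_ge[of "idx r'" r] idx_ge[of "idx r" r'] idx_ge[of "idx r" r]
        idx_ge[of "idx r'" r'] by (metis linorder_neqE_nat not_le order_refl)
    then have "\<bar>\<Phi> r - c j\<bar> \<le> h" using abs_\<Phi>_diff_le[of r r'] False by (auto simp: abs_le_iff not_le)
    then have "1 \<le> near r"
      unfolding near_def using j
        member_le_sum[of j "{..<k}" "\<lambda>j. indicator {r. \<bar>\<Phi> r - c j\<bar> \<le> h} r :: real"] by simp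
    moreover have "0 \<le> (r - r')\<^sup>2 / h\<^sup>2" by simp
    ultimately have "1 - (r - r')\<^sup>2 / h\<^sup>2 - near r \<le> 0" by linarith
    then show ?thesis using False by simp
  qed
  define s where "s = sqrt (1 - \<rho>\<^sup>2)"
  have s2: "s\<^sup>2 = 1 - \<rho>\<^sup>2" using \<rho> by (simp add: s_def power_le_one)
  note normal_moments [simp]
  have expand: "((1 - \<rho>) * a - s * r)\<^sup>2 = (1 - \<rho>)\<^sup>2 * a\<^sup>2 - 2 * (1 - \<rho>) * a * s * r + s\<^sup>2 * r\<^sup>2" for a r
    by (simp add: power2_eq_square algebra_simps)
  have inner_val: "(\<integral>r. 1 - ((1 - \<rho>) * a - s * r)\<^sup>2 / h\<^sup>2 - near a \<partial>\<N>) =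
    1 - ((1 - \<rho>)\<^sup>2 * a\<^sup>2 + s\<^sup>2) / h\<^sup>2 - near a" for a
    unfolding expand by (simp add: normal.prob_space)
  have inner_int: "integrable \<N> (\<lambda>r. 1 - ((1 - \<rho>) * a - s * r)\<^sup>2 / h\<^sup>2 - near a)" for a
    unfolding expand by simp
  have [measurable]: "near \<in> borel_measurable borel"
    unfolding near_def[abs_def] by measurable
  have near_int: "integrable \<N> near"
    unfolding near_def[abs_def] by (intro Bochner_Integration.integrable_sum) (simp add: normal.emeasure_eq_measure)
  have near_val: "(\<integral>r. near r \<partial>\<N>) \<le> 3 * real k * h"
  proof -
    have "(\<integral>r. near r \<partial>\<N>) = (\<Sum>j<k. normal.prob {r. \<bar>\<Phi> r - c j\<bar> \<le> h})"
      unfolding near_def by (subst Bochner_Integration.integral_sum) (simp_all add: normal.emeasure_eq_measure)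
    also have "\<dots> \<le> (\<Sum>j<k. 3 * h)" by (intro sum_mono prob_\<Phi>_near c_bounds h) auto
    finally show ?thesis by simp
  qed
  have idx2: "(\<lambda>r. if idx a = idx ((1 - (1 - \<rho>)) * a + s * r) then 1 else 0 :: real) \<in> borel_measurable borel" for a
  proof -
    have "(\<lambda>r. if idx r = idx a then 1 else 0 :: real) \<in> borel_measurable borel" using idx_mem(1) by measurable
    then have "(\<lambda>r. if idx ((1 - (1 - \<rho>)) * a + s * r) = idx a then 1 else 0 :: real) \<in> borel_measurable borel"
      by (rule measurable_compose[rotated]) measurable
    then show ?thesis by (simp add: eq_commute)
  qed
  have inner: "1 - ((1 - \<rho>)\<^sup>2 * (x 0)\<^sup>2 + s\<^sup>2) / h\<^sup>2 - near (x 0) \<le> (\<integral>z. F.dot x (ou_point 1 \<rho> x z) \<partial>gauss 1)" for x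
  proof -
    have "(\<integral>z. F.dot x (ou_point 1 \<rho> x z) \<partial>gauss 1) =
      (\<integral>r. (if idx (x 0) = idx ((1 - (1 - \<rho>)) * x 0 + s * r) then 1 else 0) \<partial>\<N>)"
      by (subst integral_gauss_1[OF idx2, symmetric]) (simp add: dot ou_point_def s_def)
    moreover have "(\<integral>r. 1 - ((1 - \<rho>) * x 0 - s * r)\<^sup>2 / h\<^sup>2 - near (x 0) \<partial>\<N>) \<le> \<dots>"
    proof (rule integral_mono[OF inner_int])
      show "integrable \<N> (\<lambda>r. if idx (x 0) = idx ((1 - (1 - \<rho>)) * x 0 + s * r) then 1 else 0 :: real)"
        using idx2 by (intro normal.integrable_bounded[of _ 1]) simp_all
      show "1 - ((1 - \<rho>) * x 0 - s * r)\<^sup>2 / h\<^sup>2 - near (x 0) \<le>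
        (if idx (x 0) = idx ((1 - (1 - \<rho>)) * x 0 + s * r) then 1 else 0)" for r
        using pw[of "x 0" "(1 - (1 - \<rho>)) * x 0 + s * r"] by (simp add: algebra_simps)
    qed
    ultimately show ?thesis unfolding inner_val by simp
  qed
  have "1 - 2 * (1 - \<rho>) / h\<^sup>2 - 3 * real k * h \<le>
    (\<integral>r. 1 - ((1 - \<rho>)\<^sup>2 * r\<^sup>2 + s\<^sup>2) / h\<^sup>2 - near r \<partial>\<N>)"
  proof -
    have "(1 - \<rho>)\<^sup>2 + s\<^sup>2 = 2 * (1 - \<rho>)" unfolding s2 by (simp add: power2_eq_square algebra_simps)
    then show ?thesis using near_int near_val by (simp add: normal.prob_space)
  qed
  also have "\<dots> = (\<integral>x. 1 - ((1 - \<rho>)\<^sup>2 * (x 0)\<^sup>2 + s\<^sup>2) / h\<^sup>2 - near (x 0) \<partial>gauss 1)"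
    by (rule integral_gauss_1[symmetric]) measurable
  also have "\<dots> \<le> noise_stability 1 k \<rho> F"
    unfolding F.\<phi>_eq
  proof (rule integral_mono[OF _ _ inner])
    have "integrable (distr (gauss 1) borel (\<lambda>x. x 0)) (\<lambda>r. 1 - ((1 - \<rho>)\<^sup>2 * r\<^sup>2 + s\<^sup>2) / h\<^sup>2 - near r)"
      unfolding distr_gauss_1 using near_int by simp
    then show "integrable (gauss 1) (\<lambda>x. 1 - ((1 - \<rho>)\<^sup>2 * (x 0)\<^sup>2 + s\<^sup>2) / h\<^sup>2 - near (x 0))"
      by (subst (asm) integrable_distr_eq) simp_all
    show "integrable (gauss 1) (\<lambda>x. \<integral>z. F.dot x (ou_point 1 \<rho> x z) \<partial>gauss 1)"
      by (rule F.integrable_integral_dot)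
  qed
  finally show ?thesis using mF mean by blast
qed

section \<open>Recursive functions\<close>

lemma recursive_fun_comp1:
  assumes "recursive_fun 1 g" "recursive_fun n f" "\<And>a. g [a] = h a"
  shows "recursive_fun n (\<lambda>xs. h (f xs))"
  using recursive_fun.comp[of "[f]" g n] assms by simp

lemma recursive_fun_comp2:
  assumes "recursive_fun 2 g" "recursive_fun n f1" "recursive_fun n f2" "\<And>a b. g [a, b] = h a b"
  shows "recursive_fun n (\<lambda>xs. h (f1 xs) (f2 xs))"
  using recursive_fun.comp[of "[f1, f2]" g n] assms by (simp add: numeral_2_eq_2)

lemma recursive_fun_Suc: "recursive_fun n f \<Longrightarrow> recursive_fun n (\<lambda>xs. Suc (f xs))"
  by (rule recursive_fun_comp1[OF recursive_fun.succ]) simp_all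

lemma recursive_fun_const: "recursive_fun n (\<lambda>_. c)"
  by (induction c) (auto intro: recursive_fun.zero recursive_fun_Suc)

lemma recursive_fun_add:
  assumes "recursive_fun n f" "recursive_fun n g"
  shows "recursive_fun n (\<lambda>xs. f xs + g xs)"
proof (rule recursive_fun_comp2[OF _ assms])
  have "recursive_fun (Suc 1) (\<lambda>xs. rec_nat (tl xs ! 0) (\<lambda>y r. Suc ((r # y # tl xs) ! 0)) (hd xs))"
    by (intro recursive_fun.prec recursive_fun_Suc recursive_fun.proj) simp_all
  then show "recursive_fun 2 (\<lambda>xs. rec_nat (tl xs ! 0) (\<lambda>y r. Suc ((r # y # tl xs) ! 0)) (hd xs))"
    by (simp add: numeral_2_eq_2)
  show "rec_nat (tl [a, b] ! 0) (\<lambda>y r. Suc ((r # y # tl [a, b]) ! 0)) (hd [a, b]) = a + b" for a b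
    by (induction a) auto
qed

lemma recursive_fun_mult:
  assumes "recursive_fun n f" "recursive_fun n g"
  shows "recursive_fun n (\<lambda>xs. f xs * g xs)"
proof (rule recursive_fun_comp2[OF _ assms])
  have "recursive_fun (Suc 1) (\<lambda>xs. rec_nat 0 (\<lambda>y r. (r # y # tl xs) ! 0 + (r # y # tl xs) ! 2) (hd xs))"
    by (intro recursive_fun.prec[of 1 "\<lambda>_. 0" "\<lambda>xs. xs ! 0 + xs ! 2"] recursive_fun_add recursive_fun.proj recursive_fun.zero) simp_all
  then show "recursive_fun 2 (\<lambda>xs. rec_nat 0 (\<lambda>y r. (r # y # tl xs) ! 0 + (r # y # tl xs) ! 2) (hd xs))"
    by (simp add: numeral_2_eq_2)
  show "rec_nat 0 (\<lambda>y r. (r # y # tl [a, b]) ! 0 + (r # y # tl [a, b]) ! 2) (hd [a, b]) = a * b" for a b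
    by (induction a) auto
qed

lemma recursive_fun_pred:
  assumes "recursive_fun n f"
  shows "recursive_fun n (\<lambda>xs. f xs - 1)"
proof (rule recursive_fun_comp1[OF _ assms])
  have "recursive_fun (Suc 0) (\<lambda>xs. rec_nat 0 (\<lambda>y r. (r # y # tl xs) ! 1) (hd xs))"
    by (intro recursive_fun.prec[of 0 "\<lambda>_. 0" "\<lambda>xs. xs ! 1"] recursive_fun.proj recursive_fun.zero) simp_all
  then show "recursive_fun 1 (\<lambda>xs. rec_nat 0 (\<lambda>y r. (r # y # tl xs) ! 1) (hd xs))" by simp
  show "rec_nat 0 (\<lambda>y r. (r # y # tl [a]) ! 1) (hd [a]) = a - 1" for a
    by (cases a) auto
qed

lemma recursive_fun_diff:
  assumes "recursive_fun n f" "recursive_fun n g"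
  shows "recursive_fun n (\<lambda>xs. f xs - g xs)"
\<comment> \<open>Recursion runs on the first entry of the list, and subtraction is iterated over
  the subtrahend; hence the exchanged arguments.\<close>
proof (rule recursive_fun_comp2[OF _ assms(2,1)])
  have "recursive_fun (Suc 1) (\<lambda>xs. rec_nat (tl xs ! 0) (\<lambda>y r. (r # y # tl xs) ! 0 - 1) (hd xs))"
    by (intro recursive_fun.prec recursive_fun_pred recursive_fun.proj) simp_all
  then show "recursive_fun 2 (\<lambda>xs. rec_nat (tl xs ! 0) (\<lambda>y r. (r # y # tl xs) ! 0 - 1) (hd xs))"
    by (simp add: numeral_2_eq_2)
  show "rec_nat (tl [a, b] ! 0) (\<lambda>y r. (r # y # tl [a, b]) ! 0 - 1) (hd [a, b]) = b - a" for a b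
    by (induction a) auto
qed

text \<open>The factor \<open>b\<close> makes the minimisation regular also at \<open>b = 0\<close>, where \<open>a div 0 = 0\<close>.\<close>

lemma div_eq_Least: "(LEAST y. b * (Suc a - Suc y * b) = 0) = a div (b :: nat)"
proof (cases "b = 0")
  case False
  have "(b * (Suc a - Suc y * b) = 0) \<longleftrightarrow> a div b \<le> y" for y
  proof -
    have "(b * (Suc a - Suc y * b) = 0) \<longleftrightarrow> a < Suc y * b" using False by auto
    also have "\<dots> \<longleftrightarrow> a div b < Suc y" using False by (simp only: div_less_iff_less_mult)
    finally show ?thesis unfolding less_Suc_eq_le .
  qed
  then show ?thesis by (simp add: Least_equality)
qed (simp add: Least_equality)

lemma recursive_fun_div:
  assumes "recursive_fun n f" "recursive_fun n g"
  shows "recursive_fun n (\<lambda>xs. f xs div g xs)"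
proof (rule recursive_fun_comp2[OF _ assms])
  define h where "h xs = xs ! 2 * (Suc (xs ! 1) - Suc (xs ! 0) * xs ! 2)" for xs :: "nat list"
  have "recursive_fun (Suc 2) h"
    unfolding h_def by (intro recursive_fun_mult recursive_fun_diff recursive_fun_Suc recursive_fun.proj) simp_all
  moreover have "\<exists>y. h (y # xs) = 0" if "length xs = 2" for xs
  proof -
    obtain a b where xs: "xs = [a, b]"
      using \<open>length xs = 2\<close> by (auto simp: numeral_2_eq_2 length_Suc_conv)
    \<comment> \<open>The quotient never exceeds \<open>a\<close>, so \<open>a\<close> itself is a
      zero; for b = 0 the leading factor vanishes.\<close>
    have "h (a # xs) = 0" by (cases b) (simp_all add: h_def xs)
    then show ?thesis ..
  qed
  ultimately show "recursive_fun 2 (\<lambda>xs. LEAST y. h (y # xs) = 0)"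
    by (intro recursive_fun.mu) blast+
  show "(LEAST y. h (y # [a, b]) = 0) = a div b" for a b
    by (simp add: h_def div_eq_Least[symmetric])
qed

lemma recursive_fun_power:
  "recursive_fun n f \<Longrightarrow> recursive_fun n (\<lambda>xs. f xs ^ m)"
  by (induction m) (auto intro: recursive_fun_const recursive_fun_mult)

section \<open>The approximation theorem\<close>

text \<open>
  For \<open>\<rho> \<le> 1 - 1 / B\<close> and accuracy \<open>1 / A\<close>, correlations may drop by \<open>\<eta> = 1 / (32 A\<^sup>2 B)\<close>. The
  constants are \<open>dim_of A = 80 A (16 / \<eta>)\<^sup>2\<close> and \<open>\<Delta>_of A = 32 / \<eta>\<^sup>2\<close> with \<open>B = 144 A\<^sup>5\<close>, where \<open>B\<close> is
  large enough for \<open>\<rho> = 1 - 1 / B\<close> to replace \<open>\<rho> = 1\<close>.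
\<close>

definition dim_of :: "'a::comm_semiring_1 \<Rightarrow> 'a" where
  "dim_of A = 434865438720 * A ^ 15"

definition \<Delta>_of :: "'a::comm_semiring_1 \<Rightarrow> 'a" where
  "\<Delta>_of A = 679477248 * A ^ 14"

text \<open>The degree required by \<open>kern_tail\<close> for tail level L = 32 A, which makes the
  total loss 2 / L equal to 1 / (16 A).\<close>

definition deg_of :: "'a::comm_semiring_1 \<Rightarrow> 'a" where
  "deg_of A = 4 * \<Delta>_of A * (70 * (dim_of A)\<^sup>2 * \<Delta>_of A + 32 * A)"

text \<open>One formula serves twice: over the naturals it is the computable parameter, over the
  reals the polynomial that bounds it.\<close>

lemma of_nat_dim_of: "of_nat (dim_of A) = dim_of (of_nat A)"
  and of_nat_\<Delta>_of: "of_nat (\<Delta>_of A) = \<Delta>_of (of_nat A)"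
  by (simp_all add: dim_of_def \<Delta>_of_def)

lemma of_nat_deg_of: "of_nat (deg_of A) = deg_of (of_nat A)"
  by (simp only: deg_of_def of_nat_mult of_nat_add of_nat_power of_nat_numeral of_nat_dim_of of_nat_\<Delta>_of)

lemma sum_abs_square_le:
  fixes x :: "nat \<Rightarrow> real"
  shows "(\<Sum>i<k. \<bar>x i\<bar>)\<^sup>2 \<le> real k * (\<Sum>i<k. (x i)\<^sup>2)"
  using Cauchy_Schwarz_ineq_sum[of "\<lambda>_. 1" "\<lambda>i. \<bar>x i\<bar>" "{..<k}"] by simp

text \<open>The mean \<mu> and the stability \<open>S\<close> are parameters, so that the property
  can be passed from a substitute for \<open>f\<close> to \<open>f\<close>. At the origin, which has
  no direction, the polynomial formula claims nothing.\<close>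

definition approximates ::
  "nat \<Rightarrow> nat \<Rightarrow> nat \<Rightarrow> real \<Rightarrow> (nat \<Rightarrow> real) \<Rightarrow> real \<Rightarrow> real \<Rightarrow> ((nat \<Rightarrow> real) \<Rightarrow> nat \<Rightarrow> real) \<Rightarrow> bool" where
  "approximates D d k \<rho> \<mu> S \<epsilon> f' \<longleftrightarrow>
    measurable_simplex_fun D k f' \<and>
    (\<Sum>i<k. \<bar>\<mu> i - (\<integral>x. f' x i \<partial>gauss D)\<bar>) \<le> \<epsilon> \<and>
    noise_stability D k \<rho> f' \<ge> S - \<epsilon> \<and>
    (\<exists>g. poly_map_of_degree D k d g \<and>
      (\<forall>a \<in> space (gauss D). L2_set a {..<D} \<noteq> 0 \<longrightarrow>
        f' a = rounding k (poly_map_eval k g (unit_vector D a))))"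

text \<open>The budget in units of 1 / A: 1 / 4 for the modulus of continuity, 1 / 16 for the kernel
  tails, 1 / 16 for exceptional directions and 1 / 2 for the penalised error of the mean.\<close>

lemma (in simplex_fun) exists_approximation:
  fixes A :: nat
  assumes A: "0 < k" "k \<le> A" "2 \<le> A" and \<rho>: "0 \<le> \<rho>" "\<rho> \<le> 1 - 1 / (144 * real A ^ 5)"
  shows "\<exists>f'. approximates (dim_of A) (deg_of A + 2) k \<rho> mean (\<phi> \<rho>) (1 / real A) f'"
proof -
  define D where "D = dim_of A"
  define d where "d = deg_of A"
  have A0: "0 < real A" and A1: "1 \<le> real A" using A by auto
  interpret projected n k f D d
    using A by unfold_locales (simp add: D_def dim_of_def)
  define B where "B = 144 * real A ^ 5"
  have B: "1 \<le> B" using A1 mult_mono[of 1 144 1 "real A ^ 5"] by (simp add: B_def)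
  define \<eta> where "\<eta> = 1 / (32 * real A ^ 2 * B)"
  \<comment> \<open>Half of the admissible drop \<eta> is spent on the directions, 8 \<kappa> =
    \<eta> / 2, and half on the kernel, whose width \<open>\<Delta>_of A\<close> = 32 / \<eta>^2
    gives 2 sqrt (2 / \<Delta>) = \<eta> / 2.\<close>
  define \<kappa> where "\<kappa> = \<eta> / 16"
  \<comment> \<open>Matched with \<open>N\<close>: 8 \<kappa>' = 1 / sqrt N = 1 / (8 A^4), so each
    part of the mean error, multiplied by \<Lambda> = 2 A^3, costs at most 1 / (4 A).\<close>
  define \<kappa>' where "\<kappa>' = 1 / (64 * real A ^ 4)"
  define N where "N = 64 * A ^ 8"
  define \<Lambda> where "\<Lambda> = 2 * real A ^ 3"
  define c where "c = \<phi> \<rho> - 1 / (4 * real A)"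
  have \<rho>1: "\<rho> \<le> 1"
    using \<rho>(2) A0 by (smt (verit) divide_nonneg_nonneg mult_nonneg_nonneg zero_le_power)
  have D: "real D = 434865438720 * real A ^ 15" by (simp add: D_def dim_of_def)
  define a where "a = real A ^ 7"
  have A14: "real A ^ 14 = a * a" and A15: "real A ^ 15 = a * a * real A"
    by (simp_all add: a_def flip: power_add power_Suc2)
  have a: "0 < a" using A0 by (simp add: a_def)
  have \<eta>_eq: "\<eta> = 1 / (4608 * a)"
    by (simp add: \<eta>_def B_def a_def flip: power_add)
  have \<Delta>: "real (\<Delta>_of A) = 32 / \<eta>\<^sup>2"
    by (simp add: \<Delta>_of_def \<eta>_eq A14 power2_eq_square)
  have \<eta>: "0 < \<eta>" "\<eta> \<le> 1"
  proof -
    show "0 < \<eta>" using A0 B by (simp add: \<eta>_def)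
    have "1 * 1 \<le> (32 * real A ^ 2) * B" using A1 B by (intro mult_mono) (auto simp: mult_ge1_I)
    then show "\<eta> \<le> 1" using A0 B by (simp add: \<eta>_def divide_le_eq_1)
  qed
  have \<kappa>: "0 < \<kappa>" "\<kappa> \<le> 1 / 4" using \<eta> by (simp_all add: \<kappa>_def)
  have \<kappa>': "0 < \<kappa>'" "\<kappa>' \<le> 1 / 4"
  proof -
    have "1 \<le> real A ^ 4" using A1 by (rule one_le_power)
    then have "4 \<le> 64 * real A ^ 4" by linarith
    then show "\<kappa>' \<le> 1 / 4" unfolding \<kappa>'_def using A0 by (intro divide_left_mono) simp_all
  qed (use A0 in \<open>simp add: \<kappa>'_def\<close>)
  have N: "0 < N" "real N * (8 * \<kappa>')\<^sup>2 \<le> 1"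
    using A by (simp_all add: N_def \<kappa>'_def power_divide power_mult_distrib flip: power_mult)
  have \<tau>: "\<rho> - \<eta> \<le> \<rho> - 8 * \<kappa> - 2 * sqrt (2 * (1 / real (\<Delta>_of A)))"
  proof -
    have "2 * (1 / real (\<Delta>_of A)) = (\<eta> / 4)\<^sup>2" by (simp add: \<Delta> power_divide)
    then have "sqrt (2 * (1 / real (\<Delta>_of A))) = \<eta> / 4" using \<eta> by (simp only: real_sqrt_abs)
    then show ?thesis by (simp add: \<kappa>_def)
  qed
  have c: "c \<le> 1"
  proof -
    have "0 \<le> 1 / (4 * real A)" by simp
    then show ?thesis using \<phi>_le_1[of \<rho>] unfolding c_def by linarith
  qed
  have low: "c \<le> \<phi> t" if "\<rho> - \<eta> \<le> t" "t \<le> 1" for t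
    unfolding c_def using that \<rho> B A by (intro \<phi>_modulus[of \<rho> B A t]) (auto simp: \<eta>_def B_def)
  have dd: "d = 4 * \<Delta>_of A * (70 * D\<^sup>2 * \<Delta>_of A + 32 * A)" by (simp add: d_def deg_of_def D_def)
  have "\<kappa>\<^sup>2 * real D = 80 * real A"
    using a by (simp add: \<kappa>_def \<eta>_eq D A15 power2_eq_square)
  then have e1: "5 / (\<kappa>\<^sup>2 * real D) = 1 / (16 * real A)" by simp
  have e2: "1 / sqrt (real N) = 1 / (8 * real A ^ 4)"
  proof -
    have "(8 * real A ^ 4)\<^sup>2 = real N" by (simp add: N_def power_mult_distrib flip: power_mult)
    then have "sqrt (real N) = 8 * real A ^ 4" by (rule real_sqrt_unique) simp
    then show ?thesis by simp
  qed
  have e3: "5 / (\<kappa>'\<^sup>2 * real D) \<le> 1 / (8 * real A ^ 4)"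
  proof -
    define b where "b = real A ^ 4"
    have b: "0 < b" "\<kappa>' = 1 / (64 * b)" using A0 by (simp_all add: b_def \<kappa>'_def)
    have "real A ^ 15 = b * b * a" by (simp add: a_def b_def flip: power_add)
    then have "\<kappa>'\<^sup>2 * real D = 106168320 * a"
      using b by (simp add: D power2_eq_square)
    then have "\<kappa>'\<^sup>2 * real D = 106168320 * real A ^ 7" by (simp only: a_def)
    then have "5 / (\<kappa>'\<^sup>2 * real D) = 1 / (21233664 * real A ^ 7)" by simp
    also have "\<dots> \<le> 1 / (8 * real A ^ 4)"
      using A0 A1 power_increasing[of 4 7 "real A"] by (intro divide_left_mono mult_mono) auto
    finally show ?thesis .
  qed
  obtain M where M: "M \<in> space (gmat n D)"
    and good: "c - 2 / real (32 * A) - 5 / (\<kappa>\<^sup>2 * real D) - \<Lambda> * (1 / sqrt (real N) + 5 / (\<kappa>'\<^sup>2 * real D))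
      \<le> noise_stability D k \<rho> (proj M) - \<Lambda> * (\<Sum>i<k. (emp_mean i M - mean i)\<^sup>2)"
    using exists_good_proj[OF _ _ dd c low \<rho>(1) \<rho>1 \<kappa> \<tau> \<kappa>' N, of \<Lambda>] A by (auto simp: \<Lambda>_def \<Delta>_of_def)
  define V where "V = (\<Sum>i<k. (emp_mean i M - mean i)\<^sup>2)"
  have V: "0 \<le> V" by (simp add: V_def sum_nonneg)
  have "\<Lambda> * (1 / sqrt (real N) + 5 / (\<kappa>'\<^sup>2 * real D)) \<le> \<Lambda> * (1 / (8 * real A ^ 4) + 1 / (8 * real A ^ 4))"
    using e3 by (intro mult_left_mono) (auto simp: e2 \<Lambda>_def)
  also have "\<dots> = 1 / (2 * real A)"
  proof -
    have "real A ^ 4 = real A ^ 3 * real A" by (simp flip: power_Suc2)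
    then show ?thesis using A0 by (simp add: \<Lambda>_def field_simps)
  qed
  finally have dev: "\<Lambda> * (1 / sqrt (real N) + 5 / (\<kappa>'\<^sup>2 * real D)) \<le> (1 / real A) / 2" by simp
  have frac: "2 / real (32 * A) = (1 / real A) / 16" "1 / (16 * real A) = (1 / real A) / 16"
    "1 / (4 * real A) = (1 / real A) / 4" "0 \<le> 1 / real A" by simp_all
  have stab: "\<phi> \<rho> - 1 / real A + \<Lambda> * V \<le> noise_stability D k \<rho> (proj M)"
  proof -
    have lin: "p - e / 4 - e / 16 - e / 16 - X \<le> s - v \<Longrightarrow> X \<le> e / 2 \<Longrightarrow> 0 \<le> e \<Longrightarrow> p - e + v \<le> s"
      for p e X s v :: real by linarith
    show ?thesis
      by (rule lin[OF good[unfolded e1 c_def V_def[symmetric] frac(1-3)] dev frac(4)])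
  qed
  interpret P: simplex_fun D k "proj M" by unfold_locales (rule proj_simplex_fun[OF M])
  \<comment> \<open>Stability is at most 1 and \<open>\<phi>\<close> is nonnegative, so the penalty
    is at most 1 + 1 / A. This gives V \<le> 1 / A^3, and passing from squares to absolute values
    costs a factor k \<le> A.\<close>
  have "\<Lambda> * V \<le> 2"
    using stab \<phi>_nonneg[of \<rho>] P.\<phi>_le_1[of \<rho>] A1 by (smt (verit) divide_le_eq_1)
  then have "real A ^ 3 * V \<le> 1" by (simp add: \<Lambda>_def)
  have "(\<Sum>i<k. \<bar>emp_mean i M - mean i\<bar>)\<^sup>2 \<le> real k * V" unfolding V_def by (rule sum_abs_square_le)
  also have "\<dots> \<le> real A * V" using A V by (intro mult_right_mono) auto
  also have "\<dots> = (real A ^ 3 * V) / real A ^ 2"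
    using A0 by (simp add: power3_eq_cube power2_eq_square)
  also have "\<dots> \<le> (1 / real A)\<^sup>2"
    using \<open>real A ^ 3 * V \<le> 1\<close> by (simp add: power_divide divide_right_mono)
  finally have "(\<Sum>i<k. \<bar>emp_mean i M - mean i\<bar>) \<le> 1 / real A"
    by (rule power2_le_imp_le) simp
  moreover have "\<phi> \<rho> - 1 / real A \<le> noise_stability D k \<rho> (proj M)"
  proof -
    have "0 \<le> \<Lambda> * V" using V by (simp add: \<Lambda>_def)
    then show ?thesis using stab by linarith
  qed
  moreover obtain g where "poly_map_of_degree D k (d + 2) g"
    "\<And>a. ip D a a \<noteq> 0 \<Longrightarrow> poly_map_eval k g (unit_vector D a) = proj M a"
    using proj_polynomial[OF M A(1)] by blast
  moreover have "rounding k (proj M a) = proj M a" if "a \<in> space (gauss D)" for a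
    using P.f_simplex that by (intro rounding_simplex) (simp add: space_gauss)
  ultimately have "approximates D (d + 2) k \<rho> mean (\<phi> \<rho>) (1 / real A) (proj M)"
    unfolding approximates_def using P.msf integral_proj[OF M]
    by (auto simp: L2_set_ip abs_minus_commute intro!: exI[of _ g])
  then show ?thesis unfolding D_def d_def by blast
qed

lemma approximates_weaken:
  assumes "approximates D d k \<rho> \<mu> S \<epsilon> f'" "\<epsilon> \<le> \<epsilon>'"
    and "S' - \<epsilon>' \<le> noise_stability D k \<rho>' f'" and "\<And>i. i < k \<Longrightarrow> \<mu> i = \<mu>' i"
  shows "approximates D d k \<rho>' \<mu>' S' \<epsilon>' f'"
  using assms by (auto simp: approximates_def)

text \<open>For \<rho> = 1 the function is compared with the trivial bound 1 rather than with its
  values at smaller correlations. The substitute is nearly optimal at some \<rho>' < 1, is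
  approximated there, and monotonicity of the stability of the approximation leads back to
  1.\<close>

lemma (in simplex_fun) exists_approximation_all:
  fixes A :: nat
  assumes A: "k \<le> A" "2 \<le> A" and \<rho>: "0 \<le> \<rho>" "\<rho> \<le> 1" "\<rho> < 1 \<Longrightarrow> 1 / (1 - \<rho>) \<le> real A"
  shows "\<exists>f'. approximates (dim_of A) (deg_of A + 2) k \<rho> mean (\<phi> \<rho>) (2 / real A) f'"
proof -
  have A1: "1 \<le> real A" using A by simp
  have k: "0 < k" using f_simplex[of "\<lambda>_\<in>{..<n}. 0"] by (cases k) (auto simp: prob_simplex_def)
  define B where "B = 144 * real A ^ 5"
  have AB: "real A \<le> B"
    using A1 mult_mono[of 1 144 "real A" "real A ^ 5"] power_increasing[of 1 5 "real A"] by (simp add: B_def)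
  show ?thesis
  proof (cases "\<rho> = 1")
    case False
    then have "\<rho> < 1" using \<rho> by simp
    then have "1 / (1 - \<rho>) \<le> B" using \<rho>(3) AB by simp
    then have "\<rho> \<le> 1 - 1 / B" using \<open>\<rho> < 1\<close> A1 AB by (simp add: field_simps)
    then obtain f' where f': "approximates (dim_of A) (deg_of A + 2) k \<rho> mean (\<phi> \<rho>) (1 / real A) f'"
      using exists_approximation[OF k A \<rho>(1)] unfolding B_def by blast
    moreover have "1 / real A \<le> 2 / real A" by (rule divide_right_mono) auto
    moreover then have "\<phi> \<rho> - 2 / real A \<le> noise_stability (dim_of A) k \<rho> f'"
      using f' unfolding approximates_def by linarith
    ultimately show ?thesis using approximates_weaken by blast
  next
    case True
    define \<rho>' where "\<rho>' = 1 - 1 / B"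
    \<comment> \<open>Balances the two losses of the partition: 2 / (B h^2) = 1 / (2 A) for B = 144
      A^5, and 3 k h \<le> 1 / (2 A).\<close>
    define h where "h = 1 / (6 * real A ^ 2)"
    have \<rho>': "0 \<le> \<rho>'" "\<rho>' \<le> 1" using AB A1 by (simp_all add: \<rho>'_def)
    have h: "0 < h" using A1 by (simp add: h_def)
    have \<mu>: "(\<lambda>i\<in>{..<k}. mean i) \<in> prob_simplex k"
      using mean_bounds sum_mean by (auto simp: prob_simplex_def)
    obtain F where F: "measurable_simplex_fun 1 k F" "\<And>i. i < k \<Longrightarrow> (\<integral>x. F x i \<partial>gauss 1) = mean i"
      "1 - 2 * (1 - \<rho>') / h\<^sup>2 - 3 * real k * h \<le> noise_stability 1 k \<rho>' F"
      using exists_stable_partition[OF \<mu> \<rho>' h] by auto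
    have "real A ^ 5 = real A ^ 2 * real A ^ 2 * real A" by (simp flip: power_add power_Suc2)
    then have "2 * (1 - \<rho>') / h\<^sup>2 = 1 / (2 * real A)"
      using A1 by (simp add: \<rho>'_def h_def B_def power2_eq_square[of "1 / _"])
    moreover have "3 * real k * h \<le> 3 * real A * h" using A h by (intro mult_right_mono) auto
    moreover have "3 * real A * h = 1 / (2 * real A)"
      using A1 by (simp add: h_def power2_eq_square)
    ultimately have stabF: "1 - 1 / real A \<le> noise_stability 1 k \<rho>' F" using F(3) by (simp add: field_simps)
    interpret F: simplex_fun 1 k F by unfold_locales (rule F(1))
    obtain f' where f': "approximates (dim_of A) (deg_of A + 2) k \<rho>' F.mean (F.\<phi> \<rho>') (1 / real A) f'"
      using F.exists_approximation[OF k A \<rho>'(1)] unfolding \<rho>'_def B_def by blast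
    interpret f': simplex_fun "dim_of A" k f' using f' by unfold_locales (simp add: approximates_def)
    have "\<phi> \<rho> - 2 / real A \<le> F.\<phi> \<rho>' - 1 / real A"
      using \<phi>_le_1[of \<rho>] stabF by (simp add: field_simps)
    also have "\<dots> \<le> f'.\<phi> \<rho>'" using f' by (simp add: approximates_def)
    also have "\<dots> \<le> f'.\<phi> \<rho>" using f'.\<phi>_mono \<rho>' True by simp
    finally have "\<phi> \<rho> - 2 / real A \<le> f'.\<phi> \<rho>" .
    moreover have "1 / real A \<le> 2 / real A" by (rule divide_right_mono) auto
    moreover have "F.mean i = mean i" if "i < k" for i using F(2)[OF that] by (simp only: F.mean_def)
    ultimately show ?thesis using approximates_weaken[OF f'] by blast
  qed
qed

section \<open>The accuracy parameter and its computability\<close>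

definition acc_param :: "real \<Rightarrow> nat \<Rightarrow> real \<Rightarrow> nat" where
  "acc_param \<rho> k \<epsilon> = 2 * (k + nat \<lfloor>1 / (1 - \<rho>)\<rfloor> + nat \<lfloor>1 / \<epsilon>\<rfloor> + 2)"

lemma computable_param_acc:
  assumes "\<And>n f. recursive_fun n f \<Longrightarrow> recursive_fun n (\<lambda>xs. h (f xs))"
  shows "computable_param (\<lambda>\<rho> k \<epsilon>. h (acc_param \<rho> k \<epsilon>))"
proof -
  define a where "a xs = 2 * (xs ! 2 + xs ! 1 div (xs ! 1 - xs ! 0) + xs ! 4 div xs ! 3 + 2)" for xs :: "nat list"
  have "recursive_fun 5 a"
    unfolding a_def
    by (intro recursive_fun_mult recursive_fun_add recursive_fun_div recursive_fun_diff recursive_fun_const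
      recursive_fun.proj) simp_all
  then have "recursive_fun 5 (\<lambda>xs. h (a xs))" by (rule assms)
  moreover have "acc_param (real p / real q) k (real r / real s) = a [p, q, k, r, s]"
    if "0 < q" "p \<le> q" "0 < r" "0 < s" for p q k r s
  proof -
    \<comment> \<open>Also true for p = q, where both sides are 0; natural division by 0 likewise
      returns 0, so \<rho> = 1 needs no case distinction.\<close>
    have "1 / (1 - real p / real q) = real q / real (q - p)"
      using that by (simp add: of_nat_diff field_simps)
    moreover have "1 / (real r / real s) = real s / real r" by simp
    ultimately show ?thesis
      by (simp add: acc_param_def a_def floor_divide_of_nat_eq)
  qed
  ultimately show ?thesis unfolding computable_param_def by metis
qed

lemma real_polynomial_function_acc:
  "real_polynomial_function (\<lambda>x :: real \<times> real \<times> real. 2 * (fst x + fst (snd x) + snd (snd x) + 2))"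
  by (intro real_polynomial_function.intros bounded_linear_fst bounded_linear_compose[OF bounded_linear_fst bounded_linear_snd]
    bounded_linear_compose[OF bounded_linear_snd bounded_linear_snd])

lemma acc_param_le:
  assumes "\<rho> < 1" "0 < \<epsilon>"
  shows "real (acc_param \<rho> k \<epsilon>) \<le> 2 * (real k + 1 / (1 - \<rho>) + 1 / \<epsilon> + 2)"
proof -
  have "real (nat \<lfloor>1 / (1 - \<rho>)\<rfloor>) \<le> 1 / (1 - \<rho>)" "real (nat \<lfloor>1 / \<epsilon>\<rfloor>) \<le> 1 / \<epsilon>"
    using assms by simp_all
  then show ?thesis by (simp add: acc_param_def)
qed

theorem theorem1p1:
  "\<exists>(n0 :: real \<Rightarrow> nat \<Rightarrow> real \<Rightarrow> nat) (d0 :: real \<Rightarrow> nat \<Rightarrow> real \<Rightarrow> nat)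
     (P :: real \<times> real \<times> real \<Rightarrow> real) (Q :: real \<times> real \<times> real \<Rightarrow> real).
     computable_param n0 \<and> computable_param d0 \<and>
     real_polynomial_function P \<and> real_polynomial_function Q \<and>
     (\<forall>(k::nat) (\<rho>::real) (\<epsilon>::real). 2 \<le> k \<longrightarrow> 0 \<le> \<rho> \<longrightarrow> \<rho> \<le> 1 \<longrightarrow> 0 < \<epsilon> \<longrightarrow>
        0 < n0 \<rho> k \<epsilon> \<and>
        (\<rho> < 1 \<longrightarrow> real (n0 \<rho> k \<epsilon>) \<le> exp (P (real k, 1 / (1 - \<rho>), 1 / \<epsilon>))) \<and>
        (\<rho> < 1 \<longrightarrow> real (d0 \<rho> k \<epsilon>) \<le> Q (real k, 1 / (1 - \<rho>), 1 / \<epsilon>)) \<and>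
        (\<forall>(n::nat) f. measurable_simplex_fun n k f \<longrightarrow>
           (\<exists>f'. measurable_simplex_fun (n0 \<rho> k \<epsilon>) k f' \<and>
              (\<Sum>i<k. \<bar>(\<integral>x. f x i \<partial>gauss n) - (\<integral>x. f' x i \<partial>gauss (n0 \<rho> k \<epsilon>))\<bar>) \<le> \<epsilon> \<and>
              noise_stability (n0 \<rho> k \<epsilon>) k \<rho> f' \<ge> noise_stability n k \<rho> f - \<epsilon> \<and>
              (\<exists>g. poly_map_of_degree (n0 \<rho> k \<epsilon>) k (d0 \<rho> k \<epsilon>) g \<and>
                 (\<forall>a \<in> space (gauss (n0 \<rho> k \<epsilon>)). L2_set a {..<n0 \<rho> k \<epsilon>} \<noteq> 0 \<longrightarrow>
                    f' a = rounding k (poly_map_eval k g (unit_vector (n0 \<rho> k \<epsilon>) a)))))))"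
proof -
  define a where "a x = 2 * (fst x + fst (snd x) + snd (snd x) + 2)" for x :: "real \<times> real \<times> real"
  have a_poly: "real_polynomial_function a"
    unfolding a_def by (rule real_polynomial_function_acc)
  have comp: "computable_param (\<lambda>\<rho> k \<epsilon>. dim_of (acc_param \<rho> k \<epsilon>))"
    "computable_param (\<lambda>\<rho> k \<epsilon>. deg_of (acc_param \<rho> k \<epsilon>) + 2)"
    unfolding deg_of_def dim_of_def \<Delta>_of_def
    by (rule computable_param_acc, intro recursive_fun_add recursive_fun_mult recursive_fun_power recursive_fun_const, assumption?)+
  have poly: "real_polynomial_function (\<lambda>x. dim_of (a x))" "real_polynomial_function (\<lambda>x. deg_of (a x) + 2)"
    unfolding deg_of_def dim_of_def \<Delta>_of_def
    by (intro real_polynomial_function.intros(2-4) real_polynomial_function_power a_poly)+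
  have main: "0 < dim_of (acc_param \<rho> k \<epsilon>) \<and>
      (\<rho> < 1 \<longrightarrow> real (dim_of (acc_param \<rho> k \<epsilon>)) \<le> exp (dim_of (a (real k, 1 / (1 - \<rho>), 1 / \<epsilon>)))) \<and>
      (\<rho> < 1 \<longrightarrow> real (deg_of (acc_param \<rho> k \<epsilon>) + 2) \<le> deg_of (a (real k, 1 / (1 - \<rho>), 1 / \<epsilon>)) + 2) \<and>
      (\<forall>n f. measurable_simplex_fun n k f \<longrightarrow>
        (\<exists>f'. approximates (dim_of (acc_param \<rho> k \<epsilon>)) (deg_of (acc_param \<rho> k \<epsilon>) + 2) k \<rho>
          (\<lambda>i. \<integral>x. f x i \<partial>gauss n) (noise_stability n k \<rho> f) \<epsilon> f'))"
    if k: "2 \<le> k" and \<rho>: "0 \<le> \<rho>" "\<rho> \<le> 1" and \<epsilon>: "0 < \<epsilon>" for k \<rho> \<epsilon>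
  proof (intro conjI impI allI)
    let ?A = "acc_param \<rho> k \<epsilon>" and ?a = "a (real k, 1 / (1 - \<rho>), 1 / \<epsilon>)"
    show "0 < dim_of ?A" by (simp add: dim_of_def acc_param_def)
    show "real (dim_of ?A) \<le> exp (dim_of ?a)" if "\<rho> < 1"
    proof -
      have le: "real ?A \<le> ?a" using acc_param_le[OF that \<epsilon>, of k] by (simp add: a_def)
      have "real (dim_of ?A) \<le> dim_of ?a"
        unfolding of_nat_dim_of unfolding dim_of_def using le by (intro mult_left_mono power_mono) auto
      \<comment> \<open>The dimension itself is polynomial in the parameters; the exponential bound
        follows from x \<le> e^x.\<close>
      then show ?thesis using exp_ge_add_one_self[of "dim_of ?a"] by linarith
    qed
    show "real (deg_of ?A + 2) \<le> deg_of ?a + 2" if "\<rho> < 1"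
    proof -
      have le: "real ?A \<le> ?a" using acc_param_le[OF that \<epsilon>, of k] by (simp add: a_def)
      have "deg_of (real ?A) \<le> deg_of ?a"
        unfolding deg_of_def dim_of_def \<Delta>_of_def using le
        by (intro mult_mono add_mono power_mono mult_nonneg_nonneg add_nonneg_nonneg zero_le_power) auto
      then show ?thesis by (simp add: of_nat_deg_of)
    qed
    fix n f assume "measurable_simplex_fun n k f"
    then interpret simplex_fun n k f by unfold_locales
    have "k \<le> ?A" "2 \<le> ?A" by (simp_all add: acc_param_def)
    moreover have "1 / (1 - \<rho>) \<le> real ?A" if "\<rho> < 1"
    proof -
      have "1 / (1 - \<rho>) \<le> real (nat \<lfloor>1 / (1 - \<rho>)\<rfloor>) + 1" by linarith
      then show ?thesis by (simp add: acc_param_def)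
    qed
    ultimately obtain f' where f': "approximates (dim_of ?A) (deg_of ?A + 2) k \<rho> mean (\<phi> \<rho>) (2 / real ?A) f'"
      using exists_approximation_all[of ?A \<rho>] \<rho> by blast
    \<comment> \<open>The factor 2 in \<open>acc_param\<close> compensates the 2 in the accuracy 2 /
      A, and its constant summand makes up for rounding 1 / \<epsilon> down.\<close>
    have le: "2 / real ?A \<le> \<epsilon>"
    proof -
      have "1 / \<epsilon> \<le> real (nat \<lfloor>1 / \<epsilon>\<rfloor>) + 1" by linarith
      then have "2 * (1 / \<epsilon>) \<le> real ?A" by (simp add: acc_param_def)
      moreover have "0 < real ?A" by (simp add: acc_param_def)
      ultimately show ?thesis using \<epsilon> by (simp add: field_simps)
    qed
    have "\<phi> \<rho> - \<epsilon> \<le> noise_stability (dim_of ?A) k \<rho> f'"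
      using f' le by (simp add: approximates_def)
    note weaken = approximates_weaken[OF f' le this]
    show "\<exists>f'. approximates (dim_of ?A) (deg_of ?A + 2) k \<rho> (\<lambda>i. \<integral>x. f x i \<partial>gauss n) (\<phi> \<rho>) \<epsilon> f'"
      by (rule exI[of _ f'], rule weaken) (simp only: mean_def)
  qed
  show ?thesis
    by (rule exI[of _ "\<lambda>\<rho> k \<epsilon>. dim_of (acc_param \<rho> k \<epsilon>)"],
      rule exI[of _ "\<lambda>\<rho> k \<epsilon>. deg_of (acc_param \<rho> k \<epsilon>) + 2"],
      rule exI[of _ "\<lambda>x. dim_of (a x)"], rule exI[of _ "\<lambda>x. deg_of (a x) + 2"],
      intro conjI comp poly, intro allI impI, rule main[unfolded approximates_def])
qed

end
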